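(* Let $p$ be a prime number, $K$ a field of characteristic $p$, $n\geq 1$, and $L_n=K[x_1^{\pm 1},\ldots,x_n^{\pm 1}]$. Then the group $\mathrm{Aut}_{ord}(\mathcal{D}(L_n))$ of order preserving $K$-algebra automorphisms of $\mathcal{D}(L_n)$ is isomorphic to a semidirect product $\mathbb{Z}_p^n\rtimes \mathrm{Aut}_K(L_n)$ (with $\mathbb{Z}_p^n$ the normal factor). Moreover, each automorphism $\sigma\in \mathrm{Aut}_{ord}(\mathcal{D}(L_n))$ is a unique product of two automorphisms $\sigma=\sigma_s\tau$, where $\tau\in \mathrm{Aut}_K(L_n)$ (regarded as an automorphism of $\mathcal{D}(L_n)$), $s=(s_i)\in\mathbb{Z}_p^n$, $\sigma_s(x_i)=x_i$ for all $i$, and $$\sigma_s(\partial^{[\alpha]})=\prod_{i=1}^n\frac{(\partial_i+s_ix_i^{-1})^{\alpha_i}}{\alpha_i!},\qquad \alpha=(\alpha_i)\in\mathbb{N}^n.$$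
   Context: $\mathbb{N}=\{0,1,\ldots\}$; $\mathbb{Z}_p$ is the ring of $p$-adic integers (with $\mathbb{Z}_p^n$ viewed as an additive group). $\mathcal{D}(L_n)$ is the ring of $K$-linear differential operators on the commutative $K$-algebra $L_n$. It is a $K$-subalgebra of $\mathrm{End}_K(L_n)$ and $\mathcal{D}(L_n)=\bigoplus_{\alpha\in\mathbb{N}^n}L_n\partial^{[\alpha]}$, where $\partial^{[\alpha]}=\prod_{i=1}^n\frac{\partial_i^{\alpha_i}}{\alpha_i!}$ is the $K$-linear operator on $L_n$ with $\partial^{[\alpha]}(x^\beta)=\prod_i\binom{\beta_i}{\alpha_i}x^{\beta-\alpha}$ for $\beta\in\mathbb{Z}^n$, and elements of $L_n$ act by multiplication. The order filtration is $\mathcal{D}(L_n)_i=\bigoplus_{|\alpha|\leq i}L_n\partial^{[\alpha]}$, $i\geq 0$, where $|\alpha|=\alpha_1+\cdots+\alpha_n$, and $$\mathrm{Aut}_{ord}(\mathcal{D}(L_n))=\{\sigma\in\mathrm{Aut}_K(\mathcal{D}(L_n)) \mid \sigma(\mathcal{D}(L_n)_i)=\mathcal{D}(L_n)_i,\ i\geq 0\},$$ where $\mathrm{Aut}_K$ denotes the group of $K$-algebra automorphisms. The group $\mathrm{Aut}_K(L_n)$ is regarded as a subgroup of $\mathrm{Aut}_K(\mathcal{D}(L_n))$: $\tau\in\mathrm{Aut}_K(L_n)$ acts by $a\mapsto\tau a\tau^{-1}$, $a\in\mathcal{D}(L_n)\subseteq \mathrm{End}_K(L_n)$. Meaning of the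 expression in the claim: for $s\in\mathbb{Z}_p^n$ and $\alpha\in\mathbb{N}^n$, over $\mathbb{Z}_p$ one has the $\mathbb{Z}_p$-linear differential operator on $\mathbb{Z}_p[x_1^{\pm1},\ldots,x_n^{\pm1}]$ $$\prod_{i=1}^n\frac{(\partial_i+s_ix_i^{-1})^{\alpha_i}}{\alpha_i!}=\prod_{i=1}^n x_i^{-\alpha_i}\binom{x_i\partial_i+s_i}{\alpha_i},\qquad \binom{t}{j}=\frac{t(t-1)\cdots(t-j+1)}{j!},\quad \binom{t}{0}=1,$$ which sends $x^\beta$ to $\prod_i\binom{\beta_i+s_i}{\alpha_i}x^{\beta-\alpha}$ for $\beta\in\mathbb{Z}^n$. The expression in the claim denotes the element of $\mathcal{D}(L_n)$ obtained from it by reducing modulo $p$ and extending scalars from $\mathbb{F}_p$ to $K$. For each $s\in\mathbb{Z}_p^n$ the formulas for $\sigma_s$ define a $K$-algebra automorphism of $\mathcal{D}(L_n)$. *)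

theory Defs
  imports
    "HOL-Analysis.Finite_Cartesian_Product"
    "HOL-Computational_Algebra.Primes"
    "HOL-Library.Poly_Mapping"
    "HOL-Algebra.Bij"
    "HOL-Algebra.Module"
    "HOL-Algebra.Product_Groups"
begin

section \<open>Algebras, their automorphism groups, semidirect products\<close>

text \<open>
  A \<open>K\<close>-algebra is represented by a record of type \<^typ>\<open>('k, 'a) module\<close>, the scalars being the
  elements of the type \<open>'k\<close>. As in \<^const>\<open>AutoGroup\<close>, automorphisms are extensional functions,
  so that equality of automorphisms is equality on the carrier.
\<close>

definition alg_auts :: "('k, 'a) module \<Rightarrow> ('a \<Rightarrow> 'a) set" where
  "alg_auts A = {\<sigma> \<in> Bij (carrier A) \<inter> ring_hom A A.
     \<forall>c. \<forall>a \<in> carrier A. \<sigma> (c \<odot>\<^bsub>A\<^esub> a) = c \<odot>\<^bsub>A\<^esub> \<sigma> a}"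

definition AlgAut :: "('k, 'a) module \<Rightarrow> ('a \<Rightarrow> 'a) monoid" where
  "AlgAut A = BijGroup (carrier A)\<lparr>carrier := alg_auts A\<rparr>"

text \<open>
  The external semidirect product for an action \<open>\<phi>\<close> of \<open>H\<close> on \<open>N\<close> by automorphisms, i.e. for
  \<open>\<phi> \<in> hom H (AutoGroup N)\<close>; the first factor is the normal one.
\<close>

definition semidirect_product ::
    "('a, 'm) monoid_scheme \<Rightarrow> ('b, 'l) monoid_scheme \<Rightarrow> ('b \<Rightarrow> 'a \<Rightarrow> 'a) \<Rightarrow> ('a \<times> 'b) monoid" where
  "semidirect_product N H \<phi> =
     \<lparr>carrier = carrier N \<times> carrier H,
      mult = (\<lambda>(a, g) (b, h). (a \<otimes>\<^bsub>N\<^esub> \<phi> g b, g \<otimes>\<^bsub>H\<^esub> h)),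
      one = (\<one>\<^bsub>N\<^esub>, \<one>\<^bsub>H\<^esub>)\<rparr>"


section \<open>Laurent polynomials and their differential operators\<close>

text \<open>
  The Laurent polynomial algebra over \<open>'k\<close> in variables indexed by \<open>'n\<close>, as the group algebra of
  the group \<open>int ^ 'n\<close> of exponents: \<^term>\<open>Poly_Mapping.single \<beta> c\<close> is the term with exponent
  vector \<open>\<beta>\<close> and coefficient \<open>c\<close>, and multiplication is convolution.
\<close>

type_synonym ('k, 'n) laurent = "(int, 'n) vec \<Rightarrow>\<^sub>0 'k"

definition laurent_const :: "'k::field \<Rightarrow> ('k, 'n::finite) laurent" where
  "laurent_const c = Poly_Mapping.single 0 c"

definition laurent_var :: "'n \<Rightarrow> ('k::field, 'n::finite) laurent" where
  "laurent_var i = Poly_Mapping.single (axis i 1) 1"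

definition laurent_alg :: "('k::field, ('k, 'n::finite) laurent) module" where
  "laurent_alg = \<lparr>carrier = UNIV, mult = (*), one = 1, zero = 0, add = (+),
     smult = (\<lambda>c f. laurent_const c * f)\<rparr>"

definition laurent_endos :: "(('k::field, 'n::finite) laurent \<Rightarrow> ('k, 'n) laurent) set" where
  "laurent_endos = {u. (\<forall>f g. u (f + g) = u f + u g) \<and>
     (\<forall>c f. u (laurent_const c * f) = laurent_const c * u f)}"

text \<open>
  Differential operators of order at most \<open>m\<close> in the sense of Grothendieck. The function
  \<open>\<lambda>f. a * u f - u (a * f)\<close> is the commutator of \<open>u\<close> with multiplication by \<open>a\<close>.
\<close>

primrec diff_ops_le :: "nat \<Rightarrow> (('k::field, 'n::finite) laurent \<Rightarrow> ('k, 'n) laurent) set" where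
  "diff_ops_le 0 = {u \<in> laurent_endos. \<forall>a. (\<lambda>f. a * u f - u (a * f)) = (\<lambda>_. 0)}"
| "diff_ops_le (Suc m) = {u \<in> laurent_endos. \<forall>a. (\<lambda>f. a * u f - u (a * f)) \<in> diff_ops_le m}"

definition diff_ops :: "(('k::field, 'n::finite) laurent \<Rightarrow> ('k, 'n) laurent) set" where
  "diff_ops = (\<Union>m. diff_ops_le m)"

definition diff_alg :: "('k::field, ('k, 'n::finite) laurent \<Rightarrow> ('k, 'n) laurent) module" where
  "diff_alg = \<lparr>carrier = diff_ops, mult = (\<circ>), one = id, zero = (\<lambda>_. 0),
     add = (\<lambda>u v f. u f + v f), smult = (\<lambda>c u f. laurent_const c * u f)\<rparr>"

definition mult_op :: "('k::field, 'n::finite) laurent \<Rightarrow> ('k, 'n) laurent \<Rightarrow> ('k, 'n) laurent" where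
  "mult_op a = (\<lambda>f. a * f)"

text \<open>
  The linear operator sending the monomial with exponent \<open>\<beta>\<close> to \<open>c \<beta>\<close> times the monomial with
  exponent \<open>\<beta> - \<alpha>\<close>.
\<close>

definition monomial_op ::
    "nat ^ 'n \<Rightarrow> (int ^ 'n \<Rightarrow> 'k) \<Rightarrow> ('k::field, 'n::finite) laurent \<Rightarrow> ('k, 'n) laurent" where
  "monomial_op \<alpha> c = (\<lambda>f. \<Sum>\<beta>\<in>Poly_Mapping.keys f.
     Poly_Mapping.single (\<beta> - (\<chi> i. int (\<alpha> $ i))) (c \<beta> * Poly_Mapping.lookup f \<beta>))"

text \<open>
  This is \<open>b gchoose j\<close> at type \<^typ>\<open>int\<close>, which the parser does not admit here because of the
  sort constraint to fields placed on \<^const>\<open>gbinomial\<close>. The division is exact.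
\<close>

definition int_binomial :: "int \<Rightarrow> nat \<Rightarrow> int" where
  "int_binomial b j = (\<Prod>i = 0..<j. b - of_nat i) div fact j"

definition divided_deriv ::
    "nat ^ 'n \<Rightarrow> ('k::field, 'n::finite) laurent \<Rightarrow> ('k, 'n) laurent" where
  "divided_deriv \<alpha> = monomial_op \<alpha> (\<lambda>\<beta>. \<Prod>i\<in>UNIV. of_int (int_binomial (\<beta> $ i) (\<alpha> $ i)))"

text \<open>The left \<open>L\<close>-span of the divided power derivations of total degree at most \<open>m\<close>.\<close>

definition order_filtration ::
    "nat \<Rightarrow> (('k::field, 'n::finite) laurent \<Rightarrow> ('k, 'n) laurent) set" where
  "order_filtration m =
     {u. \<exists>a :: nat ^ 'n \<Rightarrow> ('k, 'n) laurent.
           u = (\<lambda>f. \<Sum>\<alpha> | (\<Sum>i\<in>UNIV. \<alpha> $ i) \<le> m. a \<alpha> * divided_deriv \<alpha> f)}"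

definition AutOrd :: "((('k::field, 'n::finite) laurent \<Rightarrow> ('k, 'n) laurent) \<Rightarrow>
    (('k, 'n) laurent \<Rightarrow> ('k, 'n) laurent)) monoid" where
  "AutOrd = AlgAut diff_alg
     \<lparr>carrier := {\<sigma> \<in> alg_auts diff_alg. \<forall>m. \<sigma> ` order_filtration m = order_filtration m}\<rparr>"

text \<open>An automorphism of \<open>L\<close>, regarded as an automorphism of its algebra of differential operators.\<close>

definition induced_aut :: "(('k::field, 'n::finite) laurent \<Rightarrow> ('k, 'n) laurent) \<Rightarrow>
    (('k, 'n) laurent \<Rightarrow> ('k, 'n) laurent) \<Rightarrow> (('k, 'n) laurent \<Rightarrow> ('k, 'n) laurent)" where
  "induced_aut \<tau> = (\<lambda>u \<in> diff_ops. \<tau> \<circ> u \<circ> inv_into UNIV \<tau>)"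


section \<open>The p-adic integers\<close>

text \<open>
  The inverse limit of the rings of integers modulo \<open>p ^ k\<close>: the entry \<open>s k\<close> is the representative
  of \<open>s\<close> modulo \<open>p ^ k\<close> in \<open>{0..<p ^ k}\<close>.
\<close>

definition padic_int :: "nat \<Rightarrow> (nat \<Rightarrow> int) ring" where
  "padic_int p =
     \<lparr>carrier = {s. \<forall>k. s k \<in> {0..<int p ^ k} \<and> s (Suc k) mod int p ^ k = s k},
      mult = (\<lambda>s t k. (s k * t k) mod int p ^ k),
      one = (\<lambda>k. 1 mod int p ^ k),
      zero = (\<lambda>k. 0),
      add = (\<lambda>s t k. (s k + t k) mod int p ^ k)\<rparr>"

definition padic_of_int :: "nat \<Rightarrow> int \<Rightarrow> nat \<Rightarrow> int" where
  "padic_of_int p b = (\<lambda>k. b mod int p ^ k)"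

text \<open>
  The quotient \<open>t (t - 1) ... (t - j + 1) / j!\<close>, which lies in the ring of \<open>p\<close>-adic integers;
  it is unique since that ring is a domain of characteristic zero.
\<close>

definition padic_binomial :: "nat \<Rightarrow> (nat \<Rightarrow> int) \<Rightarrow> nat \<Rightarrow> (nat \<Rightarrow> int)" where
  "padic_binomial p t j = (THE b. b \<in> carrier (padic_int p) \<and>
     add_pow (padic_int p) (fact j :: nat) b =
       finprod (padic_int p) (\<lambda>i. t \<ominus>\<^bsub>padic_int p\<^esub> padic_of_int p (int i)) {..<j})"

text \<open>Reduction modulo \<open>p\<close>, followed by the inclusion of the prime field (\<open>CHAR('k) = p\<close>).\<close>

definition padic_reduce :: "(nat \<Rightarrow> int) \<Rightarrow> 'k::field" where
  "padic_reduce s = of_int (s 1)"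

text \<open>The additive group of the \<open>n\<close>-fold power of the \<open>p\<close>-adic integers, \<open>n\<close> being \<open>CARD('n)\<close>.\<close>

definition padic_power :: "nat \<Rightarrow> ('n::finite \<Rightarrow> nat \<Rightarrow> int) monoid" where
  "padic_power p = product_group UNIV (\<lambda>_. add_monoid (padic_int p))"


section \<open>The automorphisms attached to tuples of p-adic integers\<close>

text \<open>
  The product of the operators \<open>(\<partial>\<^sub>i + s\<^sub>i x\<^sub>i\<^sup>-\<^sup>1) ^ \<alpha>\<^sub>i / \<alpha>\<^sub>i!\<close>. Over the \<open>p\<close>-adic integers it sends
  \<open>x ^ \<beta>\<close> to the product of the \<open>binom (\<beta>\<^sub>i + s\<^sub>i) \<alpha>\<^sub>i\<close> times \<open>x ^ (\<beta> - \<alpha>)\<close>; what is defined here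
  is its reduction modulo \<open>p\<close>, extended linearly to \<open>'k\<close>.
\<close>

definition shifted_divided_deriv :: "nat \<Rightarrow> ('n \<Rightarrow> nat \<Rightarrow> int) \<Rightarrow> nat ^ 'n \<Rightarrow>
    ('k::field, 'n::finite) laurent \<Rightarrow> ('k, 'n) laurent" where
  "shifted_divided_deriv p s \<alpha> = monomial_op \<alpha> (\<lambda>\<beta>. \<Prod>i\<in>UNIV.
     padic_reduce (padic_binomial p (padic_of_int p (\<beta> $ i) \<oplus>\<^bsub>padic_int p\<^esub> s i) (\<alpha> $ i)))"

definition is_sigma :: "nat \<Rightarrow> ('n \<Rightarrow> nat \<Rightarrow> int) \<Rightarrow>
    ((('k::field, 'n::finite) laurent \<Rightarrow> ('k, 'n) laurent) \<Rightarrow>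
     (('k, 'n) laurent \<Rightarrow> ('k, 'n) laurent)) \<Rightarrow> bool" where
  "is_sigma p s \<rho> \<longleftrightarrow> \<rho> \<in> carrier (AlgAut diff_alg) \<and>
     (\<forall>i. \<rho> (mult_op (laurent_var i)) = mult_op (laurent_var i)) \<and>
     (\<forall>\<alpha>. \<rho> (divided_deriv \<alpha>) = shifted_divided_deriv p s \<alpha>)"

definition sigma :: "nat \<Rightarrow> ('n \<Rightarrow> nat \<Rightarrow> int) \<Rightarrow>
    (('k::field, 'n::finite) laurent \<Rightarrow> ('k, 'n) laurent) \<Rightarrow>
     (('k, 'n) laurent \<Rightarrow> ('k, 'n) laurent)" where
  "sigma p s = (THE \<rho>. is_sigma p s \<rho>)"

end

theory Submission
  imports Defs
    "HOL-Computational_Algebra.Polynomial"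
    "HOL-Number_Theory.Cong"
begin

text \<open>
  Let \<open>L\<close> be the algebra of Laurent polynomials, \<open>D\<close> its algebra of differential operators, and \<open>L\<^sub>k\<close> the
  subalgebra spanned by the monomials whose exponents are divisible by \<open>p ^ k\<close>.

  In characteristic \<open>p\<close> the commutator with \<open>x ^ (p ^ k)\<close> is the \<open>p ^ k\<close>-th power of the commutator
  with \<open>x\<close> (\<open>commut_funpow_char_power\<close>). Therefore \<open>D\<close> is the union of the algebras \<open>D\<^sub>k\<close> of
  \<open>L\<^sub>k\<close>-linear endomorphisms of \<open>L\<close> (\<open>diff_ops_periodic\<close>). Conjugation by a monomial \<open>x ^ \<gamma>\<close> is
  trivial on \<open>D\<^sub>k\<close> if \<open>p ^ k\<close> divides \<open>\<gamma>\<close>; hence for a tuple \<open>s\<close> of \<open>p\<close>-adic integers the conjugations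
  by \<open>x\<close> to the power \<open>s\<close> modulo \<open>p ^ k\<close>, on \<open>D\<^sub>k\<close>, fit together to an automorphism of \<open>D\<close>
  (\<open>padic_shift\<close>). It is the automorphism \<open>\<sigma>\<^sub>s\<close>: the divided derivation \<open>\<partial>\<^sup>[\<^sup>\<alpha>\<^sup>]\<close> has the binomial
  coefficients of \<open>\<beta>\<close> as its eigenvalues up to a shift of degree, conjugation replaces \<open>\<beta>\<close> by
  \<open>\<beta> + s\<close>, and modulo \<open>p\<close> a \<open>p\<close>-adic binomial coefficient depends on a truncation of its argument
  only (\<open>padic_reduce_binomial\<close>).

  Conversely, an order preserving automorphism maps \<open>L\<close>, the operators of order zero, onto itself and
  induces an automorphism \<open>\<tau>\<close> of \<open>L\<close>. After division by \<open>\<tau>\<close> there remains an automorphism \<open>\<sigma>\<close> that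
  fixes \<open>L\<close> pointwise, and it has to be shown that it is conjugation by a monomial on every \<open>D\<^sub>k\<close>
  (\<open>fixes_laurent_locally_inner\<close>). By induction on \<open>k\<close> and after a correction by such a conjugation,
  \<open>\<sigma>\<close> is the identity on \<open>D\<^sub>k\<close>. Let \<open>u\<close> be the diagonal operator that multiplies \<open>x ^ \<beta>\<close> by the
  \<open>k\<close>-th digit of \<open>\<beta>\<^sub>i\<close> in base \<open>p\<close>. Its commutators with \<open>L\<close> involve carries only and lie in \<open>D\<^sub>k\<close>,
  so \<open>\<sigma>(u) - u\<close> commutes with \<open>L\<close> and is multiplication by some \<open>a \<in> L\<close>. Since \<open>u ^ p = u\<close>, comparing
  leading terms in \<open>(u + a) ^ p = u + a\<close> shows that \<open>a\<close> is a constant in the prime field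
  (\<open>digit_op_image\<close>). A further conjugation by a power of \<open>x\<^sub>i ^ (p ^ k)\<close> makes \<open>\<sigma>\<close> fix \<open>u\<close>. Now \<open>\<sigma>\<close>
  fixes the projection of \<open>L\<close> onto \<open>L\<^bsub>k+1\<^esub>\<close>, which is a polynomial in the digits, and this
  projection together with \<open>L\<close> already determines the action on \<open>D\<^bsub>k+1\<^esub>\<close> (\<open>fixes_periodic_ops\<close>).

  That \<open>\<sigma>\<^sub>s\<close> and \<open>\<tau>\<close> preserve the order filtration becomes evident once the filtration is identified
  with Grothendieck's (\<open>order_filtration_eq\<close>), because the latter is defined by commutators with \<open>L\<close>.
\<close>

section \<open>Laurent polynomials and linear operators\<close>

definition lmono :: "int ^ 'n \<Rightarrow> ('k::field, 'n::finite) laurent" where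
  "lmono \<gamma> = Poly_Mapping.single \<gamma> 1"

lemma lmono_0: "lmono 0 = 1"
  by (simp add: lmono_def)

lemma lmono_mult: "lmono \<gamma> * lmono \<delta> = lmono (\<gamma> + \<delta>)"
  by (simp add: lmono_def mult_single)

lemma lmono_mult_left: "lmono \<gamma> * (lmono \<delta> * f) = lmono (\<gamma> + \<delta>) * f"
  by (simp add: lmono_mult flip: mult.assoc)

lemma lmono_inverse: "lmono (- \<gamma>) * (lmono \<gamma> * f) = f" "lmono \<gamma> * (lmono (- \<gamma>) * f) = f"
  by (simp_all add: lmono_mult_left lmono_0)

lemma laurent_var_lmono: "laurent_var i = lmono (axis i 1)"
  by (simp add: laurent_var_def lmono_def)

lemma laurent_const_simps:
  "laurent_const 0 = 0" "laurent_const 1 = 1"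
  "laurent_const (c + d) = laurent_const c + laurent_const d"
  "laurent_const (c * d) = laurent_const c * laurent_const d"
  "laurent_const (- c) = - laurent_const c"
  by (simp_all add: laurent_const_def single_add mult_single single_uminus)

lemma single_eq_const_lmono: "Poly_Mapping.single \<beta> c = laurent_const c * lmono \<beta>"
  by (simp add: laurent_const_def lmono_def mult_single)

lemma lookup_lmono: "Poly_Mapping.lookup (lmono \<gamma>) \<beta> = (if \<gamma> = \<beta> then 1 else 0)"
  by (auto simp: lmono_def lookup_single when_def)

lemma laurent_expand:
  fixes f :: "('k::field, 'n::finite) laurent"
  shows "f = (\<Sum>\<beta>\<in>Poly_Mapping.keys f. laurent_const (Poly_Mapping.lookup f \<beta>) * lmono \<beta>)"
proof (rule poly_mapping_eqI)
  fix \<gamma>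
  show "Poly_Mapping.lookup f \<gamma> = Poly_Mapping.lookup
      (\<Sum>\<beta>\<in>Poly_Mapping.keys f. laurent_const (Poly_Mapping.lookup f \<beta>) * lmono \<beta>) \<gamma>"
    by (simp add: lookup_sum lookup_single when_def not_in_keys_iff_lookup_eq_zero
        flip: single_eq_const_lmono)
qed

lemma lookup_single_mult:
  fixes f :: "('k::field, 'n::finite) laurent"
  shows "Poly_Mapping.lookup (Poly_Mapping.single \<gamma> c * f) \<beta> = c * Poly_Mapping.lookup f (\<beta> - \<gamma>)"
proof -
  have "Poly_Mapping.single \<gamma> c * f =
      (\<Sum>\<delta>\<in>Poly_Mapping.keys f. Poly_Mapping.single (\<gamma> + \<delta>) (c * Poly_Mapping.lookup f \<delta>))"
    by (subst (1) laurent_expand[of f])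
      (simp add: sum_distrib_left mult_single flip: single_eq_const_lmono)
  moreover have "(\<gamma> + \<delta> = \<beta>) = (\<delta> = \<beta> - \<gamma>)" for \<delta>
    by (auto simp: algebra_simps)
  ultimately show ?thesis
    by (simp add: lookup_sum lookup_single when_def not_in_keys_iff_lookup_eq_zero)
qed

lemma lookup_lmono_mult:
  "Poly_Mapping.lookup (lmono \<gamma> * f :: ('k::field, 'n::finite) laurent) \<beta> = Poly_Mapping.lookup f (\<beta> - \<gamma>)"
  by (simp add: lmono_def lookup_single_mult)

lemma lookup_const_mult:
  "Poly_Mapping.lookup (laurent_const c * f :: ('k::field, 'n::finite) laurent) \<beta> = c * Poly_Mapping.lookup f \<beta>"
  by (simp add: laurent_const_def lookup_single_mult)

lemma lookup_monomial_op:
  fixes f :: "('k::field, 'n::finite) laurent"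
  shows "Poly_Mapping.lookup (monomial_op \<alpha> c f) \<beta> =
    c (\<beta> + (\<chi> i. int (\<alpha> $ i))) * Poly_Mapping.lookup f (\<beta> + (\<chi> i. int (\<alpha> $ i)))"
proof -
  have "(\<delta> - (\<chi> i. int (\<alpha> $ i)) = \<beta>) = (\<delta> = \<beta> + (\<chi> i. int (\<alpha> $ i)))" for \<delta>
    by (auto simp: algebra_simps)
  then show ?thesis
    by (simp add: monomial_op_def lookup_sum lookup_single when_def not_in_keys_iff_lookup_eq_zero)
qed

lemma laurent_lmono_induct [case_names const lmono add mult]:
  fixes P :: "('k::field, 'n::finite) laurent \<Rightarrow> bool"
  assumes const: "\<And>c. P (laurent_const c)"
    and lmono: "\<And>\<beta>. P (lmono \<beta>)"
    and add: "\<And>f g. P f \<Longrightarrow> P g \<Longrightarrow> P (f + g)"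
    and mult: "\<And>f g. P f \<Longrightarrow> P g \<Longrightarrow> P (f * g)"
  shows "P f"
proof -
  have "P (\<Sum>\<beta>\<in>A. laurent_const (c \<beta>) * lmono \<beta>)" if "finite A" for A and c :: "int ^ 'n \<Rightarrow> 'k"
    using that
  proof induction
    case empty
    show ?case using const[of 0] by (simp add: laurent_const_simps)
  qed (simp add: assms)
  then show ?thesis by (subst laurent_expand) simp
qed

text \<open>
  The inverses of the variables have to be listed as generators: the exponents are integers.
\<close>

lemma laurent_generator_induct [case_names const var var_inv add mult]:
  fixes P :: "('k::field, 'n::finite) laurent \<Rightarrow> bool"
  assumes const: "\<And>c. P (laurent_const c)"
    and var: "\<And>i. P (laurent_var i)"
    and var_inv: "\<And>i. P (lmono (- axis i 1))"
    and add: "\<And>f g. P f \<Longrightarrow> P g \<Longrightarrow> P (f + g)"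
    and mult: "\<And>f g. P f \<Longrightarrow> P g \<Longrightarrow> P (f * g)"
  shows "P f"
proof (rule laurent_lmono_induct)
  have one: "P 1"
    using const[of 1] by (simp add: laurent_const_simps)
  have axis: "P (lmono (axis i z))" for i and z :: int
  proof (induction z rule: int_induct[where k = 0])
    case base
    have zero: "axis i (0::int) = 0" by (simp add: vec_eq_iff axis_def)
    show ?case using one by (simp only: zero lmono_0)
  next
    case (step1 z)
    have "axis i (z + 1) = axis i z + axis i 1"
      by (simp add: vec_eq_iff axis_def)
    then show ?case
      using mult[OF step1(2) var[of i]] by (simp add: laurent_var_lmono lmono_mult)
  next
    case (step2 z)
    have "axis i (z - 1) = axis i z + (- axis i 1)"
      by (simp add: vec_eq_iff axis_def)
    then show ?case
      using mult[OF step2(2) var_inv[of i]] by (simp only: lmono_mult)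
  qed
  fix \<beta> :: "int ^ 'n"
  have "P (lmono (\<Sum>i\<in>A. axis i (\<beta> $ i)))" if "finite A" for A
    using that
  proof induction
    case empty
    show ?case using one by (simp add: lmono_0)
  next
    case (insert i A)
    then show ?case using mult[OF axis[of i "\<beta> $ i"] insert.IH] by (simp add: lmono_mult)
  qed
  moreover have "(\<Sum>i\<in>UNIV. axis i (\<beta> $ i)) = \<beta>"
    by (simp add: vec_eq_iff axis_def)
  ultimately show "P (lmono \<beta>)" by (metis finite)
qed (fact const add mult)+

lemma laurent_endosI:
  assumes "\<And>f g. u (f + g) = u f + u g" "\<And>c f. u (laurent_const c * f) = laurent_const c * u f"
  shows "u \<in> laurent_endos"
  using assms by (simp add: laurent_endos_def)

lemma laurent_endos_simps:
  assumes "u \<in> laurent_endos"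
  shows "u (f + g) = u f + u g" "u (laurent_const c * f) = laurent_const c * u f"
    "u 0 = 0" "u (- f) = - u f" "u (f - g) = u f - u g" "u (sum h A) = (\<Sum>x\<in>A. u (h x))"
proof -
  show add: "u (f + g) = u f + u g" for f g using assms by (simp add: laurent_endos_def)
  show scale: "u (laurent_const c * f) = laurent_const c * u f" for c f
    using assms by (simp add: laurent_endos_def)
  show zero: "u 0 = 0" using scale[of 0 0] by (simp add: laurent_const_simps)
  show minus: "u (- f) = - u f" for f using scale[of "-1" f] by (simp add: laurent_const_simps)
  show "u (f - g) = u f - u g" using add[of f "- g"] minus[of g] by simp
  show "u (sum h A) = (\<Sum>x\<in>A. u (h x))"
    by (induction A rule: infinite_finite_induct) (simp_all add: zero add)
qed

lemma laurent_endos_ext: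
  assumes "u \<in> laurent_endos" "v \<in> laurent_endos" "\<And>\<beta>. u (lmono \<beta>) = v (lmono \<beta>)"
  shows "u = v"
proof
  fix f
  show "u f = v f"
    by (subst (1 2) laurent_expand[of f]) (simp add: assms laurent_endos_simps)
qed

lemma mult_op_endo: "mult_op a \<in> laurent_endos"
  by (rule laurent_endosI) (simp_all add: mult_op_def algebra_simps)

lemma comp_endo: "u \<in> laurent_endos \<Longrightarrow> v \<in> laurent_endos \<Longrightarrow> u \<circ> v \<in> laurent_endos"
  by (rule laurent_endosI) (simp_all add: laurent_endos_simps)

lemma add_endo: "u \<in> laurent_endos \<Longrightarrow> v \<in> laurent_endos \<Longrightarrow> (\<lambda>f. u f + v f) \<in> laurent_endos"
  by (rule laurent_endosI) (simp_all add: laurent_endos_simps distrib_left)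

lemma monomial_op_endo: "monomial_op \<alpha> c \<in> laurent_endos"
  by (rule laurent_endosI; rule poly_mapping_eqI)
    (simp_all add: lookup_monomial_op lookup_add lookup_const_mult distrib_left mult.left_commute)

lemma endo_commuting_with_lmonos:
  assumes u: "u \<in> laurent_endos" and comm: "\<And>\<beta>. u (lmono \<beta>) = lmono \<beta> * u 1"
  shows "u = mult_op (u 1)"
  using u mult_op_endo by (rule laurent_endos_ext) (simp add: comm mult_op_def mult.commute)

section \<open>Commutators and the order of a differential operator\<close>

definition commut :: "('k::field, 'n::finite) laurent \<Rightarrow>
    (('k, 'n) laurent \<Rightarrow> ('k, 'n) laurent) \<Rightarrow> ('k, 'n) laurent \<Rightarrow> ('k, 'n) laurent" where
  "commut a u = (\<lambda>f. a * u f - u (a * f))"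

lemma commut_endo: "u \<in> laurent_endos \<Longrightarrow> commut a u \<in> laurent_endos"
  by (rule laurent_endosI)
    (simp_all add: commut_def laurent_endos_simps mult.left_commute[of a] right_diff_distrib distrib_left)

lemma diff_ops_le_commut:
  "u \<in> diff_ops_le 0 \<longleftrightarrow> u \<in> laurent_endos \<and> (\<forall>a. commut a u = (\<lambda>_. 0))"
  "u \<in> diff_ops_le (Suc m) \<longleftrightarrow> u \<in> laurent_endos \<and> (\<forall>a. commut a u \<in> diff_ops_le m)"
  by (simp_all add: commut_def)

declare diff_ops_le.simps [simp del]

lemma diff_ops_le_endo: "u \<in> diff_ops_le m \<Longrightarrow> u \<in> laurent_endos"
  by (cases m) (simp_all add: diff_ops_le_commut)

lemma diff_ops_le_0:
  "diff_ops_le 0 = range (mult_op :: _ \<Rightarrow> ('k::field, 'n::finite) laurent \<Rightarrow> _)"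
proof (intro equalityI subsetI)
  fix u :: "('k::field, 'n::finite) laurent \<Rightarrow> ('k, 'n) laurent"
  assume u: "u \<in> diff_ops_le 0"
  have "u (lmono \<beta>) = lmono \<beta> * u 1" for \<beta>
  proof -
    have "commut (lmono \<beta>) u 1 = 0" using u by (simp add: diff_ops_le_commut(1))
    then show ?thesis by (simp add: commut_def)
  qed
  then show "u \<in> range mult_op"
    using endo_commuting_with_lmonos[OF diff_ops_le_endo[OF u]] by blast
next
  fix u :: "('k::field, 'n::finite) laurent \<Rightarrow> ('k, 'n) laurent"
  assume "u \<in> range mult_op"
  then show "u \<in> diff_ops_le 0"
    using mult_op_endo by (auto simp: diff_ops_le_commut commut_def mult_op_def mult.left_commute)
qed

lemma diff_ops_le_zero_op: "(\<lambda>_. 0) \<in> diff_ops_le m"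
proof (induction m)
  case 0
  show ?case unfolding diff_ops_le_0 by (rule image_eqI[of _ _ 0]) (auto simp: mult_op_def)
next
  case (Suc m)
  then show ?case by (auto simp: diff_ops_le_commut commut_def laurent_endos_def)
qed

lemma diff_ops_le_add:
  "u \<in> diff_ops_le m \<Longrightarrow> v \<in> diff_ops_le m \<Longrightarrow> (\<lambda>f. u f + v f) \<in> diff_ops_le m"
proof (induction m arbitrary: u v)
  case 0
  then obtain a b where "u = mult_op a" "v = mult_op b" by (auto simp: diff_ops_le_0)
  then show ?case unfolding diff_ops_le_0
    by (intro image_eqI[of _ _ "a + b"]) (auto simp: mult_op_def algebra_simps)
next
  case (Suc m)
  have "commut a (\<lambda>f. u f + v f) = (\<lambda>f. commut a u f + commut a v f)" for a
    by (simp add: commut_def algebra_simps)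
  then show ?case using Suc by (simp add: diff_ops_le_commut add_endo)
qed

lemma diff_ops_le_Suc: "u \<in> diff_ops_le m \<Longrightarrow> u \<in> diff_ops_le (Suc m)"
proof (induction m arbitrary: u)
  case 0
  then show ?case using diff_ops_le_zero_op[of 0] by (auto simp: diff_ops_le_commut)
next
  case (Suc m)
  then show ?case by (auto simp: diff_ops_le_commut(2)[of _ "Suc m"] diff_ops_le_commut(2)[of _ m])
qed

lemma diff_ops_le_mono: "u \<in> diff_ops_le m \<Longrightarrow> m \<le> m' \<Longrightarrow> u \<in> diff_ops_le m'"
proof -
  assume u: "u \<in> diff_ops_le m" and "m \<le> m'"
  from this(2) show "u \<in> diff_ops_le m'"
    by (induction m' rule: dec_induct) (auto intro: diff_ops_le_Suc u)
qed

lemma diff_ops_le_comp: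
  "u \<in> diff_ops_le m \<Longrightarrow> v \<in> diff_ops_le m' \<Longrightarrow> u \<circ> v \<in> diff_ops_le (m + m')"
proof (induction "m + m'" arbitrary: u v m m' rule: less_induct)
  case less
  have endo: "u \<circ> v \<in> laurent_endos"
    using less.prems by (intro comp_endo) (auto intro: diff_ops_le_endo)
  show ?case
  proof (cases "m + m'")
    case 0
    then obtain a b where "u = mult_op a" "v = mult_op b"
      using less.prems by (auto simp: diff_ops_le_0)
    then show ?thesis unfolding 0 diff_ops_le_0
      by (intro image_eqI[of _ _ "a * b"]) (auto simp: mult_op_def algebra_simps)
  next
    case (Suc k)
    have "commut a (u \<circ> v) \<in> diff_ops_le k" for a
    proof -
      have eq: "commut a (u \<circ> v) = (\<lambda>f. (commut a u \<circ> v) f + (u \<circ> commut a v) f)"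
        using diff_ops_le_endo[OF less.prems(1)]
        by (simp add: commut_def laurent_endos_simps)
      have "commut a u \<circ> v \<in> diff_ops_le k"
      proof (cases m)
        case 0
        then have "commut a u \<circ> v = (\<lambda>_. 0)" using less.prems(1) by (auto simp: diff_ops_le_commut)
        then show ?thesis by (simp add: diff_ops_le_zero_op)
      next
        case (Suc l)
        then show ?thesis
          using less.hyps[of l m' "commut a u" v] less.prems \<open>m + m' = Suc k\<close>
          by (auto simp: diff_ops_le_commut)
      qed
      moreover have "u \<circ> commut a v \<in> diff_ops_le k"
      proof (cases m')
        case 0
        then have "u \<circ> commut a v = (\<lambda>_. 0)"
          using less.prems diff_ops_le_endo[OF less.prems(1)]
          by (auto simp: diff_ops_le_commut laurent_endos_simps)
        then show ?thesis by (simp add: diff_ops_le_zero_op)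
      next
        case (Suc l)
        then show ?thesis
          using less.hyps[of m l u "commut a v"] less.prems \<open>m + m' = Suc k\<close>
          by (auto simp: diff_ops_le_commut)
      qed
      ultimately show ?thesis unfolding eq by (rule diff_ops_le_add)
    qed
    then show ?thesis unfolding Suc using endo by (simp add: diff_ops_le_commut)
  qed
qed

lemma mult_op_diff_ops_le: "mult_op a \<in> diff_ops_le m"
  by (rule diff_ops_le_mono[of _ 0]) (auto simp: diff_ops_le_0)

lemma diff_ops_le_mult_op:
  assumes "u \<in> diff_ops_le m"
  shows "mult_op a \<circ> u \<in> diff_ops_le m" "u \<circ> mult_op a \<in> diff_ops_le m"
  using diff_ops_le_comp[OF mult_op_diff_ops_le[of a 0] assms]
    diff_ops_le_comp[OF assms mult_op_diff_ops_le[of a 0]] by simp_all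

text \<open>
  Commutators satisfy the Leibniz rule, so the elements whose commutator with \<open>u\<close> has order at most
  \<open>m\<close> form a subalgebra. It contains the inverses of its units because \<open>[y, u] = - y [x, u] y\<close> if
  \<open>x y = 1\<close>. Hence the variables are the only elements to be tested.
\<close>

lemma diff_ops_le_SucI:
  fixes u :: "('k::field, 'n::finite) laurent \<Rightarrow> ('k, 'n) laurent"
  assumes u: "u \<in> laurent_endos" and var: "\<And>i. commut (laurent_var i) u \<in> diff_ops_le m"
  shows "u \<in> diff_ops_le (Suc m)"
proof -
  have "commut a u \<in> diff_ops_le m" for a
  proof (induction a rule: laurent_generator_induct)
    case (const c)
    have "commut (laurent_const c) u = (\<lambda>_. 0)"
      using u by (simp add: commut_def laurent_endos_simps)
    then show ?case by (simp add: diff_ops_le_zero_op)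
  next
    case (var i)
    show ?case by (fact assms(2))
  next
    case (var_inv i)
    let ?v = "mult_op (- lmono (- axis i 1)) \<circ> (commut (laurent_var i) u \<circ> mult_op (lmono (- axis i 1)))"
    have "commut (lmono (- axis i 1)) u = ?v"
      by (simp add: fun_eq_iff commut_def mult_op_def laurent_var_lmono right_diff_distrib lmono_inverse)
    moreover have "?v \<in> diff_ops_le m" by (intro diff_ops_le_mult_op assms)
    ultimately show ?case by metis
  next
    case (add f g)
    have "commut (f + g) u = (\<lambda>h. commut f u h + commut g u h)"
      using u by (simp add: fun_eq_iff commut_def laurent_endos_simps algebra_simps)
    then show ?case using add by (simp add: diff_ops_le_add)
  next
    case (mult f g)
    have eq: "commut (f * g) u = (\<lambda>h. (mult_op f \<circ> commut g u) h + (commut f u \<circ> mult_op g) h)"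
      by (simp add: fun_eq_iff commut_def mult_op_def algebra_simps)
    show ?case unfolding eq
      by (intro diff_ops_le_add[OF diff_ops_le_mult_op(1) diff_ops_le_mult_op(2)] mult)
  qed
  then show ?thesis using u by (simp add: diff_ops_le_commut)
qed

lemma diff_ops_le_0I:
  fixes u :: "('k::field, 'n::finite) laurent \<Rightarrow> ('k, 'n) laurent"
  assumes u: "u \<in> laurent_endos" and var: "\<And>i. commut (laurent_var i) u = (\<lambda>_. 0)"
  shows "u \<in> diff_ops_le 0"
proof -
  have "commut a u = (\<lambda>_. 0)" for a
  proof (induction a rule: laurent_generator_induct)
    case (const c)
    show ?case using u by (simp add: commut_def laurent_endos_simps)
  next
    case (var i)
    show ?case by (fact assms(2))
  next
    case (var_inv i)
    have "u (lmono (- axis i 1) * f) = lmono (- axis i 1) * u f" for f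
    proof -
      have "laurent_var i * u (lmono (- axis i 1) * f) = u f"
        using fun_cong[OF var[of i], of "lmono (- axis i 1) * f"]
        by (simp add: commut_def laurent_var_lmono lmono_inverse)
      then show ?thesis
        by (metis laurent_var_lmono lmono_inverse(1))
    qed
    then show ?case by (simp add: commut_def)
  next
    case (add f g)
    then show ?case
      using u by (simp add: fun_eq_iff commut_def laurent_endos_simps algebra_simps)
  next
    case (mult f g)
    then show ?case by (simp add: fun_eq_iff commut_def mult.assoc)
  qed
  then show ?thesis using u by (simp add: diff_ops_le_commut)
qed

lemma diff_ops_endo: "u \<in> diff_ops \<Longrightarrow> u \<in> laurent_endos"
  by (auto simp: diff_ops_def diff_ops_le_endo)

lemma mult_op_diff_ops: "mult_op a \<in> diff_ops"
  using mult_op_diff_ops_le by (auto simp: diff_ops_def)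

lemma diff_ops_add: "u \<in> diff_ops \<Longrightarrow> v \<in> diff_ops \<Longrightarrow> (\<lambda>f. u f + v f) \<in> diff_ops"
proof -
  assume "u \<in> diff_ops" "v \<in> diff_ops"
  then obtain m m' where "u \<in> diff_ops_le m" "v \<in> diff_ops_le m'" by (auto simp: diff_ops_def)
  then have "(\<lambda>f. u f + v f) \<in> diff_ops_le (max m m')"
    by (intro diff_ops_le_add) (auto intro: diff_ops_le_mono)
  then show ?thesis by (auto simp: diff_ops_def)
qed

lemma diff_ops_comp: "u \<in> diff_ops \<Longrightarrow> v \<in> diff_ops \<Longrightarrow> u \<circ> v \<in> diff_ops"
  unfolding diff_ops_def using diff_ops_le_comp by blast

lemma diff_ops_scale: "u \<in> diff_ops \<Longrightarrow> (\<lambda>f. laurent_const c * u f) \<in> diff_ops"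
  using diff_ops_comp[OF mult_op_diff_ops[of "laurent_const c"]] by (simp add: mult_op_def comp_def)

section \<open>The order filtration is that of Grothendieck\<close>

\<comment> \<open>The exponent of a variable has to keep its form \<open>axis i 1\<close> also over the natural numbers.\<close>
declare One_nat_def [simp del]

lemma fact_mult_int_binomial: "fact j * int_binomial b j = (\<Prod>i = 0..<j. b - int i)"
  by (simp only: int_binomial_def gbinomial_prod_rev[symmetric] gbinomial_int_mult_fact)

lemma int_binomial_Suc_Suc:
  "int_binomial (b + 1) (Suc j) = int_binomial b j + int_binomial b (Suc j)"
  by (simp only: int_binomial_def gbinomial_prod_rev[symmetric] gbinomial_int_Suc_Suc)

lemma int_binomial_0: "int_binomial b 0 = 1"
  by (simp add: int_binomial_def)

lemma int_binomial_of_nat: "int_binomial (int b) j = int (b choose j)"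
  by (simp only: int_binomial_def gbinomial_prod_rev[symmetric] Binomial_Plus.int_binomial)

definition multi_binomial :: "int ^ 'n \<Rightarrow> nat ^ 'n \<Rightarrow> 'k::field" where
  "multi_binomial \<beta> \<alpha> = (\<Prod>i\<in>UNIV. of_int (int_binomial (\<beta> $ i) (\<alpha> $ i)))"

definition nat_exponent :: "nat ^ 'n \<Rightarrow> int ^ 'n" where
  "nat_exponent \<alpha> = (\<chi> i. int (\<alpha> $ i))"

definition total_degree :: "nat ^ 'n \<Rightarrow> nat" where
  "total_degree \<alpha> = (\<Sum>i\<in>UNIV. \<alpha> $ i)"

lemma nat_exponent_add_axis: "nat_exponent (\<alpha> + axis i 1) = nat_exponent \<alpha> + axis i 1"
  by (simp add: nat_exponent_def vec_eq_iff axis_def)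

lemma total_degree_add_axis: "total_degree (\<alpha> + axis i 1) = Suc (total_degree \<alpha>)"
  by (simp add: total_degree_def sum.distrib axis_def)

lemma total_degree_eq_0: "total_degree \<alpha> = 0 \<longleftrightarrow> \<alpha> = 0"
  by (simp add: total_degree_def vec_eq_iff)

lemma finite_total_degree: "finite {\<alpha> :: nat ^ 'n::finite. total_degree \<alpha> \<le> m}"
proof -
  have "\<alpha> \<in> (\<lambda>g. \<chi> i. g i) ` (UNIV \<rightarrow>\<^sub>E {..m})" if "total_degree \<alpha> \<le> m" for \<alpha> :: "nat ^ 'n"
  proof (rule image_eqI[of _ _ "\<lambda>i. \<alpha> $ i"])
    have "\<alpha> $ i \<le> m" for i
      using member_le_sum[of i UNIV "\<lambda>i. \<alpha> $ i"] that by (simp add: total_degree_def)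
    then show "(\<lambda>i. \<alpha> $ i) \<in> UNIV \<rightarrow>\<^sub>E {..m}" by auto
  qed simp
  then have "{\<alpha> :: nat ^ 'n. total_degree \<alpha> \<le> m} \<subseteq> (\<lambda>g. \<chi> i. g i) ` (UNIV \<rightarrow>\<^sub>E {..m})" by blast
  then show ?thesis by (rule finite_subset) (simp add: finite_PiE)
qed

lemma multi_binomial_Pascal:
  "(multi_binomial (\<beta> + axis i 1) (\<alpha> + axis i 1) :: 'k::field) =
    multi_binomial \<beta> (\<alpha> + axis i 1) + multi_binomial \<beta> \<alpha>"
proof -
  have eq: "(multi_binomial \<gamma> \<delta> :: 'k) = of_int (int_binomial (\<gamma> $ i) (\<delta> $ i)) *
      (\<Prod>j\<in>UNIV - {i}. of_int (int_binomial (\<gamma> $ j) (\<delta> $ j)))" for \<gamma> \<delta>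
    unfolding multi_binomial_def by (rule prod.remove) auto
  have 1: "(\<Prod>j\<in>UNIV - {i}. of_int (int_binomial ((\<beta> + axis i 1) $ j) ((\<alpha> + axis i 1) $ j)) :: 'k) =
      (\<Prod>j\<in>UNIV - {i}. of_int (int_binomial (\<beta> $ j) (\<alpha> $ j)))"
    by (rule prod.cong) (auto simp: axis_def)
  have 2: "(\<Prod>j\<in>UNIV - {i}. of_int (int_binomial (\<beta> $ j) ((\<alpha> + axis i 1) $ j)) :: 'k) =
      (\<Prod>j\<in>UNIV - {i}. of_int (int_binomial (\<beta> $ j) (\<alpha> $ j)))"
    by (rule prod.cong) (auto simp: axis_def)
  show ?thesis
    unfolding eq 1 2 by (simp add: axis_def int_binomial_Suc_Suc distrib_right flip: Suc_eq_plus1)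
qed

lemma multi_binomial_shift:
  assumes "\<alpha> $ i = 0"
  shows "(multi_binomial (\<beta> + axis i 1) \<alpha> :: 'k::field) = multi_binomial \<beta> \<alpha>"
  unfolding multi_binomial_def using assms
  by (intro prod.cong) (auto simp: axis_def int_binomial_0)

lemma divided_deriv_alt: "divided_deriv \<alpha> = monomial_op \<alpha> (\<lambda>\<beta>. multi_binomial \<beta> \<alpha>)"
  by (simp add: divided_deriv_def multi_binomial_def)

lemma divided_deriv_endo: "divided_deriv \<alpha> \<in> laurent_endos"
  by (simp add: divided_deriv_alt monomial_op_endo)

lemma lookup_divided_deriv:
  fixes f :: "('k::field, 'n::finite) laurent"
  shows "Poly_Mapping.lookup (divided_deriv \<alpha> f) \<beta> =
    multi_binomial (\<beta> + nat_exponent \<alpha>) \<alpha> * Poly_Mapping.lookup f (\<beta> + nat_exponent \<alpha>)"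
  by (simp add: divided_deriv_alt lookup_monomial_op nat_exponent_def)

text \<open>
  By Pascal's rule the commutator with \<open>x\<^sub>i\<close> lowers the \<open>i\<close>-th entry of \<open>\<alpha>\<close> by one; it is the reason
  why \<open>\<partial>\<^sup>[\<^sup>\<alpha>\<^sup>]\<close> has order \<open>|\<alpha>|\<close>.
\<close>

lemma commut_var_divided_deriv:
  fixes \<alpha> :: "nat ^ 'n::finite"
  shows "commut (laurent_var i) (divided_deriv (\<alpha> + axis i 1)) =
    mult_op (- 1) \<circ> (divided_deriv \<alpha> :: ('k::field, 'n) laurent \<Rightarrow> _)"
proof (intro ext poly_mapping_eqI)
  fix f :: "('k, 'n) laurent" and \<beta>
  have 1: "\<beta> - axis i 1 + nat_exponent (\<alpha> + axis i 1) = \<beta> + nat_exponent \<alpha>"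
    and 2: "\<beta> + nat_exponent (\<alpha> + axis i 1) = \<beta> + nat_exponent \<alpha> + axis i 1"
    by (simp_all add: nat_exponent_add_axis)
  show "Poly_Mapping.lookup (commut (laurent_var i) (divided_deriv (\<alpha> + axis i 1)) f) \<beta> =
      Poly_Mapping.lookup ((mult_op (- 1) \<circ> divided_deriv \<alpha>) f) \<beta>"
    by (simp add: commut_def lookup_minus laurent_var_lmono lookup_lmono_mult lookup_divided_deriv
        mult_op_def 1 2 multi_binomial_Pascal distrib_right)
qed

lemma commut_var_divided_deriv_eq_0:
  fixes \<alpha> :: "nat ^ 'n::finite"
  assumes "\<alpha> $ i = 0"
  shows "commut (laurent_var i) (divided_deriv \<alpha>) =
    (\<lambda>_. 0 :: ('k::field, 'n) laurent)"
proof (intro ext poly_mapping_eqI)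
  fix f :: "('k, 'n) laurent" and \<beta>
  have "(multi_binomial (\<beta> - axis i 1 + nat_exponent \<alpha>) \<alpha> :: 'k) = multi_binomial (\<beta> + nat_exponent \<alpha>) \<alpha>"
    using multi_binomial_shift[OF assms, of "\<beta> - axis i 1 + nat_exponent \<alpha>", where 'k = 'k]
    by (simp add: algebra_simps)
  then show "Poly_Mapping.lookup (commut (laurent_var i) (divided_deriv \<alpha>) f) \<beta> =
      Poly_Mapping.lookup (0 :: ('k, 'n) laurent) \<beta>"
    by (simp add: commut_def lookup_minus laurent_var_lmono lookup_lmono_mult lookup_divided_deriv
        add_diff_eq diff_add_eq)
qed

lemma divided_deriv_order:
  "(divided_deriv \<alpha> :: ('k::field, 'n::finite) laurent \<Rightarrow> _) \<in> diff_ops_le (total_degree \<alpha>)"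
proof (induction "total_degree \<alpha>" arbitrary: \<alpha>)
  case 0
  then have "\<alpha> = 0" by (simp add: total_degree_eq_0)
  then show ?case
    unfolding 0[symmetric]
    by (intro diff_ops_le_0I divided_deriv_endo commut_var_divided_deriv_eq_0) simp
next
  case (Suc m)
  have "commut (laurent_var i) (divided_deriv \<alpha> :: ('k, 'n) laurent \<Rightarrow> _) \<in> diff_ops_le m" for i
  proof (cases "\<alpha> $ i")
    case 0
    then show ?thesis by (simp add: commut_var_divided_deriv_eq_0 diff_ops_le_zero_op)
  next
    case (Suc j)
    define \<alpha>' where "\<alpha>' = \<alpha> - axis i 1"
    have \<alpha>: "\<alpha> = \<alpha>' + axis i 1"
      using Suc by (auto simp: \<alpha>'_def vec_eq_iff axis_def)
    then have "m = total_degree \<alpha>'"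
      using \<open>Suc m = total_degree \<alpha>\<close> by (simp add: total_degree_add_axis)
    then show ?thesis
      unfolding \<alpha> commut_var_divided_deriv
      using Suc.hyps(1) by (metis diff_ops_le_mult_op(1))
  qed
  then show ?case
    unfolding Suc.hyps(2)[symmetric] by (intro diff_ops_le_SucI divided_deriv_endo)
qed

lemma diff_ops_le_sum:
  assumes "\<And>x. x \<in> A \<Longrightarrow> u x \<in> diff_ops_le m"
  shows "(\<lambda>f. \<Sum>x\<in>A. u x f) \<in> diff_ops_le m"
  using assms
  by (induction A rule: infinite_finite_induct) (simp_all add: diff_ops_le_zero_op diff_ops_le_add)

lemma deriv_combination_order:
  fixes a :: "nat ^ 'n \<Rightarrow> ('k::field, 'n::finite) laurent"
  shows "(\<lambda>f. \<Sum>\<alpha> | total_degree \<alpha> \<le> m. a \<alpha> * divided_deriv \<alpha> f) \<in> diff_ops_le m"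
proof (rule diff_ops_le_sum)
  fix \<alpha> :: "nat ^ 'n" assume "\<alpha> \<in> {\<alpha>. total_degree \<alpha> \<le> m}"
  then have "divided_deriv \<alpha> \<in> diff_ops_le m"
    using diff_ops_le_mono[OF divided_deriv_order] by simp
  from diff_ops_le_mult_op(1)[OF this, of "a \<alpha>"]
  show "(\<lambda>f. a \<alpha> * divided_deriv \<alpha> f) \<in> diff_ops_le m"
    by (simp add: mult_op_def comp_def)
qed

text \<open>
  The commutators of \<open>u\<close> with the variables vanish on the test monomials of total degree one less, so
  that induction reduces the claim to operators of order zero.
\<close>

lemma diff_op_vanishing:
  fixes u :: "('k::field, 'n::finite) laurent \<Rightarrow> ('k, 'n) laurent"
  assumes "u \<in> diff_ops_le m" "\<And>\<alpha>. total_degree \<alpha> \<le> m \<Longrightarrow> u (lmono (nat_exponent \<alpha>)) = 0"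
  shows "u = (\<lambda>_. 0)"
  using assms
proof (induction m arbitrary: u)
  case 0
  have "nat_exponent (0 :: nat ^ 'n) = 0" by (simp add: nat_exponent_def vec_eq_iff)
  then have "u 1 = 0" using 0(2)[of 0] by (simp add: total_degree_def lmono_0)
  then show ?case using 0(1) by (auto simp: diff_ops_le_0 mult_op_def)
next
  case (Suc m)
  have "commut (laurent_var i) u = (\<lambda>_. 0)" for i
  proof (rule Suc.IH)
    show "commut (laurent_var i) u \<in> diff_ops_le m" using Suc.prems(1) by (simp add: diff_ops_le_commut)
    fix \<alpha> :: "nat ^ 'n" assume \<alpha>: "total_degree \<alpha> \<le> m"
    have "laurent_var i * lmono (nat_exponent \<alpha>) = (lmono (nat_exponent (\<alpha> + axis i 1)) :: ('k, 'n) laurent)"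
      by (simp add: laurent_var_lmono lmono_mult nat_exponent_add_axis add.commute)
    then show "commut (laurent_var i) u (lmono (nat_exponent \<alpha>)) = 0"
      using Suc.prems(2)[of \<alpha>] Suc.prems(2)[of "\<alpha> + axis i 1"] \<alpha>
      by (simp add: commut_def total_degree_add_axis)
  qed
  then have "u \<in> diff_ops_le 0"
    using Suc.prems(1) by (intro diff_ops_le_0I) (auto intro: diff_ops_le_endo)
  moreover have "nat_exponent (0 :: nat ^ 'n) = 0" by (simp add: nat_exponent_def vec_eq_iff)
  then have "u 1 = 0" using Suc.prems(2)[of 0] by (simp add: total_degree_def lmono_0)
  ultimately show ?case by (auto simp: diff_ops_le_0 mult_op_def)
qed

lemma divided_deriv_triangular:
  fixes \<alpha> \<beta> :: "nat ^ 'n::finite"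
  assumes "total_degree \<beta> \<le> total_degree \<alpha>"
  shows "divided_deriv \<alpha> (lmono (nat_exponent \<beta>) :: ('k::field, 'n) laurent) = (if \<alpha> = \<beta> then 1 else 0)"
proof (rule poly_mapping_eqI)
  fix \<gamma> :: "int ^ 'n"
  have eq: "Poly_Mapping.lookup (divided_deriv \<alpha> (lmono (nat_exponent \<beta>) :: ('k, 'n) laurent)) \<gamma> =
      multi_binomial (nat_exponent \<beta>) \<alpha> * (if nat_exponent \<beta> = \<gamma> + nat_exponent \<alpha> then 1 else 0)"
    by (auto simp: lookup_divided_deriv lookup_lmono)
  show "Poly_Mapping.lookup (divided_deriv \<alpha> (lmono (nat_exponent \<beta>) :: ('k, 'n) laurent)) \<gamma> =
      Poly_Mapping.lookup (if \<alpha> = \<beta> then 1 else 0) \<gamma>"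
  proof (cases "\<alpha> = \<beta>")
    case True
    then show ?thesis unfolding eq
      by (auto simp: lookup_one when_def multi_binomial_def nat_exponent_def int_binomial_of_nat)
  next
    case False
    have "\<exists>i. \<beta> $ i < \<alpha> $ i"
    proof (rule ccontr)
      assume "\<nexists>i. \<beta> $ i < \<alpha> $ i"
      then have le: "\<alpha> $ i \<le> \<beta> $ i" for i by (simp add: not_less)
      moreover obtain i where "\<alpha> $ i \<noteq> \<beta> $ i" using False by (auto simp: vec_eq_iff)
      ultimately have "total_degree \<alpha> < total_degree \<beta>"
        unfolding total_degree_def by (intro sum_strict_mono_ex1) (auto simp: order_less_le)
      then show False using assms by simp
    qed
    then obtain i where "\<beta> $ i < \<alpha> $ i" by blast
    then have "(multi_binomial (nat_exponent \<beta>) \<alpha> :: 'k) = 0"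
      unfolding multi_binomial_def
      by (intro prod_zero bexI[of _ i]) (simp_all add: nat_exponent_def int_binomial_of_nat binomial_eq_0)
    then show ?thesis unfolding eq using False by simp
  qed
qed

text \<open>
  The values of the divided derivations on the monomials with natural exponents form a unitriangular
  matrix with respect to the total degree. The coefficients \<open>a\<close> are found degree by degree, each new
  one being the error of the previous combination.
\<close>

lemma deriv_combination_interpolates:
  fixes u :: "('k::field, 'n::finite) laurent \<Rightarrow> ('k, 'n) laurent"
  shows "\<exists>a. \<forall>\<beta>. total_degree \<beta> < j \<longrightarrow> u (lmono (nat_exponent \<beta>)) =
    (\<Sum>\<alpha> | total_degree \<alpha> < j. a \<alpha> * divided_deriv \<alpha> (lmono (nat_exponent \<beta>)))"
proof (induction j)
  case (Suc j)
  let ?x = "\<lambda>\<beta>. lmono (nat_exponent \<beta>) :: ('k, 'n) laurent"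
  from Suc obtain a where a: "\<And>\<beta>. total_degree \<beta> < j \<Longrightarrow> u (?x \<beta>) =
      (\<Sum>\<alpha> | total_degree \<alpha> < j. a \<alpha> * divided_deriv \<alpha> (?x \<beta>))" by blast
  let ?r = "\<lambda>\<beta>. u (?x \<beta>) - (\<Sum>\<alpha> | total_degree \<alpha> < j. a \<alpha> * divided_deriv \<alpha> (?x \<beta>))"
  define a' where "a' \<alpha> = (if total_degree \<alpha> < j then a \<alpha> else ?r \<alpha>)" for \<alpha>
  have "u (?x \<beta>) = (\<Sum>\<alpha> | total_degree \<alpha> < Suc j. a' \<alpha> * divided_deriv \<alpha> (?x \<beta>))"
    if \<beta>: "total_degree \<beta> < Suc j" for \<beta>
  proof -
    have fin: "finite {\<alpha> :: nat ^ 'n. total_degree \<alpha> < j}" "finite {\<alpha> :: nat ^ 'n. total_degree \<alpha> = j}"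
      by (rule finite_subset[OF _ finite_total_degree[of j]]; auto)+
    have split: "{\<alpha> :: nat ^ 'n. total_degree \<alpha> < Suc j} = {\<alpha>. total_degree \<alpha> < j} \<union> {\<alpha>. total_degree \<alpha> = j}"
      by auto
    have "(\<Sum>\<alpha> | total_degree \<alpha> < Suc j. a' \<alpha> * divided_deriv \<alpha> (?x \<beta>)) =
        (\<Sum>\<alpha> | total_degree \<alpha> < j. a' \<alpha> * divided_deriv \<alpha> (?x \<beta>)) +
        (\<Sum>\<alpha> | total_degree \<alpha> = j. a' \<alpha> * divided_deriv \<alpha> (?x \<beta>))"
      unfolding split by (rule sum.union_disjoint) (use fin in auto)
    also have "(\<Sum>\<alpha> | total_degree \<alpha> < j. a' \<alpha> * divided_deriv \<alpha> (?x \<beta>)) =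
        (\<Sum>\<alpha> | total_degree \<alpha> < j. a \<alpha> * divided_deriv \<alpha> (?x \<beta>))"
      by (rule sum.cong) (auto simp: a'_def)
    also have "(\<Sum>\<alpha> | total_degree \<alpha> = j. a' \<alpha> * divided_deriv \<alpha> (?x \<beta>)) =
        (\<Sum>\<alpha> | total_degree \<alpha> = j. if \<alpha> = \<beta> then ?r \<beta> else 0)"
      by (rule sum.cong) (use \<beta> in \<open>auto simp: a'_def divided_deriv_triangular\<close>)
    also have "\<dots> = ?r \<beta>"
      using fin a \<beta> by (auto simp: less_Suc_eq)
    finally show ?thesis by simp
  qed
  then show ?case by blast
qed simp

text \<open>
  An operator of order at most \<open>m\<close> is determined by its values on the monomials with natural exponents
  of total degree at most \<open>m\<close>, and there it agrees with a combination of divided derivations.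
\<close>

theorem order_filtration_eq: "order_filtration m = diff_ops_le m"
proof (intro equalityI subsetI)
  fix u :: "('k::field, 'n::finite) laurent \<Rightarrow> ('k, 'n) laurent"
  assume "u \<in> order_filtration m"
  then show "u \<in> diff_ops_le m"
    using deriv_combination_order by (auto simp: order_filtration_def total_degree_def)
next
  fix u :: "('k::field, 'n::finite) laurent \<Rightarrow> ('k, 'n) laurent"
  assume u: "u \<in> diff_ops_le m"
  obtain a where a: "\<And>\<beta>. total_degree \<beta> \<le> m \<Longrightarrow> u (lmono (nat_exponent \<beta>)) =
      (\<Sum>\<alpha> | total_degree \<alpha> \<le> m. a \<alpha> * divided_deriv \<alpha> (lmono (nat_exponent \<beta>)))"
    using deriv_combination_interpolates[of "Suc m" u] by (auto simp: less_Suc_eq_le)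
  define v where "v = (\<lambda>f. \<Sum>\<alpha> | total_degree \<alpha> \<le> m. a \<alpha> * divided_deriv \<alpha> f)"
  have v: "v \<in> diff_ops_le m" unfolding v_def by (rule deriv_combination_order)
  have "(\<lambda>f. u f + (mult_op (- 1) \<circ> v) f) = (\<lambda>_. 0)"
  proof (rule diff_op_vanishing)
    show "(\<lambda>f. u f + (mult_op (- 1) \<circ> v) f) \<in> diff_ops_le m"
      by (intro diff_ops_le_add diff_ops_le_mult_op u v)
  qed (simp add: a v_def mult_op_def)
  then have "u f = v f" for f by (auto simp: mult_op_def fun_eq_iff)
  then show "u \<in> order_filtration m"
    by (auto simp: order_filtration_def v_def total_degree_def fun_eq_iff)
qed

section \<open>Differential operators in characteristic p\<close>

lemma commut_commute: "commut a (commut b u) = commut b (commut a u)"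
  by (simp add: fun_eq_iff commut_def algebra_simps)

lemma commut_commute_funpow: "commut a ((commut b ^^ j) u) = (commut b ^^ j) (commut a u)"
  by (induction j) (simp_all add: commut_commute[of a b])

lemma commut_zero: "commut a (\<lambda>_. 0) = (\<lambda>_. 0)"
  by (simp add: commut_def)

text \<open>
  This is the binomial formula for the difference of left and right multiplication by \<open>a\<close>.
\<close>

lemma commut_funpow:
  "(commut a ^^ j) u f = (\<Sum>i\<le>j. (- 1) ^ i * of_nat (j choose i) * a ^ (j - i) * u (a ^ i * f))"
proof (induction j arbitrary: f)
  case (Suc j)
  let ?t = "\<lambda>c i. (- 1) ^ i * of_nat c * a ^ (j - i) * u (a ^ Suc i * f)"
  have left: "a * (commut a ^^ j) u f = a ^ Suc j * u f - (\<Sum>i\<le>j. ?t (j choose Suc i) i)"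
  proof -
    have "a * (commut a ^^ j) u f =
        (\<Sum>i\<le>j. (- 1) ^ i * of_nat (j choose i) * a ^ (Suc j - i) * u (a ^ i * f))"
      unfolding Suc.IH sum_distrib_left by (rule sum.cong) (auto simp: Suc_diff_le mult_ac)
    also have "\<dots> = (\<Sum>i\<le>Suc j. (- 1) ^ i * of_nat (j choose i) * a ^ (Suc j - i) * u (a ^ i * f))"
      by (simp add: binomial_eq_0)
    also have "\<dots> = a ^ Suc j * u f - (\<Sum>i\<le>j. ?t (j choose Suc i) i)"
      unfolding sum.atMost_Suc_shift by (simp add: sum_negf)
    finally show ?thesis .
  qed
  have "(commut a ^^ Suc j) u f = a * (commut a ^^ j) u f - (commut a ^^ j) u (a * f)"
    by (simp add: commut_def)
  also have "(commut a ^^ j) u (a * f) = (\<Sum>i\<le>j. ?t (j choose i) i)"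
    unfolding Suc.IH by (rule sum.cong) (auto simp: mult_ac)
  also have "a * (commut a ^^ j) u f - \<dots> = a ^ Suc j * u f - (\<Sum>i\<le>j. ?t (Suc j choose Suc i) i)"
    unfolding left by (simp add: sum.distrib algebra_simps)
  also have "\<dots> = (\<Sum>i\<le>Suc j. (- 1) ^ i * of_nat (Suc j choose i) * a ^ (Suc j - i) * u (a ^ i * f))"
    unfolding sum.atMost_Suc_shift by (simp add: sum_negf)
  finally show ?case .
qed simp

lemma laurent_of_nat_eq_0:
  assumes "CHAR('k::field) dvd j"
  shows "(of_nat j :: ('k, 'n::finite) laurent) = 0"
proof -
  have "(of_nat j :: 'k) = 0" using assms by (simp add: of_nat_eq_0_iff_char_dvd)
  then show ?thesis by (metis single_of_nat single_zero)
qed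

lemma commut_funpow_char:
  fixes a :: "('k::field, 'n::finite) laurent"
  assumes p: "prime p" "CHAR('k) = p"
  shows "commut a ^^ p = commut (a ^ p)"
proof (intro ext)
  fix u :: "('k, 'n) laurent \<Rightarrow> ('k, 'n) laurent" and f
  let ?t = "\<lambda>i. (- 1) ^ i * of_nat (p choose i) * a ^ (p - i) * u (a ^ i * f)"
  have "p \<noteq> 0" using p by auto
  have "?t i = 0" if "i \<in> {..p} - {0, p}" for i
    using that dvd_choose_prime[of i p] p
    by (auto simp: laurent_of_nat_eq_0)
  then have "(commut a ^^ p) u f = (\<Sum>i\<in>{0, p}. ?t i)"
    unfolding commut_funpow by (intro sum.mono_neutral_right) auto
  also have "\<dots> = a ^ p * u f + (- 1) ^ p * u (a ^ p * f)"
    using \<open>p \<noteq> 0\<close> by simp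
  \<comment> \<open>This includes \<open>p = 2\<close>, where the signs do not matter.\<close>
  also have "(- 1) ^ p = (- 1 :: ('k, 'n) laurent)"
  proof (cases "p = 2")
    case True
    have "(of_nat 2 :: ('k, 'n) laurent) = 0" using p True by (intro laurent_of_nat_eq_0) simp
    then have "(1 :: ('k, 'n) laurent) + 1 = 0" by simp
    then show ?thesis using True by (simp add: eq_neg_iff_add_eq_0)
  next
    case False
    then have "odd p" using p primes_dvd_imp_eq two_is_prime_nat by metis
    then show ?thesis by simp
  qed
  finally show "(commut a ^^ p) u f = commut (a ^ p) u f" by (simp add: commut_def[of "a ^ p"])
qed

text \<open>
  The commutator with \<open>a\<close> is the difference of left and right multiplication by \<open>a\<close>. These two
  operators commute, so that the Frobenius map is additive on their difference.
\<close>

lemma commut_funpow_char_power: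
  fixes a :: "('k::field, 'n::finite) laurent"
  assumes p: "prime p" "CHAR('k) = p"
  shows "commut a ^^ (p ^ k) = commut (a ^ (p ^ k))"
proof (induction k)
  case (Suc k)
  have "commut a ^^ (p ^ Suc k) = (commut a ^^ (p ^ k)) ^^ p"
    by (simp add: funpow_mult mult.commute)
  also have "\<dots> = commut ((a ^ (p ^ k)) ^ p)"
    unfolding Suc by (rule commut_funpow_char[OF p])
  finally show ?case by (simp add: power_mult[symmetric] mult.commute)
qed (simp add: One_nat_def)

text \<open>
  These are the endomorphisms linear over the subalgebra spanned by the monomials with exponents in
  \<open>q \<int>\<^sup>n\<close>. Their coefficients with respect to the monomials are periodic functions of the exponent.
\<close>

definition periodic_ops :: "nat \<Rightarrow> (('k::field, 'n::finite) laurent \<Rightarrow> ('k, 'n) laurent) set" where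
  "periodic_ops q = {u \<in> laurent_endos.
     \<forall>\<delta>. (\<forall>i. int q dvd \<delta> $ i) \<longrightarrow> commut (lmono \<delta>) u = (\<lambda>_. 0)}"

lemma periodic_ops_endo: "u \<in> periodic_ops q \<Longrightarrow> u \<in> laurent_endos"
  by (simp add: periodic_ops_def)

lemma periodic_opsD:
  assumes "u \<in> periodic_ops q" "\<And>i. int q dvd \<delta> $ i"
  shows "u (lmono \<delta> * f) = lmono \<delta> * u f"
proof -
  have "commut (lmono \<delta>) u f = 0" using assms by (simp add: periodic_ops_def)
  then show ?thesis by (simp add: commut_def)
qed

lemma periodic_opsI:
  assumes "u \<in> laurent_endos"
    "\<And>\<delta> f. (\<And>i. int q dvd \<delta> $ i) \<Longrightarrow> u (lmono \<delta> * f) = lmono \<delta> * u f"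
  shows "u \<in> periodic_ops q"
  using assms by (simp add: periodic_ops_def commut_def)

lemma periodic_ops_mono: "q dvd q' \<Longrightarrow> periodic_ops q \<subseteq> periodic_ops q'"
  by (auto intro!: periodic_opsI periodic_opsD[of _ q] dest: periodic_ops_endo)
    (meson dvd_trans int_dvd_int_iff)

lemma periodic_ops_1: "periodic_ops 1 = range mult_op"
proof (intro equalityI subsetI)
  fix u :: "('k::field, 'n::finite) laurent \<Rightarrow> ('k, 'n) laurent"
  assume u: "u \<in> periodic_ops 1"
  then show "u \<in> range mult_op"
    using endo_commuting_with_lmonos[of u] periodic_opsD[OF u, of _ 1] periodic_ops_endo[OF u] by auto
next
  fix u :: "('k::field, 'n::finite) laurent \<Rightarrow> ('k, 'n) laurent"
  assume "u \<in> range mult_op"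
  then obtain a where "u = mult_op a" by blast
  then show "u \<in> periodic_ops 1"
    using mult_op_endo[of a] by (auto intro!: periodic_opsI simp: mult_op_def mult.left_commute)
qed

lemma lmono_power: "lmono \<gamma> ^ q = lmono (\<chi> i. int q * \<gamma> $ i)"
proof (induction q)
  case 0
  have "(\<chi> i. int 0 * \<gamma> $ i) = 0" by (simp add: vec_eq_iff)
  then show ?case by (simp only: lmono_0 power_0)
next
  case (Suc q)
  have "\<gamma> + (\<chi> i. int q * \<gamma> $ i) = (\<chi> i. int (Suc q) * \<gamma> $ i)"
    by (simp add: vec_eq_iff algebra_simps)
  then show ?case using Suc by (simp add: lmono_mult)
qed

lemma commut_funpow_order:
  "u \<in> diff_ops_le m \<Longrightarrow> j > m \<Longrightarrow> (commut a ^^ j) u = (\<lambda>_. 0)"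
proof (induction j arbitrary: u m)
  case (Suc j)
  have "(commut a ^^ j) (commut a u) = (\<lambda>_. 0)"
  proof (cases m)
    case 0
    then have "commut a u = (\<lambda>_. 0)" using Suc.prems by (simp add: diff_ops_le_commut)
    then show ?thesis
      by (induction j) (simp_all add: commut_zero)
  next
    case (Suc m')
    then show ?thesis using Suc.IH[of "commut a u" m'] Suc.prems by (simp add: diff_ops_le_commut)
  qed
  then show ?case by (simp only: funpow_Suc_right comp_apply)
qed simp

lemma diff_ops_le_periodic:
  fixes u :: "('k::field, 'n::finite) laurent \<Rightarrow> ('k, 'n) laurent"
  assumes p: "prime p" "CHAR('k) = p" and u: "u \<in> diff_ops_le m" and m: "m < p ^ k"
  shows "u \<in> periodic_ops (p ^ k)"
  unfolding periodic_ops_def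
proof (intro CollectI conjI allI impI)
  show "u \<in> laurent_endos" using u by (rule diff_ops_le_endo)
  fix \<delta> :: "int ^ 'n" assume dvd: "\<forall>i. int (p ^ k) dvd \<delta> $ i"
  define \<gamma> where "\<gamma> = (\<chi> i. \<delta> $ i div int (p ^ k))"
  have "lmono \<delta> = (lmono \<gamma> ^ (p ^ k) :: ('k, 'n) laurent)"
    unfolding lmono_power by (rule arg_cong[of _ _ lmono]) (use dvd in \<open>auto simp: \<gamma>_def vec_eq_iff\<close>)
  then have "commut (lmono \<delta>) u = (commut (lmono \<gamma>) ^^ (p ^ k)) u"
    by (simp add: commut_funpow_char_power[OF p])
  also have "\<dots> = (\<lambda>_. 0)" using u m by (rule commut_funpow_order)
  finally show "commut (lmono \<delta>) u = (\<lambda>_. 0)" .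
qed

text \<open>
  The commutators with the variables commute with each other; passing from \<open>u\<close> to \<open>[x\<^sub>i, u]\<close> lowers
  the \<open>i\<close>-th nilpotency exponent by one and leaves the bounds for the other variables valid.
\<close>

lemma nilpotent_commut_order:
  fixes u :: "('k::field, 'n::finite) laurent \<Rightarrow> ('k, 'n) laurent"
  assumes "u \<in> laurent_endos" "\<And>i. (commut (laurent_var i) ^^ N i) u = (\<lambda>_. 0)"
  shows "u \<in> diff_ops_le (\<Sum>i\<in>UNIV. N i)"
  using assms
proof (induction "\<Sum>i\<in>UNIV. N i" arbitrary: u N)
  case 0
  then have "u = (\<lambda>_. 0)" by (metis (no_types) funpow_0 sum_eq_0_iff finite UNIV_I)
  then show ?case by (simp add: diff_ops_le_zero_op)
next
  case (Suc m)
  have "commut (laurent_var i) u \<in> diff_ops_le m" for i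
  proof (cases "N i")
    case 0
    then have "u = (\<lambda>_. 0)" using Suc.prems(2)[of i] by simp
    then show ?thesis by (simp add: commut_zero diff_ops_le_zero_op)
  next
    case (Suc l)
    let ?N = "N(i := l)"
    have "(\<Sum>j\<in>UNIV. N j) = N i + (\<Sum>j\<in>UNIV - {i}. N j)" "(\<Sum>j\<in>UNIV. ?N j) = ?N i + (\<Sum>j\<in>UNIV - {i}. ?N j)"
      by (rule sum.remove; simp)+
    moreover have "(\<Sum>j\<in>UNIV - {i}. ?N j) = (\<Sum>j\<in>UNIV - {i}. N j)" by (rule sum.cong) auto
    ultimately have m: "m = (\<Sum>j\<in>UNIV. ?N j)" using Suc \<open>Suc m = _\<close> by simp
    have "(commut (laurent_var j) ^^ ?N j) (commut (laurent_var i) u) = (\<lambda>_. 0)" for j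
    proof (cases "j = i")
      case True
      then show ?thesis using Suc.prems(2)[of i] Suc by (simp add: funpow_Suc_right del: funpow.simps)
    next
      case False
      then show ?thesis using Suc.prems(2)[of j]
        by (simp add: commut_zero flip: commut_commute_funpow)
    qed
    then show ?thesis using Suc.hyps(1)[OF m commut_endo[OF Suc.prems(1)]] m by simp
  qed
  then show ?case using diff_ops_le_SucI[OF Suc.prems(1)] Suc.hyps(2) by metis
qed

text \<open>
  Both inclusions use that the \<open>p ^ k\<close>-fold commutator with \<open>a\<close> is the commutator with
  \<open>a ^ (p ^ k)\<close>: it vanishes for an operator of order below \<open>p ^ k\<close>, and conversely a periodic operator
  is killed by the \<open>p ^ k\<close>-fold commutator with each variable.
\<close>

theorem diff_ops_periodic:
  assumes p: "prime p" "CHAR('k::field) = p"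
  shows "(diff_ops :: (('k, 'n::finite) laurent \<Rightarrow> ('k, 'n) laurent) set) = (\<Union>k. periodic_ops (p ^ k))"
proof (intro equalityI subsetI)
  fix u :: "('k, 'n) laurent \<Rightarrow> ('k, 'n) laurent"
  assume "u \<in> diff_ops"
  then obtain m where "u \<in> diff_ops_le m" by (auto simp: diff_ops_def)
  moreover have "m < p ^ m" using prime_gt_1_nat[OF p(1)] by (intro power_gt_expt) simp
  ultimately show "u \<in> (\<Union>k. periodic_ops (p ^ k))" using diff_ops_le_periodic[OF p] by blast
next
  fix u :: "('k, 'n) laurent \<Rightarrow> ('k, 'n) laurent"
  assume "u \<in> (\<Union>k. periodic_ops (p ^ k))"
  then obtain k where u: "u \<in> periodic_ops (p ^ k)" by blast
  have "(commut (laurent_var i) ^^ (p ^ k)) u = (\<lambda>_. 0)" for i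
    using u unfolding commut_funpow_char_power[OF p] laurent_var_lmono lmono_power
    by (simp add: periodic_ops_def)
  then have "u \<in> diff_ops_le (\<Sum>i\<in>(UNIV :: 'n set). p ^ k)"
    using periodic_ops_endo[OF u] by (intro nilpotent_commut_order)
  then show "u \<in> diff_ops" by (auto simp: diff_ops_def)
qed

text \<open>
  Conjugation by the monomial with exponent \<open>\<gamma>\<close>, with the sign for which \<open>\<partial>\<^sub>i\<close> goes to
  \<open>\<partial>\<^sub>i + \<gamma>\<^sub>i x\<^sub>i\<^sup>-\<^sup>1\<close>.
\<close>

definition shift_conj :: "int ^ 'n \<Rightarrow> (('k::field, 'n::finite) laurent \<Rightarrow> ('k, 'n) laurent) \<Rightarrow>
    ('k, 'n) laurent \<Rightarrow> ('k, 'n) laurent" where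
  "shift_conj \<gamma> u = (\<lambda>f. lmono (- \<gamma>) * u (lmono \<gamma> * f))"

lemma shift_conj_endo: "u \<in> laurent_endos \<Longrightarrow> shift_conj \<gamma> u \<in> laurent_endos"
  by (rule laurent_endosI)
    (simp_all add: shift_conj_def laurent_endos_simps distrib_left mult.left_commute[of _ "laurent_const _"])

lemma shift_conj_comp: "shift_conj \<gamma> (u \<circ> v) = shift_conj \<gamma> u \<circ> shift_conj \<gamma> v"
  by (simp add: shift_conj_def fun_eq_iff lmono_inverse)

lemma shift_conj_add: "shift_conj \<gamma> (\<lambda>f. u f + v f) = (\<lambda>f. shift_conj \<gamma> u f + shift_conj \<gamma> v f)"
  by (simp add: shift_conj_def fun_eq_iff distrib_left)

lemma shift_conj_mult_op: "shift_conj \<gamma> (mult_op a) = mult_op a"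
proof
  fix f
  have "shift_conj \<gamma> (mult_op a) f = lmono (- \<gamma>) * (lmono \<gamma> * (a * f))"
    by (simp add: shift_conj_def mult_op_def mult.left_commute)
  then show "shift_conj \<gamma> (mult_op a) f = mult_op a f"
    by (simp add: lmono_inverse mult_op_def)
qed

lemma shift_conj_shift_conj: "shift_conj \<gamma> (shift_conj \<delta> u) = shift_conj (\<gamma> + \<delta>) u"
  by (simp add: shift_conj_def fun_eq_iff lmono_mult_left add.commute)

lemma shift_conj_0: "shift_conj 0 u = u"
  by (simp add: shift_conj_def lmono_0)

lemma shift_conj_periodic:
  fixes u :: "('k::field, 'n::finite) laurent \<Rightarrow> ('k, 'n) laurent"
  assumes "u \<in> periodic_ops q"
  shows "shift_conj \<gamma> u \<in> periodic_ops q"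
proof (rule periodic_opsI)
  fix \<delta> :: "int ^ 'n" and f assume "\<And>i. int q dvd \<delta> $ i"
  then have "u (lmono \<delta> * (lmono \<gamma> * f)) = lmono \<delta> * u (lmono \<gamma> * f)"
    by (rule periodic_opsD[OF assms])
  then show "shift_conj \<gamma> u (lmono \<delta> * f) = lmono \<delta> * shift_conj \<gamma> u f"
    by (simp add: shift_conj_def mult.left_commute)
qed (intro shift_conj_endo periodic_ops_endo[OF assms])

lemma shift_conj_periodic_cong:
  assumes u: "u \<in> periodic_ops q" and cong: "\<And>i. int q dvd \<gamma> $ i - \<delta> $ i"
  shows "shift_conj \<gamma> u = shift_conj \<delta> u"
proof
  fix f
  have "u (lmono \<gamma> * f) = u (lmono (\<gamma> - \<delta>) * (lmono \<delta> * f))" by (simp add: lmono_mult_left)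
  also have "\<dots> = lmono (\<gamma> - \<delta>) * u (lmono \<delta> * f)" by (rule periodic_opsD[OF u]) (simp add: cong)
  finally show "shift_conj \<gamma> u f = shift_conj \<delta> u f"
    by (simp add: shift_conj_def lmono_mult_left)
qed

definition diag_op :: "(int ^ 'n \<Rightarrow> 'k) \<Rightarrow> ('k::field, 'n::finite) laurent \<Rightarrow> ('k, 'n) laurent" where
  "diag_op = monomial_op 0"

lemma lookup_diag_op:
  fixes f :: "('k::field, 'n::finite) laurent"
  shows "Poly_Mapping.lookup (diag_op c f) \<beta> = c \<beta> * Poly_Mapping.lookup f \<beta>"
proof -
  have "\<beta> + (\<chi> i. int ((0 :: nat ^ 'n) $ i)) = \<beta>" by (simp add: vec_eq_iff)
  then show ?thesis unfolding diag_op_def lookup_monomial_op by simp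
qed

lemma diag_op_endo: "diag_op c \<in> laurent_endos"
  by (simp add: diag_op_def monomial_op_endo)

lemma diag_op_comp: "diag_op c \<circ> diag_op d = diag_op (\<lambda>\<beta>. c \<beta> * d \<beta>)"
  by (intro ext poly_mapping_eqI) (simp add: lookup_diag_op)

lemma diag_op_add: "(\<lambda>f. diag_op c f + diag_op d f) = diag_op (\<lambda>\<beta>. c \<beta> + d \<beta>)"
  by (intro ext poly_mapping_eqI) (simp add: lookup_diag_op lookup_add distrib_right)

lemma diag_op_const: "diag_op (\<lambda>_. c) = mult_op (laurent_const c)"
  by (intro ext poly_mapping_eqI) (simp add: lookup_diag_op mult_op_def lookup_const_mult)

lemma diag_op_lmono: "diag_op c (lmono \<beta>) = laurent_const (c \<beta>) * lmono \<beta>"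
  by (rule poly_mapping_eqI) (simp add: lookup_diag_op lookup_const_mult lookup_lmono)

lemma shift_conj_diag_op: "shift_conj \<gamma> (diag_op c) = diag_op (\<lambda>\<beta>. c (\<beta> + \<gamma>))"
  by (intro ext poly_mapping_eqI) (simp add: lookup_diag_op shift_conj_def lookup_lmono_mult)

lemma diag_op_periodic:
  fixes c :: "int ^ 'n::finite \<Rightarrow> 'k::field"
  assumes "\<And>\<beta> \<delta>. (\<And>i. int q dvd \<delta> $ i) \<Longrightarrow> c (\<beta> + \<delta>) = c \<beta>"
  shows "diag_op c \<in> periodic_ops q"
proof (rule periodic_opsI[OF diag_op_endo])
  fix \<delta> :: "int ^ 'n" and f assume *: "\<And>i. int q dvd \<delta> $ i"
  show "diag_op c (lmono \<delta> * f) = lmono \<delta> * diag_op c f"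
    by (rule poly_mapping_eqI)
      (use assms[OF *, of "_ - \<delta>"] in \<open>simp add: lookup_diag_op lookup_lmono_mult\<close>)
qed

definition lattice_proj :: "nat \<Rightarrow> ('k::field, 'n::finite) laurent \<Rightarrow> ('k, 'n) laurent" where
  "lattice_proj q = diag_op (\<lambda>\<beta>. if \<forall>i. int q dvd \<beta> $ i then 1 else 0)"

lemma lattice_proj_periodic: "lattice_proj q \<in> periodic_ops q"
  unfolding lattice_proj_def by (rule diag_op_periodic) (simp add: dvd_add_left_iff)

lemma lattice_proj_1: "lattice_proj q 1 = 1"
  unfolding lattice_proj_def lmono_0[symmetric] diag_op_lmono by (simp add: laurent_const_simps)

text \<open>
  Conjugation moves the lattice \<open>q \<int>\<^sup>n\<close> to the coset of \<open>- \<gamma>\<close>.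
\<close>

lemma shift_conj_lattice_proj_inj:
  assumes "shift_conj \<gamma> (lattice_proj q :: ('k::field, 'n::finite) laurent \<Rightarrow> _) = shift_conj \<delta> (lattice_proj q)"
  shows "int q dvd \<gamma> $ i - \<delta> $ i"
proof -
  have "Poly_Mapping.lookup (shift_conj \<gamma> (lattice_proj q) (lmono (- \<delta>)) :: ('k, 'n) laurent) (- \<delta>) =
      Poly_Mapping.lookup (shift_conj \<delta> (lattice_proj q) (lmono (- \<delta>))) (- \<delta>)"
    by (simp only: assms)
  then show ?thesis
    by (simp add: lattice_proj_def shift_conj_diag_op lookup_diag_op lookup_lmono split: if_splits)
qed

section \<open>Automorphisms fixing the Laurent polynomials\<close>

text \<open>
  Linearity over the field follows from multiplicativity, as constants are Laurent polynomials.
\<close>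

definition fixes_laurent :: "((('k::field, 'n::finite) laurent \<Rightarrow> ('k, 'n) laurent) \<Rightarrow>
    (('k, 'n) laurent \<Rightarrow> ('k, 'n) laurent)) \<Rightarrow> bool" where
  "fixes_laurent \<sigma> \<longleftrightarrow> (\<forall>u\<in>diff_ops. \<sigma> u \<in> diff_ops) \<and>
     (\<forall>u\<in>diff_ops. \<forall>v\<in>diff_ops. \<sigma> (u \<circ> v) = \<sigma> u \<circ> \<sigma> v) \<and>
     (\<forall>u\<in>diff_ops. \<forall>v\<in>diff_ops. \<sigma> (\<lambda>f. u f + v f) = (\<lambda>f. \<sigma> u f + \<sigma> v f)) \<and>
     (\<forall>a. \<sigma> (mult_op a) = mult_op a)"

lemma fixes_laurentD:
  assumes "fixes_laurent \<sigma>"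
  shows "u \<in> diff_ops \<Longrightarrow> \<sigma> u \<in> diff_ops"
    "u \<in> diff_ops \<Longrightarrow> v \<in> diff_ops \<Longrightarrow> \<sigma> (u \<circ> v) = \<sigma> u \<circ> \<sigma> v"
    "u \<in> diff_ops \<Longrightarrow> v \<in> diff_ops \<Longrightarrow> \<sigma> (\<lambda>f. u f + v f) = (\<lambda>f. \<sigma> u f + \<sigma> v f)"
    "\<sigma> (mult_op a) = mult_op a"
  using assms by (simp_all add: fixes_laurent_def)

lemma shift_conj_diff_ops:
  fixes u :: "('k::field, 'n::finite) laurent \<Rightarrow> ('k, 'n) laurent"
  assumes "u \<in> diff_ops"
  shows "shift_conj \<gamma> u \<in> diff_ops"
proof -
  have "shift_conj \<gamma> u = mult_op (lmono (- \<gamma>)) \<circ> (u \<circ> mult_op (lmono \<gamma>))"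
    by (simp add: shift_conj_def mult_op_def fun_eq_iff)
  then show ?thesis using assms by (simp add: diff_ops_comp mult_op_diff_ops)
qed

lemma fixes_laurent_shift_conj:
  "fixes_laurent \<sigma> \<Longrightarrow> fixes_laurent (\<lambda>u. shift_conj \<gamma> (\<sigma> u))"
  by (simp add: fixes_laurent_def shift_conj_diff_ops shift_conj_comp shift_conj_add shift_conj_mult_op)

text \<open>
  With \<open>e\<close> the projection onto the span of the monomials with exponents in the lattice, an operator
  \<open>u\<close> that commutes with these monomials satisfies \<open>u \<circ> f \<circ> e = u(f) \<circ> e\<close> for every multiplication
  operator \<open>f\<close>. The right hand side does not move when \<open>e\<close> does not, and evaluation at \<open>1\<close> recovers
  \<open>u\<close>.
\<close>

lemma fixes_periodic_ops:
  fixes u :: "('k::field, 'n::finite) laurent \<Rightarrow> ('k, 'n) laurent"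
  assumes \<sigma>: "fixes_laurent \<sigma>" and e: "\<sigma> (lattice_proj q) = lattice_proj q"
    and u: "u \<in> periodic_ops q" and D: "u \<in> diff_ops" "lattice_proj q \<in> (diff_ops :: (('k, 'n) laurent \<Rightarrow> _) set)"
  shows "\<sigma> u = u"
proof
  fix f
  let ?e = "lattice_proj q :: ('k, 'n) laurent \<Rightarrow> ('k, 'n) laurent"
  have eq: "u \<circ> (mult_op f \<circ> ?e) = mult_op (u f) \<circ> ?e"
  proof (rule laurent_endos_ext)
    have endo: "?e \<in> laurent_endos" by (simp add: lattice_proj_def diag_op_endo)
    then show "u \<circ> (mult_op f \<circ> ?e) \<in> laurent_endos" "mult_op (u f) \<circ> ?e \<in> laurent_endos"
      using periodic_ops_endo[OF u] by (auto intro!: comp_endo mult_op_endo)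
    fix \<beta> :: "int ^ 'n"
    show "(u \<circ> (mult_op f \<circ> ?e)) (lmono \<beta>) = (mult_op (u f) \<circ> ?e) (lmono \<beta>)"
    proof (cases "\<forall>i. int q dvd \<beta> $ i")
      case True
      then have "u (lmono \<beta> * f) = lmono \<beta> * u f" by (intro periodic_opsD[OF u]) simp
      then show ?thesis using True
        by (simp add: lattice_proj_def diag_op_lmono laurent_const_simps mult_op_def mult.commute)
    next
      case False
      then show ?thesis using periodic_ops_endo[OF u]
        by (auto simp: lattice_proj_def diag_op_lmono laurent_const_simps mult_op_def laurent_endos_simps)
    qed
  qed
  have "\<sigma> (u \<circ> (mult_op f \<circ> ?e)) = \<sigma> u \<circ> (mult_op f \<circ> ?e)"
    by (simp add: fixes_laurentD[OF \<sigma>] D diff_ops_comp mult_op_diff_ops e)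
  moreover have "\<sigma> (mult_op (u f) \<circ> ?e) = mult_op (u f) \<circ> ?e"
    by (simp add: fixes_laurentD[OF \<sigma>] D mult_op_diff_ops e)
  ultimately have "(\<sigma> u \<circ> (mult_op f \<circ> ?e)) 1 = (mult_op (u f) \<circ> ?e) 1"
    unfolding eq by simp
  then show "\<sigma> u f = u f" by (simp add: lattice_proj_1 mult_op_def)
qed

lemma lookup_mult_keys:
  fixes a g :: "('k::field, 'n::finite) laurent"
  shows "Poly_Mapping.lookup (a * g) \<beta> =
    (\<Sum>\<gamma>\<in>Poly_Mapping.keys a. Poly_Mapping.lookup a \<gamma> * Poly_Mapping.lookup g (\<beta> - \<gamma>))"
  by (subst laurent_expand[of a])
    (simp add: sum_distrib_right lookup_sum lookup_single_mult flip: single_eq_const_lmono)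

text \<open>
  If \<open>a\<close> were not constant, take an exponent \<open>\<delta> \<noteq> 0\<close> of \<open>a\<close> of maximal Euclidean length. The linear
  functional \<open>\<langle>\<cdot>, \<delta>\<rangle>\<close> attains its maximum on the exponents of \<open>a\<close> at \<open>\<delta>\<close> only, so that
  \<open>a\<^sub>\<delta> ^ j\<close> is the coefficient of \<open>x ^ (j \<delta>)\<close> in the image of \<open>1\<close> under the \<open>j\<close>-th power of the
  operator: for \<open>j = p\<close> it does not vanish, although this exponent is out of reach of the operator
  itself.
\<close>

lemma p_power_fixed_constant:
  fixes a :: "('k::field, 'n::finite) laurent" and c :: "int ^ 'n \<Rightarrow> 'k"
  assumes W: "W = (\<lambda>f. diag_op c f + a * f)" and eq: "W ^^ p = W" and p: "1 < p"
  shows "a = laurent_const (Poly_Mapping.lookup a 0)"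
proof (rule ccontr)
  assume nonconst: "a \<noteq> laurent_const (Poly_Mapping.lookup a 0)"
  let ?K = "Poly_Mapping.keys a"
  define ip where "ip \<gamma> \<delta> = (\<Sum>i\<in>UNIV. \<gamma> $ i * \<delta> $ i)" for \<gamma> \<delta> :: "int ^ 'n"
  have ip_simps: "ip (\<gamma> - \<delta>) \<epsilon> = ip \<gamma> \<epsilon> - ip \<delta> \<epsilon>" "ip \<epsilon> (\<gamma> - \<delta>) = ip \<epsilon> \<gamma> - ip \<epsilon> \<delta>"
    "ip \<gamma> \<delta> = ip \<delta> \<gamma>" for \<gamma> \<delta> \<epsilon>
    by (simp_all add: ip_def algebra_simps sum_subtractf)
  have ip_pos: "ip \<gamma> \<gamma> > 0" if "\<gamma> \<noteq> 0" for \<gamma>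
  proof -
    have "ip \<gamma> \<gamma> \<ge> 0" by (simp add: ip_def sum_nonneg)
    moreover have "ip \<gamma> \<gamma> \<noteq> 0" using that by (auto simp: ip_def sum_nonneg_eq_0_iff vec_eq_iff)
    ultimately show ?thesis by simp
  qed
  have "\<exists>\<gamma>. Poly_Mapping.lookup a \<gamma> \<noteq> Poly_Mapping.lookup (laurent_const (Poly_Mapping.lookup a 0)) \<gamma>"
    using nonconst by (metis poly_mapping_eqI)
  then obtain \<gamma>0 where \<gamma>0: "\<gamma>0 \<in> ?K" "\<gamma>0 \<noteq> 0"
    by (auto simp: laurent_const_def lookup_single when_def in_keys_iff split: if_splits)
  have "Max ((\<lambda>\<gamma>. ip \<gamma> \<gamma>) ` ?K) \<in> (\<lambda>\<gamma>. ip \<gamma> \<gamma>) ` ?K"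
    using \<gamma>0(1) by (intro Max_in) auto
  then obtain \<delta> where \<delta>: "\<delta> \<in> ?K" and \<delta>_Max: "ip \<delta> \<delta> = Max ((\<lambda>\<gamma>. ip \<gamma> \<gamma>) ` ?K)"
    by auto
  have max: "ip \<gamma> \<gamma> \<le> ip \<delta> \<delta>" if "\<gamma> \<in> ?K" for \<gamma>
    unfolding \<delta>_Max using that by (intro Max_ge) auto
  have "\<delta> \<noteq> 0" using max[OF \<gamma>0(1)] ip_pos[OF \<gamma>0(2)] by (auto simp: ip_def)
  define N where "N = ip \<delta> \<delta>"
  have N: "N > 0" using ip_pos[OF \<open>\<delta> \<noteq> 0\<close>] by (simp add: N_def)
  have less: "ip \<gamma> \<delta> < N" if "\<gamma> \<in> ?K" "\<gamma> \<noteq> \<delta>" for \<gamma>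
    using ip_pos[of "\<gamma> - \<delta>"] max[OF that(1)] that(2) ip_simps(3)[of \<gamma> \<delta>] by (simp add: ip_simps(1,2) N_def)
  then have le: "ip \<gamma> \<delta> \<le> N" if "\<gamma> \<in> ?K" for \<gamma>
    using that by (cases "\<gamma> = \<delta>") (auto simp: N_def less_imp_le)
  define mult where "mult j = (\<chi> i. int j * \<delta> $ i)" for j
  have ip_mult: "ip (mult j) \<delta> = int j * N" for j
    by (simp add: ip_def mult_def N_def sum_distrib_left mult.assoc)
  let ?g = "\<lambda>j. (W ^^ j) 1"
  have lookup_W: "Poly_Mapping.lookup (W g) \<beta> = c \<beta> * Poly_Mapping.lookup g \<beta> +
      (\<Sum>\<gamma>\<in>?K. Poly_Mapping.lookup a \<gamma> * Poly_Mapping.lookup g (\<beta> - \<gamma>))" for g \<beta>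
    by (simp add: W lookup_add lookup_diag_op lookup_mult_keys)
  have bound: "Poly_Mapping.lookup (?g j) \<beta> = 0" if "ip \<beta> \<delta> > int j * N" for j \<beta>
    using that
  proof (induction j arbitrary: \<beta>)
    case 0
    then have "\<beta> \<noteq> 0" by (auto simp: ip_def)
    then show ?case by (simp add: lookup_one)
  next
    case (Suc j)
    have "ip \<beta> \<delta> > int j * N" using Suc.prems N by (simp add: distrib_right)
    moreover have "ip (\<beta> - \<gamma>) \<delta> > int j * N" if "\<gamma> \<in> ?K" for \<gamma>
      using Suc.prems le[OF that] by (simp add: ip_simps(1) distrib_right)
    ultimately show ?case using Suc.IH by (simp add: lookup_W)
  qed
  have lead: "Poly_Mapping.lookup (?g j) (mult j) = Poly_Mapping.lookup a \<delta> ^ j" for j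
  proof (induction j)
    case 0
    have "mult 0 = 0" by (simp add: mult_def vec_eq_iff)
    then show ?case by simp
  next
    case (Suc j)
    have *: "mult (Suc j) - \<delta> = mult j" by (simp add: mult_def vec_eq_iff algebra_simps)
    have "Poly_Mapping.lookup (?g j) (mult (Suc j) - \<gamma>) = 0" if "\<gamma> \<in> ?K - {\<delta>}" for \<gamma>
      using that less[of \<gamma>] by (intro bound) (auto simp: ip_simps(1) ip_mult distrib_right)
    then have "(\<Sum>\<gamma>\<in>?K. Poly_Mapping.lookup a \<gamma> * Poly_Mapping.lookup (?g j) (mult (Suc j) - \<gamma>)) =
        (\<Sum>\<gamma>\<in>{\<delta>}. Poly_Mapping.lookup a \<gamma> * Poly_Mapping.lookup (?g j) (mult (Suc j) - \<gamma>))"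
      using \<delta> by (intro sum.mono_neutral_right) auto
    moreover have "Poly_Mapping.lookup (?g j) (mult (Suc j)) = 0"
      by (rule bound) (use N in \<open>simp add: ip_mult distrib_right\<close>)
    ultimately show ?case by (simp add: lookup_W * Suc.IH)
  qed
  have "Poly_Mapping.lookup (?g 1) (mult p) = 0"
    by (rule bound) (use N p in \<open>simp add: ip_mult\<close>)
  moreover have "?g p = ?g 1" using eq by (simp add: One_nat_def)
  ultimately have "Poly_Mapping.lookup a \<delta> ^ p = 0" using lead[of p] by metis
  then show False using \<delta> by (simp add: in_keys_iff)
qed

lemma of_nat_power_char:
  assumes p: "prime p" "CHAR('k::field) = p"
  shows "(of_nat r :: 'k) ^ p = of_nat r"
proof (induction r)
  case 0
  show ?case using prime_gt_0_nat[OF p(1)] by simp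
next
  case (Suc r)
  have "prime CHAR('k)" "p = CHAR('k)" using p by simp_all
  then have "(1 + of_nat r :: 'k) ^ p = 1 ^ p + of_nat r ^ p" by (rule freshmans_dream)
  also have "\<dots> = 1 + of_nat r" unfolding Suc.IH power_one ..
  finally show ?case unfolding of_nat_Suc .
qed

lemma of_int_power_char:
  assumes p: "prime p" "CHAR('k::field) = p"
  shows "(of_int z :: 'k) ^ p = of_int z"
proof -
  have "0 \<le> z mod int p" using prime_gt_0_nat[OF p(1)] by simp
  then have "(of_int z :: 'k) = of_int (int (nat (z mod int p)))"
    unfolding of_int_eq_iff_cong_CHAR p(2) by (simp add: cong_def)
  then have z: "(of_int z :: 'k) = of_nat (nat (z mod int p))" unfolding of_int_of_nat_eq .
  show ?thesis unfolding z by (rule of_nat_power_char[OF p])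
qed

text \<open>
  The polynomial \<open>X ^ p - X\<close> has at most \<open>p\<close> roots in a field, and the elements of the prime field
  are \<open>p\<close> of them.
\<close>

lemma frobenius_fixed_prime_field:
  fixes d :: "'k::field"
  assumes p: "prime p" "CHAR('k) = p" and d: "d ^ p = d"
  shows "\<exists>r. d = of_nat r"
proof -
  define P :: "'k poly" where "P = Polynomial.monom 1 p - Polynomial.monom 1 1"
  have "1 < p" using p(1) by (rule prime_gt_1_nat)
  have deg: "degree P \<le> p"
    unfolding P_def
  proof (rule degree_diff_le)
    show "degree (Polynomial.monom (1 :: 'k) 1) \<le> p"
      by (rule order_trans[OF degree_monom_le]) (use \<open>1 < p\<close> in simp)
  qed (rule degree_monom_le)
  have "coeff P p = 1" using \<open>1 < p\<close> by (simp add: P_def)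
  then have "P \<noteq> 0" by auto
  have root: "poly P x = 0 \<longleftrightarrow> x ^ p = x" for x
    by (simp add: P_def poly_monom)
  note nat_root = of_nat_power_char[OF p]
  have inj: "inj_on (of_nat :: nat \<Rightarrow> 'k) {..<p}"
    using p(2) by (auto intro!: inj_onI simp: of_nat_eq_iff_cong_CHAR cong_def)
  have fin: "finite {x. poly P x = 0}" using \<open>P \<noteq> 0\<close> by (rule poly_roots_finite)
  have "of_nat ` {..<p} = {x. poly P x = 0}"
  proof (rule card_subset_eq[OF fin])
    show "of_nat ` {..<p} \<subseteq> {x. poly P x = 0}" using nat_root by (auto simp: root)
    have "card {x. poly P x = 0} \<le> p"
      using card_poly_roots_bound[OF \<open>P \<noteq> 0\<close>] deg by simp
    moreover have "card {x. poly P x = 0} \<ge> card (of_nat ` {..<p} :: 'k set)"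
      by (rule card_mono[OF fin]) (use nat_root in \<open>auto simp: root\<close>)
    ultimately show "card (of_nat ` {..<p} :: 'k set) = card {x. poly P x = 0}"
      unfolding card_image[OF inj] card_lessThan by (rule antisym[rotated])
  qed
  moreover have "d \<in> {x. poly P x = 0}" using d by (simp add: root)
  ultimately show ?thesis by blast
qed


text \<open>
  For \<open>q = p ^ k\<close> the eigenvalue on the monomial \<open>x ^ \<beta>\<close> is the \<open>k\<close>-th digit of \<open>\<beta>\<^sub>i\<close> in base
  \<open>p\<close>: the higher digits vanish in the field.
\<close>

definition digit_op :: "nat \<Rightarrow> 'n \<Rightarrow> ('k::field, 'n::finite) laurent \<Rightarrow> ('k, 'n) laurent" where
  "digit_op q i = diag_op (\<lambda>\<beta>. of_int (\<beta> $ i div int q))"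

lemma digit_op_periodic:
  assumes p: "prime p" "CHAR('k::field) = p" and q: "q > 0"
  shows "(digit_op q i :: ('k, 'n::finite) laurent \<Rightarrow> _) \<in> periodic_ops (p * q)"
  unfolding digit_op_def
proof (rule diag_op_periodic)
  fix \<beta> \<delta> :: "int ^ 'n" assume "\<And>i. int (p * q) dvd \<delta> $ i"
  then obtain z where z: "\<delta> $ i = int (p * q) * z" by blast
  have "(\<beta> $ i + \<delta> $ i) div int q = \<beta> $ i div int q + int p * z"
    using q unfolding z by (simp add: mult.assoc mult.left_commute[of "int p" "int q"])
  then show "(of_int ((\<beta> + \<delta>) $ i div int q) :: 'k) = of_int (\<beta> $ i div int q)"
    unfolding of_int_eq_iff_cong_CHAR p(2) by (simp add: cong_def)
qed

text \<open>The carry that arises when \<open>\<delta>\<close> is added depends on the lower digits only.\<close>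

lemma commut_digit_op_periodic:
  fixes \<delta> :: "int ^ 'n::finite"
  assumes q: "q > 0"
  shows "commut (lmono \<delta>) (digit_op q i :: ('k::field, 'n) laurent \<Rightarrow> _) \<in> periodic_ops q"
proof -
  let ?c = "\<lambda>\<beta> :: int ^ 'n. of_int (\<beta> $ i div int q) - of_int ((\<beta> + \<delta>) $ i div int q) :: 'k"
  have eq: "commut (lmono \<delta>) (digit_op q i) = (mult_op (lmono \<delta>) \<circ> diag_op ?c)"
    by (intro ext poly_mapping_eqI)
      (simp add: commut_def digit_op_def mult_op_def lookup_minus lookup_lmono_mult lookup_diag_op
        left_diff_distrib)
  have c: "diag_op ?c \<in> periodic_ops q"
  proof (rule diag_op_periodic)
    fix \<beta> \<epsilon> :: "int ^ 'n" assume "\<And>i. int q dvd \<epsilon> $ i"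
    then obtain z where z: "\<epsilon> $ i = int q * z" by blast
    have 1: "(\<beta> $ i + int q * z) div int q = \<beta> $ i div int q + z" using q by simp
    have 2: "(\<beta> $ i + int q * z + \<delta> $ i) div int q = (\<beta> $ i + \<delta> $ i) div int q + z"
      using q div_mult_self2[of "int q" "\<beta> $ i + \<delta> $ i" z] by (simp add: algebra_simps)
    show "?c (\<beta> + \<epsilon>) = ?c \<beta>" by (simp add: z 1 2)
  qed
  show ?thesis
    unfolding eq
  proof (rule periodic_opsI)
    fix \<epsilon> :: "int ^ 'n" and f assume "\<And>i. int q dvd \<epsilon> $ i"
    then show "(mult_op (lmono \<delta>) \<circ> diag_op ?c) (lmono \<epsilon> * f) =
        lmono \<epsilon> * (mult_op (lmono \<delta>) \<circ> diag_op ?c) f"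
      using periodic_opsD[OF c, of \<epsilon> f] by (simp add: mult_op_def mult.left_commute)
  qed (intro comp_endo mult_op_endo diag_op_endo)
qed

lemma diag_op_funpow: "diag_op c ^^ Suc j = diag_op (\<lambda>\<beta>. c \<beta> ^ Suc j)"
proof (induction j)
  case (Suc j)
  show ?case unfolding funpow.simps(2)[of "Suc j"] Suc.IH diag_op_comp by simp
qed simp

lemma digit_op_funpow:
  assumes p: "prime p" "CHAR('k::field) = p"
  shows "(digit_op q i :: ('k, 'n::finite) laurent \<Rightarrow> _) ^^ p = digit_op q i"
proof -
  obtain j where j: "p = Suc j" using prime_gt_0_nat[OF p(1)] gr0_conv_Suc by blast
  have pow: "(of_int z :: 'k) ^ Suc j = of_int z" for z using of_int_power_char[OF p] unfolding j .
  show ?thesis unfolding digit_op_def j diag_op_funpow pow ..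
qed

lemma fixes_laurent_funpow:
  assumes \<sigma>: "fixes_laurent \<sigma>" and u: "u \<in> diff_ops"
  shows "u ^^ j \<in> diff_ops \<and> \<sigma> (u ^^ j) = \<sigma> u ^^ j"
proof (induction j)
  case 0
  have id: "id = mult_op 1" by (simp add: mult_op_def fun_eq_iff)
  show ?case unfolding funpow.simps(1) id using mult_op_diff_ops[of 1] fixes_laurentD(4)[OF \<sigma>, of 1] by blast
next
  case (Suc j)
  then have IH: "u ^^ j \<in> diff_ops" "\<sigma> (u ^^ j) = \<sigma> u ^^ j" by blast+
  show ?case
    unfolding funpow.simps(2) fixes_laurentD(2)[OF \<sigma> u IH(1)] IH(2)
    using diff_ops_comp[OF u IH(1)] by blast
qed

lemma periodic_ops_diff_ops:
  assumes p: "prime p" "CHAR('k::field) = p"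
  shows "periodic_ops (p ^ k) \<subseteq> (diff_ops :: (('k, 'n::finite) laurent \<Rightarrow> ('k, 'n) laurent) set)"
  using diff_ops_periodic[OF p] by blast

lemma fixes_laurent_commut:
  assumes \<sigma>: "fixes_laurent \<sigma>" and u: "u \<in> diff_ops"
  shows "\<sigma> (commut a u) = commut a (\<sigma> u)"
proof -
  have eq: "commut a v = (\<lambda>f. (mult_op a \<circ> v) f + (mult_op (- 1) \<circ> (v \<circ> mult_op a)) f)" for v
    by (simp add: commut_def mult_op_def fun_eq_iff)
  show ?thesis
    unfolding eq using u
    by (subst fixes_laurentD(3)[OF \<sigma>])
      (simp_all add: diff_ops_comp mult_op_diff_ops fixes_laurentD(2,4)[OF \<sigma>])
qed

text \<open>
  The commutators of the digit operator \<open>u\<close> with the monomials are fixed by \<open>\<sigma>\<close>, so that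
  \<open>\<sigma>(u) - u\<close> commutes with \<open>L\<close> and is multiplication by a Laurent polynomial; as \<open>\<sigma>(u) ^ p = \<sigma>(u)\<close>,
  it is a constant of the prime field.
\<close>

lemma digit_op_image:
  fixes \<sigma> :: "(('k::field, 'n::finite) laurent \<Rightarrow> ('k, 'n) laurent) \<Rightarrow> (('k, 'n) laurent \<Rightarrow> ('k, 'n) laurent)"
  assumes p: "prime p" "CHAR('k) = p" and \<sigma>: "fixes_laurent \<sigma>"
    and e: "\<sigma> (lattice_proj (p ^ k)) = lattice_proj (p ^ k)"
  shows "\<exists>r. \<sigma> (digit_op (p ^ k) i) = diag_op (\<lambda>\<beta>. of_int (\<beta> $ i div int (p ^ k)) + of_nat r)"
proof -
  let ?u = "digit_op (p ^ k) i :: ('k, 'n) laurent \<Rightarrow> ('k, 'n) laurent"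
  have "p > 1" using p(1) by (rule prime_gt_1_nat)
  then have q: "p ^ k > 0" by simp
  have u: "?u \<in> diff_ops"
    using digit_op_periodic[OF p q] periodic_ops_diff_ops[OF p, of "Suc k"] by auto
  define v where "v = (\<lambda>f. \<sigma> ?u f + (mult_op (- 1) \<circ> ?u) f)"
  have v: "v \<in> diff_ops"
    unfolding v_def using u fixes_laurentD(1)[OF \<sigma> u] by (intro diff_ops_add diff_ops_comp mult_op_diff_ops)
  have "v (lmono \<delta>) = lmono \<delta> * v 1" for \<delta>
  proof -
    have "commut (lmono \<delta>) ?u \<in> periodic_ops (p ^ k)" using q by (rule commut_digit_op_periodic)
    then have "\<sigma> (commut (lmono \<delta>) ?u) = commut (lmono \<delta>) ?u"
      using lattice_proj_periodic[of "p ^ k"] periodic_ops_diff_ops[OF p, of k]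
      by (intro fixes_periodic_ops[OF \<sigma> e]) auto
    then have "commut (lmono \<delta>) (\<sigma> ?u) 1 = commut (lmono \<delta>) ?u 1"
      by (simp add: fixes_laurent_commut[OF \<sigma> u])
    then show ?thesis by (simp add: v_def commut_def mult_op_def algebra_simps)
  qed
  then have v_eq: "v = mult_op (v 1)"
    using endo_commuting_with_lmonos[OF diff_ops_endo[OF v]] by blast
  \<comment> \<open>An operator that commutes with \<open>L\<close> is multiplication by its value at \<open>1\<close>.\<close>
  define a where "a = v 1"
  have v_a: "v f = mult_op a f" for f unfolding a_def by (rule fun_cong[OF v_eq])
  have "\<sigma> ?u f = ?u f + a * f" for f
    using v_a[of f] by (simp add: v_def mult_op_def algebra_simps)
  then have \<sigma>u: "\<sigma> ?u = (\<lambda>f. ?u f + a * f)" by blast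
  have pow: "\<sigma> ?u ^^ p = \<sigma> ?u"
    using fixes_laurent_funpow[OF \<sigma> u, of p] by (simp add: digit_op_funpow[OF p])
  define d where "d = Poly_Mapping.lookup a 0"
  have a: "a = laurent_const d"
    unfolding d_def using \<open>p > 1\<close>
    by (intro p_power_fixed_constant[OF \<sigma>u[unfolded digit_op_def] pow[unfolded digit_op_def]])
  have \<sigma>u': "\<sigma> ?u = diag_op (\<lambda>\<beta>. of_int (\<beta> $ i div int (p ^ k)) + d)"
    unfolding \<sigma>u unfolding a digit_op_def diag_op_add[symmetric] diag_op_const by (simp add: mult_op_def)
  obtain j where j: "p = Suc j" using \<open>p > 1\<close> by (cases p) auto
  have "(diag_op (\<lambda>\<beta> :: int ^ 'n. of_int (\<beta> $ i div int (p ^ k)) + d) ^^ Suc j) (lmono 0) =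
      diag_op (\<lambda>\<beta>. of_int (\<beta> $ i div int (p ^ k)) + d) (lmono 0)"
    using pow unfolding \<sigma>u' using j by metis
  then have "laurent_const (d ^ Suc j) = (laurent_const d :: ('k, 'n) laurent)"
    unfolding diag_op_funpow diag_op_lmono by (simp add: lmono_0)
  then have "d ^ p = d" unfolding laurent_const_def j by (rule injD[OF inj_single])
  then obtain r where "d = of_nat r" using frobenius_fixed_prime_field[OF p] by blast
  then show ?thesis using \<sigma>u' by auto
qed

text \<open>
  If \<open>q\<close> divides \<open>\<beta>\<^sub>i\<close>, then \<open>p q\<close> divides it if and only if the next digit vanishes, and \<open>1 - z ^ (p - 1)\<close> is
  the indicator of \<open>z = 0\<close> on the prime field.
\<close>

lemma lattice_indicator_Suc:
  fixes \<beta> :: "int ^ 'n::finite"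
  assumes p: "prime p" "CHAR('k::field) = p" and q: "q > 0"
  shows "(if \<forall>i. int (p * q) dvd \<beta> $ i then 1 else 0 :: 'k) =
    (if \<forall>i. int q dvd \<beta> $ i then 1 else 0) *
    (\<Prod>i\<in>UNIV. 1 + (- 1) * of_int (\<beta> $ i div int q) ^ (p - 1))"
proof (cases "\<forall>i. int q dvd \<beta> $ i")
  case False
  then have "\<not> (\<forall>i. int (p * q) dvd \<beta> $ i)" unfolding of_nat_mult by (blast dest: dvd_mult_right)
  then show ?thesis using False by (simp only: if_False mult_zero_left)
next
  case True
  have p1: "p > 1" using p(1) by (rule prime_gt_1_nat)
  have eq: "(1 + (- 1) * of_int z ^ (p - 1) :: 'k) = (if int p dvd z then 1 else 0)" for z
  proof -
    have zero: "(of_int z :: 'k) = 0 \<longleftrightarrow> int p dvd z"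
      using of_int_eq_iff_cong_CHAR[of z 0, where 'a = 'k] p by (simp add: cong_0_iff)
    obtain j where j: "p = Suc j" using p1 by (cases p) auto
    have "(of_int z :: 'k) * of_int z ^ j = of_int z"
      using of_int_power_char[OF p, of z] unfolding j by simp
    then show ?thesis using zero p1 unfolding j by (cases "(of_int z :: 'k) = 0") simp_all
  qed
  have dvd: "int (p * q) dvd \<beta> $ i \<longleftrightarrow> int p dvd \<beta> $ i div int q" for i
  proof -
    obtain z where "\<beta> $ i = int q * z" using True by blast
    then show ?thesis using q by simp
  qed
  show ?thesis unfolding eq dvd using True by (auto simp: prod_zero_iff)
qed


text \<open>
  Conjugation by the monomial with exponent \<open>\<gamma>\<^sub>i = p ^ k r\<^sub>i\<close> has the same effect as \<open>\<sigma>\<close> on the digit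
  operators, so that the quotient of the two fixes the algebra that they generate together with the
  projection for \<open>p ^ k\<close>.
\<close>

lemma lattice_proj_image:
  fixes \<sigma> :: "(('k::field, 'n::finite) laurent \<Rightarrow> ('k, 'n) laurent) \<Rightarrow> (('k, 'n) laurent \<Rightarrow> ('k, 'n) laurent)"
  assumes p: "prime p" "CHAR('k) = p" and \<sigma>: "fixes_laurent \<sigma>"
    and e: "\<sigma> (lattice_proj (p ^ k)) = lattice_proj (p ^ k)"
  shows "\<exists>\<gamma>. \<sigma> (lattice_proj (p ^ Suc k)) = shift_conj \<gamma> (lattice_proj (p ^ Suc k))"
proof -
  have q: "p ^ k > 0" using prime_gt_0_nat[OF p(1)] by simp
  from digit_op_image[OF p \<sigma> e] obtain r where
    r: "\<And>i. \<sigma> (digit_op (p ^ k) i) = diag_op (\<lambda>\<beta>. of_int (\<beta> $ i div int (p ^ k)) + of_nat (r i))"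
    by metis
  define \<gamma> where "\<gamma> = (\<chi> i. int (p ^ k) * int (r i))"
  define \<tau> where "\<tau> u = shift_conj (- \<gamma>) (\<sigma> u)" for u
  have \<tau>: "fixes_laurent \<tau>" unfolding \<tau>_def using \<sigma> by (rule fixes_laurent_shift_conj)
  \<comment> \<open>The eigenvalues of the fixed diagonal operators form an algebra under pointwise operations.\<close>
  define F where "F = {c. diag_op c \<in> (diff_ops :: (('k, 'n) laurent \<Rightarrow> _) set) \<and> \<tau> (diag_op c) = diag_op c}"
  have F_mult: "(\<lambda>\<beta>. c \<beta> * d \<beta>) \<in> F" if "c \<in> F" "d \<in> F" for c d
    using that diff_ops_comp[of "diag_op c" "diag_op d"] fixes_laurentD(2)[OF \<tau>, of "diag_op c" "diag_op d"]
    by (simp add: F_def diag_op_comp)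
  have F_add: "(\<lambda>\<beta>. c \<beta> + d \<beta>) \<in> F" if "c \<in> F" "d \<in> F" for c d
    using that diff_ops_add[of "diag_op c" "diag_op d"] fixes_laurentD(3)[OF \<tau>, of "diag_op c" "diag_op d"]
    by (simp add: F_def diag_op_add)
  have F_const: "(\<lambda>_. c) \<in> F" for c
    using mult_op_diff_ops fixes_laurentD(4)[OF \<tau>] by (simp add: F_def diag_op_const)
  have F_power: "(\<lambda>\<beta>. c \<beta> ^ j) \<in> F" if "c \<in> F" for c j
    by (induction j) (simp_all add: F_const F_mult that)
  have F_prod: "(\<lambda>\<beta>. \<Prod>i\<in>A. h i \<beta>) \<in> F" if "\<And>i. h i \<in> F" for h :: "'n \<Rightarrow> _" and A
    using finite[of A] by induction (simp_all add: F_const F_mult that)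
  have F_proj: "(\<lambda>\<beta>. if \<forall>i. int (p ^ k) dvd \<beta> $ i then 1 else 0) \<in> F"
  proof -
    have "shift_conj (- \<gamma>) (lattice_proj (p ^ k)) = shift_conj 0 (lattice_proj (p ^ k) :: ('k, 'n) laurent \<Rightarrow> _)"
      by (rule shift_conj_periodic_cong[OF lattice_proj_periodic]) (simp add: \<gamma>_def)
    then show ?thesis
      using periodic_ops_diff_ops[OF p, of k] lattice_proj_periodic[of "p ^ k"]
      unfolding F_def mem_Collect_eq \<tau>_def lattice_proj_def[symmetric] e shift_conj_0 by blast
  qed
  have F_digit: "(\<lambda>\<beta>. of_int (\<beta> $ i div int (p ^ k))) \<in> F" for i
  proof -
    have div: "(\<beta> $ i + - \<gamma> $ i) div int (p ^ k) = \<beta> $ i div int (p ^ k) - int (r i)" for \<beta> :: "int ^ 'n"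
      using div_mult_self2[of "int (p ^ k)" "\<beta> $ i" "- int (r i)"] q by (simp add: \<gamma>_def)
    have "\<tau> (digit_op (p ^ k) i) = digit_op (p ^ k) i"
      unfolding \<tau>_def r unfolding shift_conj_diag_op digit_op_def vector_add_component
        vector_uminus_component div by simp
    moreover have "(digit_op (p ^ k) i :: ('k, 'n) laurent \<Rightarrow> _) \<in> diff_ops"
      using digit_op_periodic[OF p q] periodic_ops_diff_ops[OF p, of "Suc k"] by auto
    ultimately show ?thesis by (simp add: F_def digit_op_def)
  qed
  have "(\<lambda>\<beta>. if \<forall>i. int (p ^ Suc k) dvd \<beta> $ i then 1 else 0) \<in> F"
    unfolding power_Suc lattice_indicator_Suc[OF p q]
    by (intro F_mult F_proj F_prod F_add F_power F_digit F_const)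
  then have "\<tau> (lattice_proj (p ^ Suc k)) = lattice_proj (p ^ Suc k)"
    unfolding F_def lattice_proj_def by blast
  then have "shift_conj \<gamma> (\<tau> (lattice_proj (p ^ Suc k))) = shift_conj \<gamma> (lattice_proj (p ^ Suc k))"
    by simp
  then show ?thesis unfolding \<tau>_def shift_conj_shift_conj by (auto simp: shift_conj_0)
qed

text \<open>
  In the inductive step \<open>\<tau>\<close> is \<open>\<sigma>\<close> corrected so as to be trivial at level \<open>k\<close>, and \<open>\<rho>\<close> is \<open>\<tau>\<close>
  corrected so as to fix the projection at level \<open>k + 1\<close>, hence everything at that level.
\<close>

lemma fixes_laurent_locally_inner:
  fixes \<sigma> :: "(('k::field, 'n::finite) laurent \<Rightarrow> ('k, 'n) laurent) \<Rightarrow> (('k, 'n) laurent \<Rightarrow> ('k, 'n) laurent)"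
  assumes p: "prime p" "CHAR('k) = p" and \<sigma>: "fixes_laurent \<sigma>"
  shows "\<exists>\<gamma>. \<forall>u\<in>periodic_ops (p ^ k). \<sigma> u = shift_conj \<gamma> u"
proof (induction k)
  case 0
  show ?case
    unfolding power_0 periodic_ops_1 using fixes_laurentD(4)[OF \<sigma>] by (auto simp: shift_conj_mult_op)
next
  case (Suc k)
  have proj: "lattice_proj (p ^ j) \<in> (diff_ops :: (('k, 'n) laurent \<Rightarrow> _) set)" for j
    using periodic_ops_diff_ops[OF p, of j] lattice_proj_periodic[of "p ^ j"] by blast
  from Suc obtain \<gamma> where \<gamma>: "\<And>u. u \<in> periodic_ops (p ^ k) \<Longrightarrow> \<sigma> u = shift_conj \<gamma> u" by blast
  define \<tau> where "\<tau> u = shift_conj (- \<gamma>) (\<sigma> u)" for u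
  have \<tau>: "fixes_laurent \<tau>" unfolding \<tau>_def using \<sigma> by (rule fixes_laurent_shift_conj)
  have "\<tau> (lattice_proj (p ^ k)) = lattice_proj (p ^ k)"
    by (simp add: \<tau>_def \<gamma> lattice_proj_periodic shift_conj_shift_conj shift_conj_0)
  from lattice_proj_image[OF p \<tau> this] obtain \<delta> where
    \<delta>: "\<tau> (lattice_proj (p ^ Suc k)) = shift_conj \<delta> (lattice_proj (p ^ Suc k))" by blast
  define \<rho> where "\<rho> u = shift_conj (- \<delta>) (\<tau> u)" for u
  have \<rho>: "fixes_laurent \<rho>" unfolding \<rho>_def using \<tau> by (rule fixes_laurent_shift_conj)
  have \<rho>_proj: "\<rho> (lattice_proj (p ^ Suc k)) = lattice_proj (p ^ Suc k)"
    by (simp add: \<rho>_def \<delta> shift_conj_shift_conj shift_conj_0 del: power_Suc)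
  have "\<sigma> u = shift_conj (\<gamma> + \<delta>) u" if u: "u \<in> periodic_ops (p ^ Suc k)" for u
  proof -
    have "\<rho> u = u"
      using u periodic_ops_diff_ops[OF p, of "Suc k"] proj
      by (intro fixes_periodic_ops[OF \<rho> \<rho>_proj u]) blast+
    then have "shift_conj (\<gamma> + \<delta>) (\<rho> u) = shift_conj (\<gamma> + \<delta>) u" by simp
    then show ?thesis by (simp add: \<rho>_def \<tau>_def shift_conj_shift_conj shift_conj_0)
  qed
  then show ?case by blast
qed

section \<open>The p-adic binomial coefficients\<close>

lemma padic_int_simps:
  "a \<oplus>\<^bsub>padic_int p\<^esub> b = (\<lambda>k. (a k + b k) mod int p ^ k)"
  "a \<otimes>\<^bsub>padic_int p\<^esub> b = (\<lambda>k. (a k * b k) mod int p ^ k)"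
  "\<zero>\<^bsub>padic_int p\<^esub> = (\<lambda>k. 0)"
  "\<one>\<^bsub>padic_int p\<^esub> = (\<lambda>k. 1 mod int p ^ k)"
  by (simp_all add: padic_int_def)

lemma padic_int_carrier:
  "s \<in> carrier (padic_int p) \<longleftrightarrow> (\<forall>k. s k \<in> {0..<int p ^ k} \<and> s (Suc k) mod int p ^ k = s k)"
  by (simp add: padic_int_def)

lemma padic_mod_self:
  assumes "s \<in> carrier (padic_int p)"
  shows "s k mod int p ^ k = s k"
  using assms by (simp add: padic_int_carrier)

lemma padic_coherent:
  assumes s: "s \<in> carrier (padic_int p)" and "k \<le> l"
  shows "s l mod int p ^ k = s k"
  using \<open>k \<le> l\<close>
proof (induction l rule: dec_induct)
  case base
  show ?case using s by (rule padic_mod_self)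
next
  case (step l)
  have "s (Suc l) mod int p ^ k = s (Suc l) mod int p ^ l mod int p ^ k"
    using step(1) by (simp add: mod_mod_cancel le_imp_power_dvd)
  also have "\<dots> = s k" using s step by (simp add: padic_int_carrier)
  finally show ?case .
qed

lemma padic_carrier_mod:
  assumes p: "p > 0" and cong: "\<And>k. [z (Suc k) = z k] (mod int p ^ k)"
  shows "(\<lambda>k. z k mod int p ^ k) \<in> carrier (padic_int p)"
proof -
  have "z (Suc k) mod int p ^ Suc k mod int p ^ k = z k mod int p ^ k" for k
    using cong[of k] by (simp add: mod_mod_cancel cong_def)
  then show ?thesis using p by (simp add: padic_int_carrier)
qed

lemma padic_cong_Suc:
  assumes "s \<in> carrier (padic_int p)"
  shows "[s (Suc k) = s k] (mod int p ^ k)"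
  using assms by (simp add: padic_int_carrier cong_def)

lemma padic_of_int_closed:
  assumes "p > 0"
  shows "padic_of_int p b \<in> carrier (padic_int p)"
  unfolding padic_of_int_def using assms by (rule padic_carrier_mod) simp

lemma padic_int_closed:
  assumes p: "p > 0" and s: "s \<in> carrier (padic_int p)" and t: "t \<in> carrier (padic_int p)"
  shows "(\<lambda>k. (s k + t k) mod int p ^ k) \<in> carrier (padic_int p)"
    "(\<lambda>k. (s k * t k) mod int p ^ k) \<in> carrier (padic_int p)"
    "(\<lambda>k. (- s k) mod int p ^ k) \<in> carrier (padic_int p)"
  using padic_cong_Suc[OF s] padic_cong_Suc[OF t]
  by (auto intro!: padic_carrier_mod[OF p] cong_add cong_mult simp: cong_minus_minus_iff)

lemma padic_int_zero_one_closed: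
  assumes p: "p > 0"
  shows "(\<lambda>k. 0) \<in> carrier (padic_int p)" "(\<lambda>k. 1 mod int p ^ k) \<in> carrier (padic_int p)"
  using padic_of_int_closed[OF p, of 0] padic_of_int_closed[OF p, of 1] by (simp_all add: padic_of_int_def)

lemma padic_int_cring:
  assumes p: "p > 0"
  shows "cring (padic_int p)"
proof (rule cringI)
  show "abelian_group (padic_int p)"
  proof (rule abelian_groupI)
    fix s assume s: "s \<in> carrier (padic_int p)"
    show "\<exists>t\<in>carrier (padic_int p). t \<oplus>\<^bsub>padic_int p\<^esub> s = \<zero>\<^bsub>padic_int p\<^esub>"
      using padic_int_closed(3)[OF p s s]
      by (intro bexI[of _ "\<lambda>k. (- s k) mod int p ^ k"]) (simp_all add: padic_int_simps mod_simps)
  qed (simp_all add: padic_int_simps padic_int_closed[OF p] padic_int_zero_one_closed[OF p] padic_mod_self mod_simps ac_simps)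
  show "comm_monoid (padic_int p)"
  proof (rule comm_monoidI)
    fix s assume s: "s \<in> carrier (padic_int p)"
    have "1 mod int p ^ k * s k mod int p ^ k = s k" for k
      using padic_mod_self[OF s, of k] by (metis mod_mult_left_eq mult_1)
    then show "\<one>\<^bsub>padic_int p\<^esub> \<otimes>\<^bsub>padic_int p\<^esub> s = s" by (simp add: padic_int_simps)
  qed (simp_all add: padic_int_simps padic_int_closed[OF p] padic_int_zero_one_closed[OF p] mod_simps ac_simps)
qed (simp add: padic_int_simps mod_simps distrib_right)

lemma padic_int_minus:
  assumes p: "p > 0" and s: "s \<in> carrier (padic_int p)" and t: "t \<in> carrier (padic_int p)"
  shows "s \<ominus>\<^bsub>padic_int p\<^esub> t = (\<lambda>k. (s k - t k) mod int p ^ k)"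
proof -
  interpret cring "padic_int p" using p by (rule padic_int_cring)
  have "\<ominus>\<^bsub>padic_int p\<^esub> t = (\<lambda>k. (- t k) mod int p ^ k)"
    using padic_int_closed(3)[OF p t t] t
    by (intro minus_equality) (simp_all add: padic_int_simps mod_simps)
  then show ?thesis by (simp add: a_minus_def padic_int_simps mod_simps)
qed

lemma padic_add_pow:
  "add_pow (padic_int p) (n :: nat) b = (\<lambda>k. (int n * b k) mod int p ^ k)"
proof (induction n)
  case 0
  show ?case by (simp add: add_pow_def nat_pow_def padic_int_simps)
next
  case (Suc n)
  have "add_pow (padic_int p) (Suc n) b = add_pow (padic_int p) n b \<oplus>\<^bsub>padic_int p\<^esub> b"
    by (simp add: add_pow_def nat_pow_def)
  then show ?case unfolding Suc by (simp add: padic_int_simps mod_simps algebra_simps)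
qed

lemma padic_falling_factorial:
  assumes p: "p > 0" and t: "t \<in> carrier (padic_int p)"
  shows "finprod (padic_int p) (\<lambda>i. t \<ominus>\<^bsub>padic_int p\<^esub> padic_of_int p (int i)) {..<j} =
    (\<lambda>k. (\<Prod>i<j. t k - int i) mod int p ^ k)"
proof -
  interpret cring "padic_int p" using p by (rule padic_int_cring)
  have minus: "t \<ominus>\<^bsub>padic_int p\<^esub> padic_of_int p (int i) = (\<lambda>k. (t k - int i) mod int p ^ k)" for i
    unfolding padic_int_minus[OF p t padic_of_int_closed[OF p]]
    unfolding padic_of_int_def by (simp add: mod_simps)
  have "(finprod (padic_int p) (\<lambda>i. t \<ominus>\<^bsub>padic_int p\<^esub> padic_of_int p (int i)) {..<j}) k =
      (\<Prod>i<j. t k - int i) mod int p ^ k" for k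
  proof (induction j)
    case 0
    show ?case by (simp add: padic_int_simps)
  next
    case (Suc j)
    have "finprod (padic_int p) (\<lambda>i. t \<ominus>\<^bsub>padic_int p\<^esub> padic_of_int p (int i)) {..<Suc j} =
        (t \<ominus>\<^bsub>padic_int p\<^esub> padic_of_int p (int j)) \<otimes>\<^bsub>padic_int p\<^esub>
        finprod (padic_int p) (\<lambda>i. t \<ominus>\<^bsub>padic_int p\<^esub> padic_of_int p (int i)) {..<j}"
      unfolding lessThan_Suc using padic_of_int_closed[OF p] t by (intro finprod_insert) auto
    then have "(finprod (padic_int p) (\<lambda>i. t \<ominus>\<^bsub>padic_int p\<^esub> padic_of_int p (int i)) {..<Suc j}) k =
        ((t k - int j) * (\<Prod>i<j. t k - int i)) mod int p ^ k"
      unfolding padic_int_simps minus by (simp add: Suc[unfolded minus] mod_simps)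
    then show ?case by (simp add: mult.commute)
  qed
  then show ?thesis by blast
qed

text \<open>
  The factorial is \<open>p\<close> to its multiplicity times a factor prime to \<open>p\<close>.
\<close>

lemma prime_power_dvd_fact_mult:
  assumes p: "prime p" and dvd: "int p ^ (r + multiplicity p (fact j)) dvd fact j * d"
  shows "int p ^ r dvd d"
proof -
  let ?v = "multiplicity p (fact j :: nat)"
  have "\<not> is_unit p" using p not_prime_unit by blast
  then obtain w where w: "(fact j :: nat) = p ^ ?v * w" "\<not> p dvd w"
    using multiplicity_decompose'[of "fact j :: nat" p] by (metis fact_nonzero)
  have fact: "(fact j :: int) = int p ^ ?v * int w"
    using arg_cong[OF w(1), of int] by simp
  have "int p ^ ?v * int p ^ r dvd int p ^ ?v * (int w * d)"
    using dvd unfolding fact by (simp add: power_add mult_ac)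
  then have "int p ^ r dvd int w * d"
    using prime_gt_0_nat[OF p] by simp
  moreover have "coprime (int p ^ r) (int w)"
    using w(2) p by (simp add: prime_imp_coprime coprime_power_left_iff)
  ultimately show ?thesis by (simp add: coprime_dvd_mult_right_iff)
qed

text \<open>
  Multiplication by \<open>fact j\<close> turns the binomial coefficients into polynomials, which preserve
  congruences; the division by \<open>fact j\<close> costs as many powers of \<open>p\<close> as it contains.
\<close>

lemma int_binomial_cong:
  assumes p: "prime p" and cong: "[b = b'] (mod int p ^ (r + multiplicity p (fact j)))"
  shows "[int_binomial b j = int_binomial b' j] (mod int p ^ r)"
proof -
  have "[fact j * int_binomial b j = fact j * int_binomial b' j] (mod int p ^ (r + multiplicity p (fact j)))"
    unfolding fact_mult_int_binomial using cong by (intro cong_prod cong_diff cong_refl)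
  then have "int p ^ (r + multiplicity p (fact j)) dvd fact j * (int_binomial b j - int_binomial b' j)"
    by (simp add: cong_iff_dvd_diff right_diff_distrib)
  then show ?thesis unfolding cong_iff_dvd_diff by (rule prime_power_dvd_fact_mult[OF p])
qed

text \<open>
  The entry at level \<open>k\<close> is computed from the truncation at a level higher by the multiplicity of \<open>p\<close>
  in \<open>fact j\<close>, which makes up for the loss of precision in the division. Uniqueness holds for the same
  reason: \<open>fact j\<close> times an element determines that element.
\<close>

lemma padic_binomial_eq:
  fixes j :: nat
  assumes p: "prime p" and t: "t \<in> carrier (padic_int p)"
  shows "padic_binomial p t j = (\<lambda>k. int_binomial (t (k + multiplicity p (fact j))) j mod int p ^ k)"
    (is "_ = ?b")
  unfolding padic_binomial_def
proof (rule the_equality)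
  have p0: "p > 0" using p by (rule prime_gt_0_nat)
  let ?v = "multiplicity p (fact j :: nat)"
  have t_cong: "[t l = t k] (mod int p ^ k)" if "k \<le> l" for k l
    using padic_coherent[OF t that] padic_mod_self[OF t, of k] by (simp add: cong_def)
  have fall: "finprod (padic_int p) (\<lambda>i. t \<ominus>\<^bsub>padic_int p\<^esub> padic_of_int p (int i)) {..<j} =
      (\<lambda>k. (fact j * int_binomial (t (k + ?v)) j) mod int p ^ k)"
  proof
    fix k
    have "[(\<Prod>i<j. t k - int i) = (\<Prod>i<j. t (k + ?v) - int i)] (mod int p ^ k)"
      using t_cong[of k "k + ?v"] by (intro cong_prod cong_diff cong_refl) (simp add: cong_sym)
    then show "finprod (padic_int p) (\<lambda>i. t \<ominus>\<^bsub>padic_int p\<^esub> padic_of_int p (int i)) {..<j} k =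
        (fact j * int_binomial (t (k + ?v)) j) mod int p ^ k"
      unfolding padic_falling_factorial[OF p0 t] fact_mult_int_binomial
      by (simp add: cong_def lessThan_atLeast0)
  qed
  have "?b \<in> carrier (padic_int p)"
  proof (rule padic_carrier_mod[OF p0])
    fix k
    have "[t (Suc k + ?v) = t (k + ?v)] (mod int p ^ (k + ?v))" by (rule t_cong) simp
    then show "[int_binomial (t (Suc k + ?v)) j = int_binomial (t (k + ?v)) j] (mod int p ^ k)"
      by (rule int_binomial_cong[OF p])
  qed
  moreover have "add_pow (padic_int p) (fact j :: nat) ?b =
      finprod (padic_int p) (\<lambda>i. t \<ominus>\<^bsub>padic_int p\<^esub> padic_of_int p (int i)) {..<j}"
    unfolding fall padic_add_pow by (simp add: mod_simps)
  ultimately show "?b \<in> carrier (padic_int p) \<and> add_pow (padic_int p) (fact j :: nat) ?b =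
      finprod (padic_int p) (\<lambda>i. t \<ominus>\<^bsub>padic_int p\<^esub> padic_of_int p (int i)) {..<j}" by blast
  fix b
  assume b: "b \<in> carrier (padic_int p) \<and> add_pow (padic_int p) (fact j :: nat) b =
      finprod (padic_int p) (\<lambda>i. t \<ominus>\<^bsub>padic_int p\<^esub> padic_of_int p (int i)) {..<j}"
  show "b = ?b"
  proof
    fix k
    let ?l = "k + ?v"
    let ?d = "b ?l - int_binomial (t (?l + ?v)) j"
    have "(int (fact j) * b ?l) mod int p ^ ?l = (fact j * int_binomial (t (?l + ?v)) j) mod int p ^ ?l"
      using b fun_cong[of _ _ ?l] unfolding fall padic_add_pow by metis
    then have "int p ^ ?l dvd fact j * ?d"
      by (simp add: mod_eq_dvd_iff right_diff_distrib)
    then have "int p ^ k dvd ?d" by (rule prime_power_dvd_fact_mult[OF p])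
    then have "b ?l mod int p ^ k = int_binomial (t (?l + ?v)) j mod int p ^ k"
      by (simp add: mod_eq_dvd_iff)
    moreover have "b ?l mod int p ^ k = b k" using b by (intro padic_coherent) auto
    moreover have "[int_binomial (t (?l + ?v)) j = int_binomial (t ?l) j] (mod int p ^ k)"
      by (intro int_binomial_cong[OF p] t_cong) simp
    ultimately show "b k = ?b k" by (simp add: cong_def)
  qed
qed

lemma padic_reduce_binomial:
  fixes j :: nat
  assumes p: "prime p" "CHAR('k::field) = p" and t: "t \<in> carrier (padic_int p)"
    and k: "1 + multiplicity p (fact j) \<le> k"
  shows "(padic_reduce (padic_binomial p t j) :: 'k) = of_int (int_binomial (t k) j)"
proof -
  let ?v = "multiplicity p (fact j :: nat)"
  have "[t k = t (1 + ?v)] (mod int p ^ (1 + ?v))"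
    using padic_coherent[OF t k] padic_mod_self[OF t, of "1 + ?v"] by (simp add: cong_def)
  then have "[int_binomial (t k) j = int_binomial (t (1 + ?v)) j] (mod int p ^ 1)"
    by (rule int_binomial_cong[OF p(1)])
  then show ?thesis
    unfolding padic_binomial_eq[OF p(1) t] padic_reduce_def of_int_eq_iff_cong_CHAR p(2)
    by (simp add: cong_def)
qed

section \<open>Automorphism groups and semidirect products\<close>

lemma alg_auts_iff:
  "\<sigma> \<in> alg_auts A \<longleftrightarrow> \<sigma> \<in> Bij (carrier A) \<and>
     (\<forall>a\<in>carrier A. \<forall>b\<in>carrier A. \<sigma> (a \<otimes>\<^bsub>A\<^esub> b) = \<sigma> a \<otimes>\<^bsub>A\<^esub> \<sigma> b) \<and>
     (\<forall>a\<in>carrier A. \<forall>b\<in>carrier A. \<sigma> (a \<oplus>\<^bsub>A\<^esub> b) = \<sigma> a \<oplus>\<^bsub>A\<^esub> \<sigma> b) \<and>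
     \<sigma> \<one>\<^bsub>A\<^esub> = \<one>\<^bsub>A\<^esub> \<and> (\<forall>c. \<forall>a\<in>carrier A. \<sigma> (c \<odot>\<^bsub>A\<^esub> a) = c \<odot>\<^bsub>A\<^esub> \<sigma> a)"
  by (auto simp: alg_auts_def ring_hom_def dest: Bij_imp_funcset)

lemma alg_auts_subgroup:
  assumes closed: "\<And>a b. a \<in> carrier A \<Longrightarrow> b \<in> carrier A \<Longrightarrow> a \<otimes>\<^bsub>A\<^esub> b \<in> carrier A"
    "\<And>a b. a \<in> carrier A \<Longrightarrow> b \<in> carrier A \<Longrightarrow> a \<oplus>\<^bsub>A\<^esub> b \<in> carrier A"
    "\<one>\<^bsub>A\<^esub> \<in> carrier A" "\<And>c a. a \<in> carrier A \<Longrightarrow> c \<odot>\<^bsub>A\<^esub> a \<in> carrier A"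
  shows "subgroup (alg_auts A) (BijGroup (carrier A))"
proof (rule subgroup.intro)
  show "alg_auts A \<subseteq> carrier (BijGroup (carrier A))"
    by (auto simp: BijGroup_def alg_auts_iff)
next
  fix \<sigma> \<tau> assume "\<sigma> \<in> alg_auts A" "\<tau> \<in> alg_auts A"
  then show "\<sigma> \<otimes>\<^bsub>BijGroup (carrier A)\<^esub> \<tau> \<in> alg_auts A"
    using Bij_imp_funcset[of \<tau> "carrier A"]
    by (auto simp: BijGroup_def alg_auts_iff compose_Bij compose_eq closed Pi_iff)
next
  show "\<one>\<^bsub>BijGroup (carrier A)\<^esub> \<in> alg_auts A"
    by (simp add: BijGroup_def alg_auts_iff id_Bij closed)
next
  fix \<sigma> assume \<sigma>: "\<sigma> \<in> alg_auts A"
  then have bij: "\<sigma> \<in> Bij (carrier A)" by (simp add: alg_auts_iff)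
  then have inj: "inj_on \<sigma> (carrier A)" and img: "\<sigma> ` carrier A = carrier A"
    by (auto simp: Bij_def bij_betw_def)
  define \<rho> where "\<rho> = (\<lambda>x\<in>carrier A. inv_into (carrier A) \<sigma> x)"
  have \<rho>: "\<rho> x \<in> carrier A" "\<sigma> (\<rho> x) = x" if "x \<in> carrier A" for x
    using that img by (auto simp: \<rho>_def inv_into_into f_inv_into_f)
  have uniq: "\<rho> x = y" if "x \<in> carrier A" "y \<in> carrier A" "\<sigma> y = x" for x y
    using that inj \<rho> by (metis inj_onD)
  have "\<rho> \<in> alg_auts A"
    unfolding alg_auts_iff
  proof (intro conjI ballI allI)
    show "\<rho> \<in> Bij (carrier A)" unfolding \<rho>_def using bij by (rule restrict_inv_into_Bij)
  next
    fix a b assume "a \<in> carrier A" "b \<in> carrier A"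
    then show "\<rho> (a \<otimes>\<^bsub>A\<^esub> b) = \<rho> a \<otimes>\<^bsub>A\<^esub> \<rho> b"
      using \<sigma> by (intro uniq closed \<rho>) (simp_all add: alg_auts_iff \<rho>)
  next
    fix a b assume "a \<in> carrier A" "b \<in> carrier A"
    then show "\<rho> (a \<oplus>\<^bsub>A\<^esub> b) = \<rho> a \<oplus>\<^bsub>A\<^esub> \<rho> b"
      using \<sigma> by (intro uniq closed \<rho>) (simp_all add: alg_auts_iff \<rho>)
  next
    show "\<rho> \<one>\<^bsub>A\<^esub> = \<one>\<^bsub>A\<^esub>" using \<sigma> by (intro uniq closed) (simp add: alg_auts_iff)
  next
    fix c a assume "a \<in> carrier A"
    then show "\<rho> (c \<odot>\<^bsub>A\<^esub> a) = c \<odot>\<^bsub>A\<^esub> \<rho> a"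
      using \<sigma> by (intro uniq closed \<rho>) (simp_all add: alg_auts_iff \<rho>)
  qed
  then show "inv\<^bsub>BijGroup (carrier A)\<^esub> \<sigma> \<in> alg_auts A"
    by (simp add: inv_BijGroup[OF bij] \<rho>_def)
qed

lemma BijGroup_preserving_subgroup:
  assumes H: "subgroup H (BijGroup S)" and F: "\<And>m. F m \<subseteq> S"
  shows "subgroup {\<sigma> \<in> H. \<forall>m. \<sigma> ` F m = F m} (BijGroup S)"
proof (rule subgroup.intro)
  have sub: "H \<subseteq> Bij S" using subgroup.subset[OF H] by (simp add: BijGroup_def)
  then show "{\<sigma> \<in> H. \<forall>m. \<sigma> ` F m = F m} \<subseteq> carrier (BijGroup S)" by (auto simp: BijGroup_def)
  show "\<one>\<^bsub>BijGroup S\<^esub> \<in> {\<sigma> \<in> H. \<forall>m. \<sigma> ` F m = F m}"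
  proof -
    have "(\<lambda>x\<in>S. x) ` F m = F m" for m using F[of m] by auto
    then show ?thesis using subgroup.one_closed[OF H] by (simp add: BijGroup_def)
  qed
  fix \<sigma> assume \<sigma>: "\<sigma> \<in> {\<sigma> \<in> H. \<forall>m. \<sigma> ` F m = F m}"
  then have bij: "\<sigma> \<in> Bij S" using sub by auto
  have "inv_into S \<sigma> ` F m = F m" for m
  proof -
    have "inv_into S \<sigma> ` (\<sigma> ` F m) = F m"
      using bij F[of m] by (intro inv_into_image_cancel) (auto simp: Bij_def bij_betw_def)
    then show ?thesis using \<sigma> by simp
  qed
  moreover have "(\<lambda>x\<in>S. inv_into S \<sigma> x) ` F m = inv_into S \<sigma> ` F m" for m
    using F[of m] by (intro image_cong) auto
  ultimately have "(\<lambda>x\<in>S. inv_into S \<sigma> x) ` F m = F m" for m by simp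
  then show "inv\<^bsub>BijGroup S\<^esub> \<sigma> \<in> {\<sigma> \<in> H. \<forall>m. \<sigma> ` F m = F m}"
    using subgroup.m_inv_closed[OF H, of \<sigma>] \<sigma> by (simp add: inv_BijGroup[OF bij])
  fix \<tau> assume \<tau>: "\<tau> \<in> {\<sigma> \<in> H. \<forall>m. \<sigma> ` F m = F m}"
  have "compose S \<sigma> \<tau> ` F m = F m" for m
  proof -
    have "compose S \<sigma> \<tau> ` F m = \<sigma> ` (\<tau> ` F m)" using F[of m] by (auto simp: compose_def image_image)
    then show ?thesis using \<sigma> \<tau> by simp
  qed
  moreover have "\<sigma> \<otimes>\<^bsub>BijGroup S\<^esub> \<tau> = compose S \<sigma> \<tau>"
    using bij sub \<tau> by (auto simp: BijGroup_def)
  ultimately show "\<sigma> \<otimes>\<^bsub>BijGroup S\<^esub> \<tau> \<in> {\<sigma> \<in> H. \<forall>m. \<sigma> ` F m = F m}"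
    using subgroup.m_closed[OF H, of \<sigma> \<tau>] \<sigma> \<tau> by simp
qed

text \<open>
  Being normalized by \<open>T\<close>, the image of \<open>S\<close> carries an action of \<open>H\<close> by conjugation. The uniqueness
  of the decomposition makes \<open>S\<close> injective, transports the action to \<open>N\<close>, and gives the inverse of
  \<open>(s, h) \<mapsto> S s \<otimes> T h\<close>.
\<close>

theorem internal_semidirect_product:
  fixes G (structure) and N (structure) and H (structure)
  assumes G: "group G" and N: "group N" and H: "group H"
    and S: "S \<in> hom N G" and T: "T \<in> hom H G"
    and decomp: "\<And>g. g \<in> carrier G \<Longrightarrow>
      \<exists>!x. x \<in> carrier N \<times> carrier H \<and> g = S (fst x) \<otimes>\<^bsub>G\<^esub> T (snd x)"
    and normal: "\<And>s h. s \<in> carrier N \<Longrightarrow> h \<in> carrier H \<Longrightarrow>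
      \<exists>t\<in>carrier N. T h \<otimes>\<^bsub>G\<^esub> S s = S t \<otimes>\<^bsub>G\<^esub> T h"
  shows "\<exists>\<phi>\<in>hom H (AutoGroup N). G \<cong> semidirect_product N H \<phi>"
proof -
  interpret G: group G by (fact G)
  interpret N: group N by (fact N)
  interpret H: group H by (fact H)
  have Sc [simp]: "S s \<in> carrier G" if "s \<in> carrier N" for s using S that by (auto simp: hom_def)
  have Tc [simp]: "T h \<in> carrier G" if "h \<in> carrier H" for h using T that by (auto simp: hom_def)
  have Sm: "S (s \<otimes>\<^bsub>N\<^esub> t) = S s \<otimes>\<^bsub>G\<^esub> S t" if "s \<in> carrier N" "t \<in> carrier N" for s t
    using S that by (auto simp: hom_def)
  have Tm: "T (h \<otimes>\<^bsub>H\<^esub> k) = T h \<otimes>\<^bsub>G\<^esub> T k" if "h \<in> carrier H" "k \<in> carrier H" for h k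
    using T that by (auto simp: hom_def)
  have T1: "T \<one>\<^bsub>H\<^esub> = \<one>\<^bsub>G\<^esub>" using hom_one[OF T H G] .
  have eqD: "s = s' \<and> h = h'"
    if "s \<in> carrier N" "s' \<in> carrier N" "h \<in> carrier H" "h' \<in> carrier H"
      "S s \<otimes>\<^bsub>G\<^esub> T h = S s' \<otimes>\<^bsub>G\<^esub> T h'" for s s' h h'
  proof -
    have "(s, h) = (s', h')"
      by (rule ex1E[OF decomp[of "S s \<otimes>\<^bsub>G\<^esub> T h"]])
        (use that in \<open>auto dest: spec[of _ "(s, h)"] spec[of _ "(s', h')"]\<close>)
    then show ?thesis by simp
  qed
  define act where "act h s = (SOME t. t \<in> carrier N \<and> T h \<otimes>\<^bsub>G\<^esub> S s = S t \<otimes>\<^bsub>G\<^esub> T h)" for h s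
  have act: "act h s \<in> carrier N" "T h \<otimes>\<^bsub>G\<^esub> S s = S (act h s) \<otimes>\<^bsub>G\<^esub> T h"
    if "s \<in> carrier N" "h \<in> carrier H" for h s
  proof -
    have "\<exists>t. t \<in> carrier N \<and> T h \<otimes>\<^bsub>G\<^esub> S s = S t \<otimes>\<^bsub>G\<^esub> T h" using normal[OF that] by blast
    from someI_ex[OF this] show "act h s \<in> carrier N" "T h \<otimes>\<^bsub>G\<^esub> S s = S (act h s) \<otimes>\<^bsub>G\<^esub> T h"
      by (auto simp: act_def)
  qed
  have act_eqI: "act h s = t"
    if "s \<in> carrier N" "h \<in> carrier H" "t \<in> carrier N" "T h \<otimes>\<^bsub>G\<^esub> S s = S t \<otimes>\<^bsub>G\<^esub> T h" for h s t
    using eqD[of "act h s" t h h] act[OF that(1,2)] that by simp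
  have act_mult: "act h (s \<otimes>\<^bsub>N\<^esub> t) = act h s \<otimes>\<^bsub>N\<^esub> act h t"
    if "s \<in> carrier N" "t \<in> carrier N" "h \<in> carrier H" for h s t
  proof (rule act_eqI)
    have "T h \<otimes>\<^bsub>G\<^esub> S (s \<otimes>\<^bsub>N\<^esub> t) = (T h \<otimes>\<^bsub>G\<^esub> S s) \<otimes>\<^bsub>G\<^esub> S t"
      using that by (simp add: Sm G.m_assoc)
    also have "\<dots> = S (act h s) \<otimes>\<^bsub>G\<^esub> (T h \<otimes>\<^bsub>G\<^esub> S t)"
      using that by (simp add: act G.m_assoc)
    also have "\<dots> = S (act h s \<otimes>\<^bsub>N\<^esub> act h t) \<otimes>\<^bsub>G\<^esub> T h"
      using that by (simp add: act Sm G.m_assoc)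
    finally show "T h \<otimes>\<^bsub>G\<^esub> S (s \<otimes>\<^bsub>N\<^esub> t) = S (act h s \<otimes>\<^bsub>N\<^esub> act h t) \<otimes>\<^bsub>G\<^esub> T h" .
  qed (use that act in auto)
  have act_comp: "act (h \<otimes>\<^bsub>H\<^esub> k) s = act h (act k s)"
    if "s \<in> carrier N" "h \<in> carrier H" "k \<in> carrier H" for h k s
  proof (rule act_eqI)
    have "T (h \<otimes>\<^bsub>H\<^esub> k) \<otimes>\<^bsub>G\<^esub> S s = T h \<otimes>\<^bsub>G\<^esub> (T k \<otimes>\<^bsub>G\<^esub> S s)"
      using that by (simp add: Tm G.m_assoc)
    also have "\<dots> = (T h \<otimes>\<^bsub>G\<^esub> S (act k s)) \<otimes>\<^bsub>G\<^esub> T k"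
      using that by (simp add: act(2)[OF that(1,3)] act(1) G.m_assoc)
    also have "T h \<otimes>\<^bsub>G\<^esub> S (act k s) = S (act h (act k s)) \<otimes>\<^bsub>G\<^esub> T h"
      using that by (intro act)
    also have "\<dots> \<otimes>\<^bsub>G\<^esub> T k = S (act h (act k s)) \<otimes>\<^bsub>G\<^esub> T (h \<otimes>\<^bsub>H\<^esub> k)"
      using that by (simp add: act(1) Tm G.m_assoc)
    finally show "T (h \<otimes>\<^bsub>H\<^esub> k) \<otimes>\<^bsub>G\<^esub> S s = S (act h (act k s)) \<otimes>\<^bsub>G\<^esub> T (h \<otimes>\<^bsub>H\<^esub> k)" .
  qed (use that act in auto)
  have act_one: "act \<one>\<^bsub>H\<^esub> s = s" if "s \<in> carrier N" for s
    by (rule act_eqI) (use that in \<open>simp_all add: T1\<close>)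
  define \<phi> where "\<phi> h = (\<lambda>s\<in>carrier N. act h s)" for h
  have \<phi>_Bij: "\<phi> h \<in> Bij (carrier N)" if h: "h \<in> carrier H" for h
  proof -
    have "bij_betw (\<phi> h) (carrier N) (carrier N)"
      by (rule bij_betw_byWitness[of _ "\<phi> (inv\<^bsub>H\<^esub> h)"])
        (use h act in \<open>auto simp: \<phi>_def act_one simp flip: act_comp\<close>)
    then show ?thesis by (simp add: Bij_def \<phi>_def)
  qed
  have \<phi>: "\<phi> \<in> hom H (AutoGroup N)"
  proof (rule homI)
    fix h assume h: "h \<in> carrier H"
    then show "\<phi> h \<in> carrier (AutoGroup N)"
      using \<phi>_Bij[OF h] act act_mult by (auto simp: AutoGroup_def auto_def hom_def \<phi>_def)
    fix k assume k: "k \<in> carrier H"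
    then show "\<phi> (h \<otimes>\<^bsub>H\<^esub> k) = \<phi> h \<otimes>\<^bsub>AutoGroup N\<^esub> \<phi> k"
      using \<phi>_Bij[OF h] \<phi>_Bij[OF k] h act act_comp
      by (auto simp: AutoGroup_def BijGroup_def \<phi>_def compose_def fun_eq_iff)
  qed
  let ?P = "semidirect_product N H \<phi>"
  define dec where "dec g = (THE x. x \<in> carrier N \<times> carrier H \<and> g = S (fst x) \<otimes>\<^bsub>G\<^esub> T (snd x))" for g
  have dec: "dec (S s \<otimes>\<^bsub>G\<^esub> T h) = (s, h)" if "s \<in> carrier N" "h \<in> carrier H" for s h
    unfolding dec_def by (rule the1_equality[OF decomp]) (use that in auto)
  have split: "\<exists>s h. s \<in> carrier N \<and> h \<in> carrier H \<and> g = S s \<otimes>\<^bsub>G\<^esub> T h" if "g \<in> carrier G" for g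
    using ex1_implies_ex[OF decomp[OF that]] by auto
  have hom: "dec \<in> hom G ?P"
  proof (rule homI)
    fix g assume "g \<in> carrier G"
    then obtain s h where g: "s \<in> carrier N" "h \<in> carrier H" "g = S s \<otimes>\<^bsub>G\<^esub> T h" using split by blast
    then show "dec g \<in> carrier ?P" by (simp add: dec semidirect_product_def)
    fix g' assume "g' \<in> carrier G"
    then obtain s' h' where g': "s' \<in> carrier N" "h' \<in> carrier H" "g' = S s' \<otimes>\<^bsub>G\<^esub> T h'" using split by blast
    have "g \<otimes>\<^bsub>G\<^esub> g' = S s \<otimes>\<^bsub>G\<^esub> (T h \<otimes>\<^bsub>G\<^esub> S s') \<otimes>\<^bsub>G\<^esub> T h'" using g g' by (simp add: G.m_assoc)
    also have "\<dots> = S (s \<otimes>\<^bsub>N\<^esub> act h s') \<otimes>\<^bsub>G\<^esub> T (h \<otimes>\<^bsub>H\<^esub> h')"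
      using g g' by (simp add: act Sm Tm G.m_assoc)
    finally show "dec (g \<otimes>\<^bsub>G\<^esub> g') = dec g \<otimes>\<^bsub>?P\<^esub> dec g'"
      using g g' act by (simp add: dec semidirect_product_def \<phi>_def)
  qed
  have "bij_betw dec (carrier G) (carrier ?P)"
    by (rule bij_betw_byWitness[of _ "\<lambda>x. S (fst x) \<otimes>\<^bsub>G\<^esub> T (snd x)"])
      (use split in \<open>fastforce simp: dec semidirect_product_def\<close>)+
  then have "dec \<in> iso G ?P" using hom by (simp add: iso_def)
  then show ?thesis using \<phi> by (auto simp: is_iso_def)
qed

section \<open>Order preserving automorphisms\<close>

lemma diff_alg_simps:
  "carrier diff_alg = diff_ops" "u \<otimes>\<^bsub>diff_alg\<^esub> v = u \<circ> v" "\<one>\<^bsub>diff_alg\<^esub> = id"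
  "u \<oplus>\<^bsub>diff_alg\<^esub> v = (\<lambda>f. u f + v f)" "c \<odot>\<^bsub>diff_alg\<^esub> u = (\<lambda>f. laurent_const c * u f)"
  by (simp_all add: diff_alg_def)

lemma laurent_alg_simps:
  "carrier laurent_alg = UNIV" "a \<otimes>\<^bsub>laurent_alg\<^esub> b = a * b" "\<one>\<^bsub>laurent_alg\<^esub> = 1"
  "a \<oplus>\<^bsub>laurent_alg\<^esub> b = a + b" "c \<odot>\<^bsub>laurent_alg\<^esub> a = laurent_const c * a"
  by (simp_all add: laurent_alg_def)

lemma id_mult_op: "id = mult_op 1"
  by (simp add: mult_op_def fun_eq_iff)

lemma diff_auts_iff:
  "\<sigma> \<in> alg_auts diff_alg \<longleftrightarrow> \<sigma> \<in> Bij diff_ops \<and>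
     (\<forall>u\<in>diff_ops. \<forall>v\<in>diff_ops. \<sigma> (u \<circ> v) = \<sigma> u \<circ> \<sigma> v) \<and>
     (\<forall>u\<in>diff_ops. \<forall>v\<in>diff_ops. \<sigma> (\<lambda>f. u f + v f) = (\<lambda>f. \<sigma> u f + \<sigma> v f)) \<and>
     \<sigma> id = id \<and> (\<forall>c. \<forall>u\<in>diff_ops. \<sigma> (\<lambda>f. laurent_const c * u f) = (\<lambda>f. laurent_const c * \<sigma> u f))"
  unfolding alg_auts_iff diff_alg_simps ..

lemma laurent_auts_iff:
  "\<tau> \<in> alg_auts laurent_alg \<longleftrightarrow> bij \<tau> \<and> (\<forall>a b. \<tau> (a * b) = \<tau> a * \<tau> b) \<and>
     (\<forall>a b. \<tau> (a + b) = \<tau> a + \<tau> b) \<and> \<tau> 1 = 1 \<and>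
     (\<forall>c a. \<tau> (laurent_const c * a) = laurent_const c * \<tau> a)"
  unfolding alg_auts_iff laurent_alg_simps by (simp add: Bij_def)

lemma diff_auts_subgroup: "subgroup (alg_auts diff_alg) (BijGroup diff_ops)"
  unfolding diff_alg_simps(1)[symmetric]
  by (rule alg_auts_subgroup)
    (simp_all add: diff_alg_simps diff_ops_comp diff_ops_add diff_ops_scale id_mult_op mult_op_diff_ops)

lemma laurent_auts_subgroup: "subgroup (alg_auts laurent_alg) (BijGroup UNIV)"
  using alg_auts_subgroup[of laurent_alg] by (simp add: laurent_alg_simps)

lemma order_filtration_subset: "order_filtration m \<subseteq> diff_ops"
  by (auto simp: order_filtration_eq diff_ops_def)

lemma AutOrd_alt:
  "AutOrd = BijGroup diff_ops
     \<lparr>carrier := {\<sigma> \<in> alg_auts diff_alg. \<forall>m. \<sigma> ` order_filtration m = order_filtration m}\<rparr>"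
  by (simp add: AutOrd_def AlgAut_def diff_alg_simps)

lemma AlgAut_laurent_alt:
  "AlgAut laurent_alg = BijGroup UNIV\<lparr>carrier := alg_auts laurent_alg\<rparr>"
  by (simp add: AlgAut_def laurent_alg_simps)

lemma group_AutOrd: "group AutOrd"
  unfolding AutOrd_alt
  by (intro subgroup.subgroup_is_group[OF _ group_BijGroup] BijGroup_preserving_subgroup
      diff_auts_subgroup order_filtration_subset)

lemma group_AlgAut_laurent: "group (AlgAut laurent_alg)"
  unfolding AlgAut_laurent_alt
  by (intro subgroup.subgroup_is_group[OF _ group_BijGroup] laurent_auts_subgroup)

lemma AutOrd_carrier:
  "\<sigma> \<in> carrier AutOrd \<longleftrightarrow>
     \<sigma> \<in> alg_auts diff_alg \<and> (\<forall>m. \<sigma> ` order_filtration m = order_filtration m)"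
  by (simp add: AutOrd_alt)

lemma AutOrd_Bij: "\<sigma> \<in> carrier AutOrd \<Longrightarrow> \<sigma> \<in> Bij diff_ops"
  by (simp add: AutOrd_carrier diff_auts_iff)

lemma AutOrd_mult:
  assumes "\<sigma> \<in> carrier AutOrd" "\<tau> \<in> carrier AutOrd"
  shows "\<sigma> \<otimes>\<^bsub>AutOrd\<^esub> \<tau> = compose diff_ops \<sigma> \<tau>"
    and "\<sigma> \<otimes>\<^bsub>AlgAut diff_alg\<^esub> \<tau> = compose diff_ops \<sigma> \<tau>"
  using AutOrd_Bij[OF assms(1)] AutOrd_Bij[OF assms(2)]
  by (simp_all add: AutOrd_alt AlgAut_def diff_alg_simps BijGroup_def)

lemma AlgAut_laurent_carrier: "carrier (AlgAut laurent_alg) = alg_auts laurent_alg"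
  by (simp add: AlgAut_def)

lemma AlgAut_laurent_mult:
  assumes "\<sigma> \<in> alg_auts laurent_alg" "\<tau> \<in> alg_auts laurent_alg"
  shows "\<sigma> \<otimes>\<^bsub>AlgAut laurent_alg\<^esub> \<tau> = \<sigma> \<circ> \<tau>"
  using assms by (auto simp: AlgAut_laurent_alt BijGroup_def laurent_auts_iff Bij_def compose_def fun_eq_iff)

text \<open>
  The order is defined by iterated commutators with \<open>L\<close>, and \<open>\<sigma>\<close> permutes these.
\<close>

lemma diff_aut_preserves_order:
  assumes \<sigma>: "\<sigma> \<in> alg_auts diff_alg" and img: "\<sigma> ` range mult_op = range mult_op"
    and "u \<in> diff_ops_le m"
  shows "\<sigma> u \<in> diff_ops_le m"
proof -
  have hom: "\<And>u v. u \<in> diff_ops \<Longrightarrow> v \<in> diff_ops \<Longrightarrow> \<sigma> (u \<circ> v) = \<sigma> u \<circ> \<sigma> v"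
    "\<And>u v. u \<in> diff_ops \<Longrightarrow> v \<in> diff_ops \<Longrightarrow> \<sigma> (\<lambda>f. u f + v f) = (\<lambda>f. \<sigma> u f + \<sigma> v f)"
    "\<And>c u. u \<in> diff_ops \<Longrightarrow> \<sigma> (\<lambda>f. laurent_const c * u f) = (\<lambda>f. laurent_const c * \<sigma> u f)"
    using \<sigma> unfolding diff_auts_iff by blast+
  show ?thesis using assms(3)
  proof (induction m arbitrary: u)
    case 0
    then show ?case using img by (auto simp: diff_ops_le_0)
  next
    case (Suc m)
    have u: "u \<in> diff_ops" using Suc.prems by (auto simp: diff_ops_def)
    then have \<sigma>u: "\<sigma> u \<in> diff_ops" using \<sigma> by (auto simp: diff_auts_iff dest: Bij_imp_funcset)
    have "commut a (\<sigma> u) \<in> diff_ops_le m" for a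
    proof -
      have "mult_op a \<in> \<sigma> ` range mult_op" unfolding img by (rule rangeI)
      then obtain b where b: "\<sigma> (mult_op b) = mult_op a" by auto
      have eq: "commut c v = (\<lambda>f. (mult_op c \<circ> v) f + laurent_const (- 1) * (v \<circ> mult_op c) f)" for c v
        by (simp add: commut_def mult_op_def laurent_const_simps)
      have bu: "mult_op b \<circ> u \<in> diff_ops" and ub: "u \<circ> mult_op b \<in> diff_ops"
        by (intro diff_ops_comp u mult_op_diff_ops)+
      have "\<sigma> (commut b u) = (\<lambda>f. \<sigma> (mult_op b \<circ> u) f + \<sigma> (\<lambda>f. laurent_const (- 1) * (u \<circ> mult_op b) f) f)"
        unfolding eq by (rule hom(2)[OF bu diff_ops_scale[OF ub]])
      also have "\<dots> = commut a (\<sigma> u)"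
        unfolding eq hom(3)[OF ub] hom(1)[OF u mult_op_diff_ops] hom(1)[OF mult_op_diff_ops u] b ..
      finally have "\<sigma> (commut b u) = commut a (\<sigma> u)" .
      moreover have "commut b u \<in> diff_ops_le m" using Suc.prems by (simp add: diff_ops_le_commut(2))
      ultimately show ?thesis using Suc.IH[of "commut b u"] by simp
    qed
    then show ?case using diff_ops_endo[OF \<sigma>u] by (simp add: diff_ops_le_commut)
  qed
qed

lemma AutOrdI:
  fixes \<sigma> :: "(('k::field, 'n::finite) laurent \<Rightarrow> ('k, 'n) laurent) \<Rightarrow> (('k, 'n) laurent \<Rightarrow> ('k, 'n) laurent)"
  assumes \<sigma>: "\<sigma> \<in> alg_auts diff_alg" and img: "\<sigma> ` range mult_op = range mult_op"
  shows "\<sigma> \<in> carrier AutOrd"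
proof -
  have bij: "\<sigma> \<in> Bij diff_ops" using \<sigma> by (simp add: diff_auts_iff)
  then have inj: "inj_on \<sigma> diff_ops" and surj: "\<sigma> ` diff_ops = diff_ops"
    by (auto simp: Bij_def bij_betw_def)
  define \<rho> where "\<rho> = (\<lambda>u\<in>diff_ops. inv_into diff_ops \<sigma> u)"
  have \<rho>: "\<rho> \<in> alg_auts diff_alg"
    using subgroup.m_inv_closed[OF diff_auts_subgroup \<sigma>] unfolding \<rho>_def inv_BijGroup[OF bij] .
  have "\<rho> ` range mult_op = inv_into diff_ops \<sigma> ` (\<sigma> ` range mult_op)"
    unfolding img using mult_op_diff_ops by (intro image_cong) (auto simp: \<rho>_def)
  also have "\<dots> = range mult_op"
    using inj mult_op_diff_ops by (intro inv_into_image_cancel) auto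
  finally have \<rho>_img: "\<rho> ` range mult_op = range mult_op" .
  have "\<sigma> ` diff_ops_le m = diff_ops_le m" for m
  proof (intro equalityI subsetI)
    fix u assume "u \<in> \<sigma> ` diff_ops_le m"
    then show "u \<in> diff_ops_le m" using diff_aut_preserves_order[OF \<sigma> img] by blast
  next
    fix u :: "('k, 'n) laurent \<Rightarrow> ('k, 'n) laurent" assume u: "u \<in> diff_ops_le m"
    then have "u \<in> diff_ops" by (auto simp: diff_ops_def)
    then have "\<sigma> (\<rho> u) = u" using surj by (simp add: \<rho>_def f_inv_into_f)
    moreover have "\<rho> u \<in> diff_ops_le m" using diff_aut_preserves_order[OF \<rho> \<rho>_img u] .
    ultimately show "u \<in> \<sigma> ` diff_ops_le m" by (rule image_eqI[OF sym])
  qed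
  then show ?thesis using \<sigma> by (simp add: AutOrd_carrier order_filtration_eq)
qed

section \<open>Conjugation by monomials with p-adic exponents\<close>

lemma padic_power_carrier:
  "s \<in> carrier (padic_power p) \<longleftrightarrow> (\<forall>i. s i \<in> carrier (padic_int p))"
  by (simp add: padic_power_def PiE_UNIV_domain Pi_iff)

lemma padic_power_mult: "s \<otimes>\<^bsub>padic_power p\<^esub> t = (\<lambda>i k. (s i k + t i k) mod int p ^ k)"
  by (simp add: padic_power_def padic_int_simps restrict_def)

lemma padic_power_one: "\<one>\<^bsub>padic_power p\<^esub> = (\<lambda>i k. 0)"
  by (simp add: padic_power_def padic_int_simps restrict_def)

lemma group_padic_power:
  assumes "p > 0"
  shows "group (padic_power p)"
proof -
  interpret cring "padic_int p" using assms by (rule padic_int_cring)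
  show ?thesis unfolding padic_power_def by (rule product_group) (rule a_group)
qed

definition padic_trunc :: "('n \<Rightarrow> nat \<Rightarrow> int) \<Rightarrow> nat \<Rightarrow> int ^ 'n::finite" where
  "padic_trunc s k = (\<chi> i. s i k)"

text \<open>
  Any level \<open>k\<close> at which \<open>u\<close> is periodic would do in place of the least one, see \<open>padic_shift_eq\<close>.
\<close>

definition padic_shift :: "nat \<Rightarrow> ('n \<Rightarrow> nat \<Rightarrow> int) \<Rightarrow>
    (('k::field, 'n::finite) laurent \<Rightarrow> ('k, 'n) laurent) \<Rightarrow> (('k, 'n) laurent \<Rightarrow> ('k, 'n) laurent)" where
  "padic_shift p s = (\<lambda>u\<in>diff_ops. shift_conj (padic_trunc s (LEAST k. u \<in> periodic_ops (p ^ k))) u)"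

lemma padic_shift_eq:
  fixes u :: "('k::field, 'n::finite) laurent \<Rightarrow> ('k, 'n) laurent"
  assumes p: "prime p" "CHAR('k) = p"
    and s: "s \<in> carrier (padic_power p)" and u: "u \<in> periodic_ops (p ^ k)"
  shows "padic_shift p s u = shift_conj (padic_trunc s k) u"
proof -
  define l where "l = (LEAST k. u \<in> periodic_ops (p ^ k))"
  have l: "u \<in> periodic_ops (p ^ l)" "l \<le> k"
    unfolding l_def using u by (auto intro: LeastI Least_le)
  have "int (p ^ l) dvd padic_trunc s l $ i - padic_trunc s k $ i" for i
  proof -
    have "s i k mod int p ^ l = s i l mod int p ^ l"
      using s l(2) by (simp add: padic_power_carrier padic_coherent padic_mod_self)
    then show ?thesis by (metis mod_eq_dvd_iff of_nat_power padic_trunc_def vec_lambda_beta)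
  qed
  then have "shift_conj (padic_trunc s l) u = shift_conj (padic_trunc s k) u"
    by (rule shift_conj_periodic_cong[OF l(1)])
  moreover have "u \<in> diff_ops" using u periodic_ops_diff_ops[OF p, of k] by blast
  ultimately show ?thesis by (simp add: padic_shift_def l_def)
qed

lemma common_period:
  fixes u v :: "('k::field, 'n::finite) laurent \<Rightarrow> ('k, 'n) laurent"
  assumes p: "prime p" "CHAR('k) = p" and "u \<in> diff_ops" "v \<in> diff_ops"
  obtains k where "u \<in> periodic_ops (p ^ k)" "v \<in> periodic_ops (p ^ k)"
proof -
  obtain k l where "u \<in> periodic_ops (p ^ k)" "v \<in> periodic_ops (p ^ l)"
    using assms(3,4) unfolding diff_ops_periodic[OF p] by blast
  then have "u \<in> periodic_ops (p ^ max k l)" "v \<in> periodic_ops (p ^ max k l)"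
    using periodic_ops_mono[of "p ^ k" "p ^ max k l"] periodic_ops_mono[of "p ^ l" "p ^ max k l"]
    by (auto simp: le_imp_power_dvd)
  then show thesis by (rule that)
qed

lemma periodic_ops_comp:
  assumes "u \<in> periodic_ops q" "v \<in> periodic_ops q"
  shows "u \<circ> v \<in> periodic_ops q"
  using assms by (auto intro!: periodic_opsI comp_endo dest: periodic_ops_endo simp: periodic_opsD)

lemma periodic_ops_add:
  assumes "u \<in> periodic_ops q" "v \<in> periodic_ops q"
  shows "(\<lambda>f. u f + v f) \<in> periodic_ops q"
  using assms by (auto intro!: periodic_opsI add_endo dest: periodic_ops_endo simp: periodic_opsD distrib_left)

lemma mult_op_periodic: "mult_op a \<in> periodic_ops q"
  using periodic_ops_mono[of 1 q] periodic_ops_1 by auto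

lemma padic_shift_fixes_laurent:
  fixes s :: "'n::finite \<Rightarrow> nat \<Rightarrow> int"
  assumes p: "prime p" "CHAR('k::field) = p" and s: "s \<in> carrier (padic_power p)"
  shows "fixes_laurent (padic_shift p s :: (('k, 'n) laurent \<Rightarrow> ('k, 'n) laurent) \<Rightarrow> _)"
  unfolding fixes_laurent_def
proof (intro conjI ballI allI)
  fix u v :: "('k, 'n) laurent \<Rightarrow> ('k, 'n) laurent"
  assume uv: "u \<in> diff_ops" "v \<in> diff_ops"
  then obtain k where k: "u \<in> periodic_ops (p ^ k)" "v \<in> periodic_ops (p ^ k)"
    by (rule common_period[OF p])
  note eqs = padic_shift_eq[OF p s, of _ k]
  show "padic_shift p s (u \<circ> v) = padic_shift p s u \<circ> padic_shift p s v"
    by (simp add: eqs k periodic_ops_comp shift_conj_comp)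
  show "padic_shift p s (\<lambda>f. u f + v f) = (\<lambda>f. padic_shift p s u f + padic_shift p s v f)"
    by (simp add: eqs k periodic_ops_add shift_conj_add)
next
  fix u :: "('k, 'n) laurent \<Rightarrow> ('k, 'n) laurent"
  assume "u \<in> diff_ops"
  then show "padic_shift p s u \<in> diff_ops" by (simp add: padic_shift_def shift_conj_diff_ops)
next
  fix a :: "('k, 'n) laurent"
  show "padic_shift p s (mult_op a) = mult_op a"
    using padic_shift_eq[OF p s mult_op_periodic, of a 0] by (simp add: shift_conj_mult_op)
qed

lemma padic_shift_shift:
  fixes u :: "('k::field, 'n::finite) laurent \<Rightarrow> ('k, 'n) laurent"
  assumes p: "prime p" "CHAR('k) = p"
    and s: "s \<in> carrier (padic_power p)" and t: "t \<in> carrier (padic_power p)" and u: "u \<in> diff_ops"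
  shows "padic_shift p s (padic_shift p t u) = padic_shift p (s \<otimes>\<^bsub>padic_power p\<^esub> t) u"
proof -
  interpret group "padic_power p :: ('n \<Rightarrow> nat \<Rightarrow> int) monoid"
    using prime_gt_0_nat[OF p(1)] by (rule group_padic_power)
  obtain k where k: "u \<in> periodic_ops (p ^ k)" using u unfolding diff_ops_periodic[OF p] by blast
  have "padic_shift p s (padic_shift p t u) = shift_conj (padic_trunc s k + padic_trunc t k) u"
    by (simp add: padic_shift_eq[OF p s shift_conj_periodic[OF k]] padic_shift_eq[OF p t k] shift_conj_shift_conj)
  also have "\<dots> = shift_conj (padic_trunc (s \<otimes>\<^bsub>padic_power p\<^esub> t) k) u"
    by (rule shift_conj_periodic_cong[OF k])
      (simp add: padic_trunc_def padic_power_mult minus_mod_eq_mult_div)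
  finally show ?thesis using padic_shift_eq[OF p m_closed[OF s t] k] by simp
qed

lemma padic_shift_one:
  fixes u :: "('k::field, 'n::finite) laurent \<Rightarrow> ('k, 'n) laurent"
  assumes "u \<in> diff_ops"
  shows "padic_shift p \<one>\<^bsub>padic_power p\<^esub> u = u"
proof -
  have "padic_trunc (\<lambda>i k. 0) l = (0 :: int ^ 'n)" for l by (simp add: padic_trunc_def vec_eq_iff)
  then show ?thesis using assms by (simp add: padic_shift_def padic_power_one shift_conj_0)
qed

lemma fixes_laurent_AutOrd:
  assumes \<sigma>: "fixes_laurent \<sigma>" and bij: "\<sigma> \<in> Bij diff_ops"
  shows "\<sigma> \<in> carrier AutOrd"
proof (rule AutOrdI)
  have "\<sigma> (\<lambda>f. laurent_const c * u f) = (\<lambda>f. laurent_const c * \<sigma> u f)" if "u \<in> diff_ops" for c u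
  proof -
    have "\<sigma> (mult_op (laurent_const c) \<circ> u) = mult_op (laurent_const c) \<circ> \<sigma> u"
      using fixes_laurentD(2,4)[OF \<sigma>] mult_op_diff_ops that by metis
    then show ?thesis by (simp add: comp_def mult_op_def)
  qed
  then show "\<sigma> \<in> alg_auts diff_alg"
    using bij fixes_laurentD[OF \<sigma>] by (simp add: diff_auts_iff id_mult_op)
  show "\<sigma> ` range mult_op = range mult_op"
    using fixes_laurentD(4)[OF \<sigma>] by (simp add: image_image)
qed

lemma padic_shift_AutOrd:
  fixes s :: "'n::finite \<Rightarrow> nat \<Rightarrow> int"
  assumes p: "prime p" "CHAR('k::field) = p" and s: "s \<in> carrier (padic_power p)"
  shows "(padic_shift p s :: (('k, 'n) laurent \<Rightarrow> ('k, 'n) laurent) \<Rightarrow> _) \<in> carrier AutOrd"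
proof (rule fixes_laurent_AutOrd[OF padic_shift_fixes_laurent[OF p s]])
  interpret group "padic_power p :: ('n \<Rightarrow> nat \<Rightarrow> int) monoid"
    using prime_gt_0_nat[OF p(1)] by (rule group_padic_power)
  let ?t = "inv\<^bsub>padic_power p\<^esub> s"
  note t = inv_closed[OF s]
  have "bij_betw (padic_shift p s) diff_ops (diff_ops :: (('k, 'n) laurent \<Rightarrow> _) set)"
    by (rule bij_betw_byWitness[of _ "padic_shift p ?t"])
      (use s t in \<open>auto simp: padic_shift_shift[OF p] padic_shift_one
        fixes_laurentD(1)[OF padic_shift_fixes_laurent[OF p]]\<close>)
  then show "(padic_shift p s :: (('k, 'n) laurent \<Rightarrow> ('k, 'n) laurent) \<Rightarrow> _) \<in> Bij diff_ops"
    by (simp add: Bij_def padic_shift_def)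
qed

lemma padic_shift_hom:
  assumes p: "prime p" "CHAR('k::field) = p"
  shows "(padic_shift p :: _ \<Rightarrow> (('k, 'n::finite) laurent \<Rightarrow> ('k, 'n) laurent) \<Rightarrow> _) \<in> hom (padic_power p) AutOrd"
proof (rule homI)
  interpret group "padic_power p :: ('n \<Rightarrow> nat \<Rightarrow> int) monoid"
    using prime_gt_0_nat[OF p(1)] by (rule group_padic_power)
  let ?S = "padic_shift p :: _ \<Rightarrow> (('k, 'n) laurent \<Rightarrow> ('k, 'n) laurent) \<Rightarrow> _"
  fix s :: "'n \<Rightarrow> nat \<Rightarrow> int" assume s: "s \<in> carrier (padic_power p)"
  then show S: "?S s \<in> carrier AutOrd" by (rule padic_shift_AutOrd[OF p])
  fix t :: "'n \<Rightarrow> nat \<Rightarrow> int" assume t: "t \<in> carrier (padic_power p)"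
  then have T: "?S t \<in> carrier AutOrd" by (rule padic_shift_AutOrd[OF p])
  have "?S (s \<otimes>\<^bsub>padic_power p\<^esub> t) u = compose diff_ops (?S s) (?S t) u" for u
  proof (cases "u \<in> diff_ops")
    case True
    then show ?thesis by (simp add: compose_def padic_shift_shift[OF p s t])
  next
    case False
    then show ?thesis by (simp add: compose_def padic_shift_def)
  qed
  then show "?S (s \<otimes>\<^bsub>padic_power p\<^esub> t) = ?S s \<otimes>\<^bsub>AutOrd\<^esub> ?S t"
    unfolding AutOrd_mult(1)[OF S T] by blast
qed

text \<open>
  Conjugation of the projection for \<open>p ^ k\<close> remembers the exponent modulo \<open>p ^ k\<close>.
\<close>

lemma padic_shift_inj:
  fixes s t :: "'n::finite \<Rightarrow> nat \<Rightarrow> int"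
  assumes p: "prime p" "CHAR('k::field) = p"
    and s: "s \<in> carrier (padic_power p)" and t: "t \<in> carrier (padic_power p)"
    and eq: "(padic_shift p s :: (('k, 'n) laurent \<Rightarrow> ('k, 'n) laurent) \<Rightarrow> _) = padic_shift p t"
  shows "s = t"
proof (intro ext)
  fix i k
  have "shift_conj (padic_trunc s k) (lattice_proj (p ^ k) :: ('k, 'n) laurent \<Rightarrow> _) =
      shift_conj (padic_trunc t k) (lattice_proj (p ^ k))"
    using padic_shift_eq[OF p s lattice_proj_periodic] padic_shift_eq[OF p t lattice_proj_periodic] eq
    by metis
  then have "int (p ^ k) dvd padic_trunc s k $ i - padic_trunc t k $ i"
    by (rule shift_conj_lattice_proj_inj)
  then have "s i k mod int p ^ k = t i k mod int p ^ k"
    by (simp add: padic_trunc_def mod_eq_dvd_iff)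
  then show "s i k = t i k" using s t by (simp add: padic_power_carrier padic_mod_self)
qed

text \<open>
  The exponents of the local conjugations are determined modulo \<open>p ^ k\<close> by their effect on the
  projections, and so they form coherent sequences.
\<close>

theorem fixes_laurent_imp_padic_shift:
  fixes \<sigma> :: "(('k::field, 'n::finite) laurent \<Rightarrow> ('k, 'n) laurent) \<Rightarrow> (('k, 'n) laurent \<Rightarrow> ('k, 'n) laurent)"
  assumes p: "prime p" "CHAR('k) = p" and \<sigma>: "fixes_laurent \<sigma>" and ext: "\<sigma> \<in> extensional diff_ops"
  shows "\<exists>s\<in>carrier (padic_power p). \<sigma> = padic_shift p s"
proof -
  have "\<forall>k. \<exists>\<gamma>. \<forall>u\<in>periodic_ops (p ^ k). \<sigma> u = shift_conj \<gamma> u"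
    using fixes_laurent_locally_inner[OF p \<sigma>] by blast
  then obtain \<gamma> where \<gamma>: "\<And>k u. u \<in> periodic_ops (p ^ k) \<Longrightarrow> \<sigma> u = shift_conj (\<gamma> k) u"
    by metis
  define s where "s i k = \<gamma> k $ i mod int p ^ k" for i k
  have "s i \<in> carrier (padic_int p)" for i
    unfolding s_def
  proof (rule padic_carrier_mod)
    show "p > 0" using p(1) by (rule prime_gt_0_nat)
    fix k
    have "lattice_proj (p ^ k) \<in> (periodic_ops (p ^ Suc k) :: (('k, 'n) laurent \<Rightarrow> _) set)"
      using lattice_proj_periodic periodic_ops_mono[of "p ^ k" "p ^ Suc k"] by auto
    then have "shift_conj (\<gamma> (Suc k)) (lattice_proj (p ^ k) :: ('k, 'n) laurent \<Rightarrow> _) =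
        shift_conj (\<gamma> k) (lattice_proj (p ^ k))"
      using \<gamma> lattice_proj_periodic by metis
    then have "int (p ^ k) dvd \<gamma> (Suc k) $ i - \<gamma> k $ i" by (rule shift_conj_lattice_proj_inj)
    then show "[\<gamma> (Suc k) $ i = \<gamma> k $ i] (mod int p ^ k)" by (simp add: cong_iff_dvd_diff)
  qed
  then have s: "s \<in> carrier (padic_power p)" by (simp add: padic_power_carrier)
  have "\<sigma> u = padic_shift p s u" for u
  proof (cases "u \<in> diff_ops")
    case True
    then obtain k where k: "u \<in> periodic_ops (p ^ k)" unfolding diff_ops_periodic[OF p] by blast
    have "shift_conj (\<gamma> k) u = shift_conj (padic_trunc s k) u"
      by (rule shift_conj_periodic_cong[OF k]) (simp add: padic_trunc_def s_def minus_mod_eq_mult_div)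
    then show ?thesis using \<gamma>[OF k] padic_shift_eq[OF p s k] by simp
  next
    case False
    then show ?thesis using ext by (simp add: padic_shift_def extensional_def)
  qed
  then show ?thesis using s by blast
qed

lemma AutOrd_fixing_laurent:
  assumes p: "prime p" "CHAR('k::field) = p"
    and \<sigma>: "\<sigma> \<in> alg_auts (diff_alg :: ('k, ('k, 'n::finite) laurent \<Rightarrow> ('k, 'n) laurent) module)"
    and fix_L: "\<And>a. \<sigma> (mult_op a) = mult_op a"
  shows "\<exists>s\<in>carrier (padic_power p). \<sigma> = padic_shift p s"
proof (rule fixes_laurent_imp_padic_shift[OF p])
  show "fixes_laurent \<sigma>"
    using \<sigma> fix_L by (auto simp: diff_auts_iff fixes_laurent_def dest: Bij_imp_funcset)
  show "\<sigma> \<in> extensional diff_ops" using \<sigma> by (simp add: diff_auts_iff Bij_def)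
qed

section \<open>The automorphisms attached to tuples of p-adic integers\<close>

lemma mult_op_mult: "mult_op (a * b) = mult_op a \<circ> mult_op b"
  by (simp add: mult_op_def fun_eq_iff mult.assoc)

lemma mult_op_plus: "mult_op (a + b) = (\<lambda>f. mult_op a f + mult_op b f)"
  by (simp add: mult_op_def distrib_right)

lemma shift_conj_divided_deriv:
  fixes \<gamma> :: "int ^ 'n::finite"
  shows "(shift_conj \<gamma> (divided_deriv \<alpha>) :: ('k::field, 'n) laurent \<Rightarrow> _) =
    monomial_op \<alpha> (\<lambda>\<beta>. multi_binomial (\<beta> + \<gamma>) \<alpha>)"
proof (intro ext poly_mapping_eqI)
  fix f :: "('k, 'n) laurent" and \<beta>
  show "Poly_Mapping.lookup (shift_conj \<gamma> (divided_deriv \<alpha>) f) \<beta> =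
      Poly_Mapping.lookup (monomial_op \<alpha> (\<lambda>\<beta>. multi_binomial (\<beta> + \<gamma>) \<alpha>) f) \<beta>"
    unfolding shift_conj_def lookup_lmono_mult lookup_divided_deriv lookup_monomial_op
      nat_exponent_def[symmetric]
    by (simp add: algebra_simps)
qed

text \<open>
  The level \<open>k\<close> is so large that \<open>\<partial>\<^sup>[\<^sup>\<alpha>\<^sup>]\<close> is periodic modulo \<open>p ^ k\<close> and that the truncation at
  level \<open>k\<close> determines all \<open>p\<close>-adic binomial coefficients that occur, modulo \<open>p\<close>.
\<close>

lemma padic_shift_divided_deriv:
  fixes s :: "'n::finite \<Rightarrow> nat \<Rightarrow> int" and \<alpha> :: "nat ^ 'n"
  assumes p: "prime p" "CHAR('k::field) = p" and s: "s \<in> carrier (padic_power p)"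
  shows "padic_shift p s (divided_deriv \<alpha> :: ('k, 'n) laurent \<Rightarrow> _) = shifted_divided_deriv p s \<alpha>"
proof -
  have p0: "p > 0" using p(1) by (rule prime_gt_0_nat)
  interpret cring "padic_int p" using p0 by (rule padic_int_cring)
  let ?v = "\<lambda>i. 1 + multiplicity p (fact (\<alpha> $ i) :: nat)"
  define k where "k = total_degree \<alpha> + (\<Sum>i\<in>UNIV. ?v i)"
  have "total_degree \<alpha> < p ^ k"
    using power_gt_expt[of p k] prime_gt_1_nat[OF p(1)] by (simp add: k_def One_nat_def)
  then have k: "(divided_deriv \<alpha> :: ('k, 'n) laurent \<Rightarrow> _) \<in> periodic_ops (p ^ k)"
    by (rule diff_ops_le_periodic[OF p divided_deriv_order])
  have "(of_int (int_binomial ((\<beta> + padic_trunc s k) $ i) (\<alpha> $ i)) :: 'k) =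
      padic_reduce (padic_binomial p (padic_of_int p (\<beta> $ i) \<oplus>\<^bsub>padic_int p\<^esub> s i) (\<alpha> $ i))" for \<beta> i
  proof -
    let ?t = "padic_of_int p (\<beta> $ i) \<oplus>\<^bsub>padic_int p\<^esub> s i"
    have t: "?t \<in> carrier (padic_int p)"
      using s padic_of_int_closed[OF p0] by (simp add: padic_power_carrier)
    have "?v i \<le> (\<Sum>i\<in>UNIV. ?v i)" by (rule member_le_sum) auto
    then have vk: "?v i \<le> k" by (simp add: k_def)
    have "?t k = (\<beta> $ i + s i k) mod int p ^ k"
      by (simp add: padic_int_simps padic_of_int_def mod_simps)
    then have "[\<beta> $ i + s i k = ?t k] (mod int p ^ k)" by (simp add: cong_def)
    then have "[\<beta> $ i + s i k = ?t k] (mod int p ^ ?v i)"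
      by (rule cong_dvd_modulus) (rule le_imp_power_dvd[OF vk])
    then have "[int_binomial (\<beta> $ i + s i k) (\<alpha> $ i) = int_binomial (?t k) (\<alpha> $ i)] (mod int p ^ 1)"
      by (rule int_binomial_cong[OF p(1)])
    then have "(of_int (int_binomial (\<beta> $ i + s i k) (\<alpha> $ i)) :: 'k) = of_int (int_binomial (?t k) (\<alpha> $ i))"
      unfolding of_int_eq_iff_cong_CHAR p(2) by simp
    then show ?thesis
      unfolding padic_reduce_binomial[OF p t vk] by (simp add: padic_trunc_def)
  qed
  then show ?thesis
    unfolding padic_shift_eq[OF p s k] shift_conj_divided_deriv shifted_divided_deriv_def multi_binomial_def
    by simp
qed

lemma fixes_laurent_sum:
  assumes \<sigma>: "fixes_laurent \<sigma>" and "\<And>x. x \<in> A \<Longrightarrow> u x \<in> diff_ops"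
  shows "(\<lambda>f. \<Sum>x\<in>A. u x f) \<in> diff_ops \<and> \<sigma> (\<lambda>f. \<Sum>x\<in>A. u x f) = (\<lambda>f. \<Sum>x\<in>A. \<sigma> (u x) f)"
proof -
  have zero: "(\<lambda>_. 0) = mult_op 0" by (simp add: mult_op_def)
  have zero': "(\<lambda>_. 0) \<in> diff_ops \<and> \<sigma> (\<lambda>_. 0) = (\<lambda>_. 0)"
    unfolding zero using mult_op_diff_ops[of 0] fixes_laurentD(4)[OF \<sigma>, of 0] by blast
  show ?thesis
    using assms(2)
  proof (induction A rule: infinite_finite_induct)
    case (insert x A)
    then have "u x \<in> diff_ops" "(\<lambda>f. \<Sum>x\<in>A. u x f) \<in> diff_ops"
      "\<sigma> (\<lambda>f. \<Sum>x\<in>A. u x f) = (\<lambda>f. \<Sum>x\<in>A. \<sigma> (u x) f)" by auto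
    then show ?case
      using insert.hyps by (simp add: diff_ops_add fixes_laurentD(3)[OF \<sigma>])
  qed (use zero' in simp_all)
qed

text \<open>
  The divided derivations span the differential operators as a left module over \<open>L\<close>.
\<close>

lemma fixes_laurent_determined:
  fixes \<sigma> \<tau> :: "(('k::field, 'n::finite) laurent \<Rightarrow> ('k, 'n) laurent) \<Rightarrow> (('k, 'n) laurent \<Rightarrow> ('k, 'n) laurent)"
  assumes \<sigma>: "fixes_laurent \<sigma>" and \<tau>: "fixes_laurent \<tau>"
    and eq: "\<And>\<alpha>. \<sigma> (divided_deriv \<alpha>) = \<tau> (divided_deriv \<alpha>)" and u: "u \<in> diff_ops"
  shows "\<sigma> u = \<tau> u"
proof -
  obtain m where "u \<in> order_filtration m" using u by (auto simp: order_filtration_eq diff_ops_def)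
  then obtain a :: "nat ^ 'n \<Rightarrow> ('k, 'n) laurent" where
    u_eq: "u = (\<lambda>f. \<Sum>\<alpha> | total_degree \<alpha> \<le> m. (mult_op (a \<alpha>) \<circ> divided_deriv \<alpha>) f)"
    by (auto simp: order_filtration_def total_degree_def mult_op_def)
  have D: "divided_deriv \<alpha> \<in> (diff_ops :: (('k, 'n) laurent \<Rightarrow> _) set)" for \<alpha>
    using divided_deriv_order[of \<alpha>] by (auto simp: diff_ops_def)
  then have D': "mult_op (a \<alpha>) \<circ> divided_deriv \<alpha> \<in> diff_ops" for \<alpha>
    by (intro diff_ops_comp mult_op_diff_ops)
  have hom: "\<rho> (mult_op (a \<alpha>) \<circ> divided_deriv \<alpha>) = mult_op (a \<alpha>) \<circ> \<rho> (divided_deriv \<alpha>)"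
    if "fixes_laurent \<rho>" for \<rho> \<alpha>
    using fixes_laurentD(2)[OF that mult_op_diff_ops D] fixes_laurentD(4)[OF that] by simp
  have "\<rho> u = (\<lambda>f. \<Sum>\<alpha> | total_degree \<alpha> \<le> m. (mult_op (a \<alpha>) \<circ> \<rho> (divided_deriv \<alpha>)) f)"
    if "fixes_laurent \<rho>" for \<rho>
    using fixes_laurent_sum[OF that, of "{\<alpha>. total_degree \<alpha> \<le> m}" "\<lambda>\<alpha>. mult_op (a \<alpha>) \<circ> divided_deriv \<alpha>"] D'
    unfolding u_eq hom[OF that] by blast
  from this[OF \<sigma>] this[OF \<tau>] show ?thesis unfolding eq by simp
qed

lemma diff_aut_fixing_vars:
  fixes \<sigma> :: "(('k::field, 'n::finite) laurent \<Rightarrow> ('k, 'n) laurent) \<Rightarrow> (('k, 'n) laurent \<Rightarrow> ('k, 'n) laurent)"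
  assumes \<sigma>: "\<sigma> \<in> alg_auts diff_alg" and var: "\<And>i. \<sigma> (mult_op (laurent_var i)) = mult_op (laurent_var i)"
  shows "fixes_laurent \<sigma>"
proof -
  have hom: "\<And>u v. u \<in> diff_ops \<Longrightarrow> v \<in> diff_ops \<Longrightarrow> \<sigma> (u \<circ> v) = \<sigma> u \<circ> \<sigma> v"
    "\<And>u v. u \<in> diff_ops \<Longrightarrow> v \<in> diff_ops \<Longrightarrow> \<sigma> (\<lambda>f. u f + v f) = (\<lambda>f. \<sigma> u f + \<sigma> v f)"
    "\<And>c u. u \<in> diff_ops \<Longrightarrow> \<sigma> (\<lambda>f. laurent_const c * u f) = (\<lambda>f. laurent_const c * \<sigma> u f)"
    "\<sigma> id = id" "\<And>u. u \<in> diff_ops \<Longrightarrow> \<sigma> u \<in> diff_ops"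
    using \<sigma> unfolding diff_auts_iff by (blast dest: Bij_imp_funcset)+
  have "\<sigma> (mult_op a) = mult_op a" for a
  proof (induction a rule: laurent_generator_induct)
    case (const c)
    have "mult_op (laurent_const c) = (\<lambda>f. laurent_const c * id f :: ('k, 'n) laurent)"
      by (simp add: mult_op_def)
    then show ?case using hom(3)[of id c] hom(4) mult_op_diff_ops[of 1] by (simp add: id_mult_op)
  next
    case (var i)
    show ?case by (fact assms(2))
  next
    case (var_inv i)
    let ?x = "laurent_var i :: ('k, 'n) laurent" and ?y = "lmono (- axis i 1) :: ('k, 'n) laurent"
    have xy: "mult_op ?x \<circ> mult_op ?y = id" and yx: "mult_op ?y \<circ> mult_op ?x = id"
      by (simp_all add: mult_op_def fun_eq_iff laurent_var_lmono lmono_inverse)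
    have "\<sigma> (mult_op ?y) \<circ> mult_op ?x = id"
      using hom(1)[OF mult_op_diff_ops mult_op_diff_ops, of ?y ?x] by (simp only: yx hom(4) assms(2))
    then have "\<sigma> (mult_op ?y) \<circ> mult_op ?x \<circ> mult_op ?y = mult_op ?y" by simp
    then show ?case unfolding comp_assoc xy by simp
  next
    case (add f g)
    then show ?case
      unfolding mult_op_plus using hom(2)[OF mult_op_diff_ops mult_op_diff_ops, of f g] by simp
  next
    case (mult f g)
    show ?case unfolding mult_op_mult hom(1)[OF mult_op_diff_ops mult_op_diff_ops] mult ..
  qed
  then show ?thesis using hom by (simp add: fixes_laurent_def)
qed

lemma is_sigma_iff:
  fixes s :: "'n::finite \<Rightarrow> nat \<Rightarrow> int"
    and \<rho> :: "(('k::field, 'n) laurent \<Rightarrow> ('k, 'n) laurent) \<Rightarrow> (('k, 'n) laurent \<Rightarrow> ('k, 'n) laurent)"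
  assumes p: "prime p" "CHAR('k) = p" and s: "s \<in> carrier (padic_power p)"
  shows "is_sigma p s \<rho> \<longleftrightarrow> \<rho> = padic_shift p s"
proof
  assume \<rho>: "is_sigma p s \<rho>"
  then have aut: "\<rho> \<in> alg_auts diff_alg" by (simp add: is_sigma_def AlgAut_def)
  moreover have "\<rho> (mult_op (laurent_var i)) = mult_op (laurent_var i)" for i
    using \<rho> by (simp add: is_sigma_def)
  ultimately have fix_L: "fixes_laurent \<rho>" by (rule diff_aut_fixing_vars)
  have "\<rho> u = padic_shift p s u" for u
  proof (cases "u \<in> diff_ops")
    case True
    show ?thesis
      by (rule fixes_laurent_determined[OF fix_L padic_shift_fixes_laurent[OF p s] _ True])
        (use \<rho> in \<open>simp add: is_sigma_def padic_shift_divided_deriv[OF p s]\<close>)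
  next
    case False
    then show ?thesis using aut by (simp add: padic_shift_def diff_auts_iff Bij_def extensional_def)
  qed
  then show "\<rho> = padic_shift p s" by blast
next
  assume "\<rho> = padic_shift p s"
  then show "is_sigma p s \<rho>"
    using padic_shift_AutOrd[OF p s] fixes_laurentD(4)[OF padic_shift_fixes_laurent[OF p s]]
    by (simp add: is_sigma_def AlgAut_def AutOrd_carrier padic_shift_divided_deriv[OF p s])
qed

lemma sigma_eq:
  fixes s :: "'n::finite \<Rightarrow> nat \<Rightarrow> int"
  assumes p: "prime p" "CHAR('k::field) = p" and s: "s \<in> carrier (padic_power p)"
  shows "(sigma p s :: (('k, 'n) laurent \<Rightarrow> ('k, 'n) laurent) \<Rightarrow> _) = padic_shift p s"
  unfolding sigma_def is_sigma_iff[OF p s] by (rule the_eq_trivial)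

section \<open>Automorphisms induced from the Laurent polynomials\<close>

lemma laurent_autD:
  assumes "\<tau> \<in> alg_auts laurent_alg"
  shows "\<tau> (a * b) = \<tau> a * \<tau> b" "\<tau> (a + b) = \<tau> a + \<tau> b" "\<tau> (laurent_const c * a) = laurent_const c * \<tau> a"
  using assms unfolding laurent_auts_iff by blast+

lemma laurent_aut_inv:
  assumes "\<tau> \<in> alg_auts laurent_alg"
  shows "inv_into UNIV \<tau> \<in> alg_auts laurent_alg" "\<tau> (inv_into UNIV \<tau> a) = a" "inv_into UNIV \<tau> (\<tau> a) = a"
proof -
  have bij: "bij \<tau>" using assms by (simp add: laurent_auts_iff)
  then have "\<tau> \<in> Bij UNIV" by (simp add: Bij_def)
  from inv_BijGroup[OF this] subgroup.m_inv_closed[OF laurent_auts_subgroup assms]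
  show "inv_into UNIV \<tau> \<in> alg_auts laurent_alg" by (simp add: restrict_def)
  show "\<tau> (inv_into UNIV \<tau> a) = a" "inv_into UNIV \<tau> (\<tau> a) = a"
    using bij by (simp_all add: bij_is_surj surj_f_inv_f bij_is_inj)
qed

lemma induced_order:
  assumes \<tau>: "\<tau> \<in> alg_auts laurent_alg" and u: "u \<in> diff_ops_le m"
  shows "\<tau> \<circ> u \<circ> inv_into UNIV \<tau> \<in> diff_ops_le m"
  using u
proof (induction m arbitrary: u)
  case 0
  then obtain a where "u = mult_op a" by (auto simp: diff_ops_le_0)
  then have "\<tau> \<circ> u \<circ> inv_into UNIV \<tau> = mult_op (\<tau> a)"
    by (simp add: mult_op_def fun_eq_iff laurent_autD(1)[OF \<tau>] laurent_aut_inv[OF \<tau>])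
  then show ?case unfolding diff_ops_le_0 by (rule range_eqI)
next
  case (Suc m)
  let ?\<rho> = "inv_into UNIV \<tau>"
  note \<rho> = laurent_aut_inv[OF \<tau>]
  have minus: "\<tau> (f - g) = \<tau> f - \<tau> g" for f g
    using laurent_autD(2)[OF \<tau>, of "f - g" g] by (simp add: algebra_simps)
  have "commut a (\<tau> \<circ> u \<circ> ?\<rho>) = \<tau> \<circ> commut (?\<rho> a) u \<circ> ?\<rho>" for a
    by (simp add: commut_def fun_eq_iff minus laurent_autD(1)[OF \<tau>] laurent_autD(1)[OF \<rho>(1)] \<rho>(2))
  moreover have "\<tau> \<circ> commut (?\<rho> a) u \<circ> ?\<rho> \<in> diff_ops_le m" for a
    using Suc by (simp only: diff_ops_le_commut(2))
  moreover have "\<tau> \<circ> u \<circ> ?\<rho> \<in> laurent_endos"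
    using diff_ops_le_endo[OF Suc.prems]
    by (intro laurent_endosI)
      (simp_all add: laurent_autD(2,3)[OF \<tau>] laurent_autD(2,3)[OF \<rho>(1)] laurent_endos_simps)
  ultimately show ?case by (simp only: diff_ops_le_commut(2)) blast
qed

lemma induced_diff_ops:
  assumes "\<tau> \<in> alg_auts laurent_alg" "u \<in> diff_ops"
  shows "\<tau> \<circ> u \<circ> inv_into UNIV \<tau> \<in> diff_ops"
  using assms induced_order by (auto simp: diff_ops_def)

lemma induced_aut_mult_op:
  assumes "\<tau> \<in> alg_auts laurent_alg"
  shows "induced_aut \<tau> (mult_op a) = mult_op (\<tau> a)"
  using mult_op_diff_ops[of a]
  by (simp add: induced_aut_def mult_op_def fun_eq_iff laurent_autD(1)[OF assms] laurent_aut_inv[OF assms])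

lemma induced_aut_AutOrd:
  fixes \<tau> :: "('k::field, 'n::finite) laurent \<Rightarrow> ('k, 'n) laurent"
  assumes \<tau>: "\<tau> \<in> alg_auts laurent_alg"
  shows "induced_aut \<tau> \<in> carrier AutOrd"
proof (rule AutOrdI)
  let ?\<rho> = "inv_into UNIV \<tau>"
  note \<rho> = laurent_aut_inv[OF \<tau>]
  have inv: "inv_into UNIV ?\<rho> = \<tau>"
    using \<tau> by (simp add: laurent_auts_iff inv_inv_eq)
  have "bij_betw (induced_aut \<tau>) diff_ops diff_ops"
    by (rule bij_betw_byWitness[of _ "induced_aut ?\<rho>"])
      (use induced_diff_ops[OF \<tau>] induced_diff_ops[OF \<rho>(1)] in
        \<open>auto simp: induced_aut_def inv \<rho>(2,3) fun_eq_iff comp_def\<close>)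
  then have "induced_aut \<tau> \<in> Bij diff_ops" by (simp add: Bij_def induced_aut_def)
  then show "induced_aut \<tau> \<in> alg_auts diff_alg"
    using mult_op_diff_ops[of "1 :: ('k, 'n) laurent"]
    by (simp add: diff_auts_iff induced_aut_def diff_ops_comp diff_ops_add diff_ops_scale id_mult_op[symmetric]
        fun_eq_iff \<rho>(2,3) laurent_autD(2,3)[OF \<tau>])
  show "induced_aut \<tau> ` range mult_op = range mult_op"
  proof -
    have "induced_aut \<tau> ` range mult_op = mult_op ` range \<tau>"
      by (simp add: image_image induced_aut_mult_op[OF \<tau>])
    moreover have "range \<tau> = UNIV" using \<tau> by (simp add: laurent_auts_iff bij_is_surj)
    ultimately show ?thesis by simp
  qed
qed

lemma induced_aut_hom: "induced_aut \<in> hom (AlgAut laurent_alg) AutOrd"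
proof (rule homI)
  fix \<sigma> :: "('k::field, 'n::finite) laurent \<Rightarrow> ('k, 'n) laurent"
  assume "\<sigma> \<in> carrier (AlgAut laurent_alg)"
  then have \<sigma>: "\<sigma> \<in> alg_auts laurent_alg" by (simp add: AlgAut_laurent_carrier)
  then show S: "induced_aut \<sigma> \<in> carrier AutOrd" by (rule induced_aut_AutOrd)
  fix \<tau> :: "('k, 'n) laurent \<Rightarrow> ('k, 'n) laurent"
  assume "\<tau> \<in> carrier (AlgAut laurent_alg)"
  then have \<tau>: "\<tau> \<in> alg_auts laurent_alg" by (simp add: AlgAut_laurent_carrier)
  have "bij \<sigma>" "bij \<tau>" using \<sigma> \<tau> by (simp_all add: laurent_auts_iff)
  then have "inv_into UNIV (\<sigma> \<circ> \<tau>) = inv_into UNIV \<tau> \<circ> inv_into UNIV \<sigma>" by (rule o_inv_distrib)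
  then show "induced_aut (\<sigma> \<otimes>\<^bsub>AlgAut laurent_alg\<^esub> \<tau>) = induced_aut \<sigma> \<otimes>\<^bsub>AutOrd\<^esub> induced_aut \<tau>"
    unfolding AutOrd_mult(1)[OF S induced_aut_AutOrd[OF \<tau>]] AlgAut_laurent_mult[OF \<sigma> \<tau>]
    using induced_diff_ops[OF \<tau>]
    by (auto simp: induced_aut_def compose_def fun_eq_iff comp_assoc)
qed

text \<open>
  The multiplication operators are the operators of order zero.
\<close>

lemma AutOrd_restriction:
  fixes \<sigma> :: "(('k::field, 'n::finite) laurent \<Rightarrow> ('k, 'n) laurent) \<Rightarrow> (('k, 'n) laurent \<Rightarrow> ('k, 'n) laurent)"
  assumes "\<sigma> \<in> carrier AutOrd"
  shows "\<exists>\<tau>\<in>alg_auts laurent_alg. \<forall>a. \<sigma> (mult_op a) = mult_op (\<tau> a)"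
proof -
  have aut: "\<sigma> \<in> alg_auts diff_alg" and img: "\<sigma> ` range mult_op = range mult_op"
    using assms unfolding AutOrd_carrier order_filtration_eq by (auto simp: diff_ops_le_0[symmetric])
  have hom: "\<And>u v. u \<in> diff_ops \<Longrightarrow> v \<in> diff_ops \<Longrightarrow> \<sigma> (u \<circ> v) = \<sigma> u \<circ> \<sigma> v"
    "\<And>u v. u \<in> diff_ops \<Longrightarrow> v \<in> diff_ops \<Longrightarrow> \<sigma> (\<lambda>f. u f + v f) = (\<lambda>f. \<sigma> u f + \<sigma> v f)"
    "\<And>c u. u \<in> diff_ops \<Longrightarrow> \<sigma> (\<lambda>f. laurent_const c * u f) = (\<lambda>f. laurent_const c * \<sigma> u f)"
    "\<sigma> id = id" "inj_on \<sigma> diff_ops"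
    using aut unfolding diff_auts_iff by (auto simp: Bij_def bij_betw_def)
  define \<tau> where "\<tau> a = \<sigma> (mult_op a) 1" for a
  have \<tau>: "\<sigma> (mult_op a) = mult_op (\<tau> a)" for a
  proof -
    have "\<sigma> (mult_op a) \<in> range mult_op" using img by blast
    then show ?thesis by (auto simp: \<tau>_def mult_op_def)
  qed
  have mult_op_inj: "mult_op a = mult_op b \<Longrightarrow> a = b" for a b :: "('k, 'n) laurent"
    by (metis mult_op_def mult_1_right)
  have "\<tau> \<in> alg_auts laurent_alg"
    unfolding laurent_auts_iff
  proof (intro conjI allI)
    fix a b :: "('k, 'n) laurent"
    have "\<sigma> (mult_op (a * b)) = mult_op (\<tau> a) \<circ> mult_op (\<tau> b)"
      unfolding mult_op_mult hom(1)[OF mult_op_diff_ops mult_op_diff_ops] \<tau> ..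
    then show "\<tau> (a * b) = \<tau> a * \<tau> b" by (simp add: \<tau>_def[of "a * b"] mult_op_def)
    show "\<tau> (a + b) = \<tau> a + \<tau> b"
      using hom(2)[OF mult_op_diff_ops mult_op_diff_ops, of a b] by (simp add: \<tau>_def mult_op_plus)
  next
    show "\<tau> 1 = 1" using hom(4) by (simp add: \<tau>_def id_mult_op[symmetric])
  next
    fix c and a :: "('k, 'n) laurent"
    have "mult_op (laurent_const c * a) = (\<lambda>f. laurent_const c * mult_op a f)"
      by (simp add: mult_op_def mult.assoc)
    then show "\<tau> (laurent_const c * a) = laurent_const c * \<tau> a"
      using hom(3)[OF mult_op_diff_ops, of c a] by (simp add: \<tau>_def)
  next
    have "inj \<tau>"
    proof (rule injI)
      fix a b assume "\<tau> a = \<tau> b"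
      then have "\<sigma> (mult_op a) = \<sigma> (mult_op b)" by (simp add: \<tau>)
      then show "a = b" using inj_onD[OF hom(5)] mult_op_diff_ops mult_op_inj by metis
    qed
    moreover have "b \<in> range \<tau>" for b
    proof -
      have "mult_op b \<in> \<sigma> ` range mult_op" unfolding img by (rule rangeI)
      then obtain a where "mult_op b = \<sigma> (mult_op a)" by auto
      then have "b = \<tau> a" unfolding \<tau> by (rule mult_op_inj)
      then show ?thesis by blast
    qed
    then have "surj \<tau>" by blast
    ultimately show "bij \<tau>" by (rule bijI)
  qed
  then show ?thesis using \<tau> by blast
qed


section \<open>The structure of the group of order preserving automorphisms\<close>

text \<open>
  The second factor is the restriction of \<open>\<sigma>\<close> to \<open>L\<close>, because the first one fixes \<open>L\<close>; the first
  factor is what remains after division by the second.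
\<close>

lemma AutOrd_decomposition:
  fixes \<sigma> :: "(('k::field, 'n::finite) laurent \<Rightarrow> ('k, 'n) laurent) \<Rightarrow> (('k, 'n) laurent \<Rightarrow> ('k, 'n) laurent)"
  assumes p: "prime p" "CHAR('k) = p" and \<sigma>: "\<sigma> \<in> carrier AutOrd"
  shows "\<exists>!x. x \<in> carrier (padic_power p) \<times> carrier (AlgAut laurent_alg) \<and>
    \<sigma> = padic_shift p (fst x) \<otimes>\<^bsub>AutOrd\<^esub> induced_aut (snd x)"
proof -
  interpret group "AutOrd :: ((('k, 'n) laurent \<Rightarrow> ('k, 'n) laurent) \<Rightarrow>
      (('k, 'n) laurent \<Rightarrow> ('k, 'n) laurent)) monoid" by (rule group_AutOrd)
  have mult_op_inj: "mult_op a = mult_op b \<Longrightarrow> a = b" for a b :: "('k, 'n) laurent"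
    by (metis mult_op_def mult_1_right)
  have on_laurent: "(padic_shift p s \<otimes>\<^bsub>AutOrd\<^esub> induced_aut \<tau>) (mult_op a) = mult_op (\<tau> a)"
    if s: "s \<in> carrier (padic_power p)" and \<tau>: "\<tau> \<in> alg_auts laurent_alg"
    for s and \<tau> :: "('k, 'n) laurent \<Rightarrow> ('k, 'n) laurent" and a
    using fixes_laurentD(4)[OF padic_shift_fixes_laurent[OF p s]] mult_op_diff_ops[of a]
    by (simp add: AutOrd_mult(1)[OF padic_shift_AutOrd[OF p s] induced_aut_AutOrd[OF \<tau>]] compose_eq
        induced_aut_mult_op[OF \<tau>])
  obtain \<tau> where \<tau>: "\<tau> \<in> alg_auts laurent_alg" and \<sigma>\<tau>: "\<And>a. \<sigma> (mult_op a) = mult_op (\<tau> a)"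
    using AutOrd_restriction[OF \<sigma>] by blast
  have T: "induced_aut \<tau> \<in> carrier AutOrd" using \<tau> by (rule induced_aut_AutOrd)
  define \<rho> where "\<rho> = \<sigma> \<otimes>\<^bsub>AutOrd\<^esub> inv\<^bsub>AutOrd\<^esub> induced_aut \<tau>"
  have \<rho>: "\<rho> \<in> carrier AutOrd" using \<sigma> T by (simp add: \<rho>_def)
  have \<sigma>_eq: "\<sigma> = \<rho> \<otimes>\<^bsub>AutOrd\<^esub> induced_aut \<tau>" using \<sigma> T by (simp add: \<rho>_def m_assoc)
  have "\<rho> (mult_op a) = mult_op a" for a
  proof -
    obtain b where a: "a = \<tau> b" using laurent_aut_inv(2)[OF \<tau>, of a] by metis
    have "\<sigma> (mult_op b) = \<rho> (induced_aut \<tau> (mult_op b))"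
      using mult_op_diff_ops[of b] by (subst \<sigma>_eq) (simp add: AutOrd_mult(1)[OF \<rho> T] compose_eq)
    then show ?thesis by (simp add: \<sigma>\<tau> induced_aut_mult_op[OF \<tau>] a)
  qed
  then have "\<exists>s\<in>carrier (padic_power p). \<rho> = padic_shift p s"
    using \<rho> by (intro AutOrd_fixing_laurent[OF p]) (simp_all add: AutOrd_carrier)
  then obtain s where s: "s \<in> carrier (padic_power p)" "\<rho> = padic_shift p s" by blast
  show ?thesis
  proof (rule ex1I[of _ "(s, \<tau>)"])
    show "(s, \<tau>) \<in> carrier (padic_power p) \<times> carrier (AlgAut laurent_alg) \<and>
        \<sigma> = padic_shift p (fst (s, \<tau>)) \<otimes>\<^bsub>AutOrd\<^esub> induced_aut (snd (s, \<tau>))"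
      using s \<tau> \<sigma>_eq by (simp add: AlgAut_laurent_carrier)
    fix x :: "('n \<Rightarrow> nat \<Rightarrow> int) \<times> (('k, 'n) laurent \<Rightarrow> ('k, 'n) laurent)"
    assume x: "x \<in> carrier (padic_power p) \<times> carrier (AlgAut laurent_alg) \<and>
        \<sigma> = padic_shift p (fst x) \<otimes>\<^bsub>AutOrd\<^esub> induced_aut (snd x)"
    obtain t \<upsilon> where x_eq: "x = (t, \<upsilon>)" by (cases x)
    have t: "t \<in> carrier (padic_power p)" and \<upsilon>: "\<upsilon> \<in> alg_auts laurent_alg"
      and \<sigma>_eq': "\<sigma> = padic_shift p t \<otimes>\<^bsub>AutOrd\<^esub> induced_aut \<upsilon>"
      using x by (simp_all add: x_eq AlgAut_laurent_carrier)
    have "\<upsilon> a = \<tau> a" for a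
      using on_laurent[OF t \<upsilon>, of a] \<sigma>\<tau>[of a] \<sigma>_eq' mult_op_inj by metis
    then have "\<upsilon> = \<tau>" by blast
    then have "padic_shift p t \<otimes>\<^bsub>AutOrd\<^esub> induced_aut \<tau> = padic_shift p s \<otimes>\<^bsub>AutOrd\<^esub> induced_aut \<tau>"
      using \<sigma>_eq \<sigma>_eq' s(2) by simp
    then have "padic_shift p t = (padic_shift p s :: (('k, 'n) laurent \<Rightarrow> ('k, 'n) laurent) \<Rightarrow> _)"
      using T padic_shift_AutOrd[OF p t] padic_shift_AutOrd[OF p s(1)] by simp
    then have "t = s" by (rule padic_shift_inj[OF p t s(1)])
    then show "x = (s, \<tau>)" using \<open>\<upsilon> = \<tau>\<close> x_eq by simp
  qed
qed

text \<open>
  The decomposition of the product on the left has \<open>\<tau>\<close> as its second factor, since both sides have the same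
  restriction to \<open>L\<close>.
\<close>

lemma induced_aut_normalizes:
  fixes s :: "'n::finite \<Rightarrow> nat \<Rightarrow> int" and \<tau> :: "('k::field, 'n) laurent \<Rightarrow> ('k, 'n) laurent"
  assumes p: "prime p" "CHAR('k) = p" and s: "s \<in> carrier (padic_power p)" and \<tau>: "\<tau> \<in> alg_auts laurent_alg"
  shows "\<exists>t\<in>carrier (padic_power p).
    induced_aut \<tau> \<otimes>\<^bsub>AutOrd\<^esub> padic_shift p s = padic_shift p t \<otimes>\<^bsub>AutOrd\<^esub> induced_aut \<tau>"
proof -
  interpret group "AutOrd :: ((('k, 'n) laurent \<Rightarrow> ('k, 'n) laurent) \<Rightarrow>
      (('k, 'n) laurent \<Rightarrow> ('k, 'n) laurent)) monoid" by (rule group_AutOrd)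
  note S = padic_shift_AutOrd[OF p s] and T = induced_aut_AutOrd[OF \<tau>]
  let ?g = "induced_aut \<tau> \<otimes>\<^bsub>AutOrd\<^esub> padic_shift p s"
  have g: "?g \<in> carrier AutOrd" using S T by simp
  from ex1_implies_ex[OF AutOrd_decomposition[OF p g]] obtain t \<upsilon> where
    t: "t \<in> carrier (padic_power p)" and \<upsilon>: "\<upsilon> \<in> alg_auts laurent_alg"
    and g_eq: "?g = padic_shift p t \<otimes>\<^bsub>AutOrd\<^esub> induced_aut \<upsilon>"
    by (auto simp: AlgAut_laurent_carrier)
  have "mult_op (\<tau> a) = mult_op (\<upsilon> a)" for a
  proof -
    have "?g (mult_op a) = mult_op (\<tau> a)"
      using mult_op_diff_ops[of a] fixes_laurentD(4)[OF padic_shift_fixes_laurent[OF p s]]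
      by (simp add: AutOrd_mult(1)[OF T S] compose_eq induced_aut_mult_op[OF \<tau>])
    moreover have "(padic_shift p t \<otimes>\<^bsub>AutOrd\<^esub> induced_aut \<upsilon>) (mult_op a) = mult_op (\<upsilon> a)"
      using mult_op_diff_ops[of a] fixes_laurentD(4)[OF padic_shift_fixes_laurent[OF p t]]
      by (simp add: AutOrd_mult(1)[OF padic_shift_AutOrd[OF p t] induced_aut_AutOrd[OF \<upsilon>]] compose_eq
          induced_aut_mult_op[OF \<upsilon>])
    ultimately show ?thesis unfolding g_eq by simp
  qed
  then have "mult_op (\<tau> a) 1 = mult_op (\<upsilon> a) 1" for a by metis
  then have "\<tau> = \<upsilon>" by (simp add: mult_op_def fun_eq_iff)
  then show ?thesis using t g_eq by blast
qed

theorem theorem1p3: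
  fixes p :: nat
  assumes "prime p"
    and "CHAR('k::field) = p"
  shows "(\<exists>\<phi> \<in> hom (AlgAut (laurent_alg :: ('k, ('k, 'n::finite) laurent) module))
                    (AutoGroup (padic_power p :: ('n \<Rightarrow> nat \<Rightarrow> int) monoid)).
            (AutOrd :: ((('k, 'n) laurent \<Rightarrow> ('k, 'n) laurent) \<Rightarrow>
                        (('k, 'n) laurent \<Rightarrow> ('k, 'n) laurent)) monoid)
              \<cong> semidirect_product (padic_power p) (AlgAut laurent_alg) \<phi>)
     \<and> (\<forall>s \<in> carrier (padic_power p :: ('n \<Rightarrow> nat \<Rightarrow> int) monoid).
          \<exists>!\<rho> :: (('k, 'n) laurent \<Rightarrow> ('k, 'n) laurent) \<Rightarrow>
                 (('k, 'n) laurent \<Rightarrow> ('k, 'n) laurent). is_sigma p s \<rho>)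
     \<and> (\<forall>\<sigma> \<in> carrier (AutOrd :: ((('k, 'n) laurent \<Rightarrow> ('k, 'n) laurent) \<Rightarrow>
                        (('k, 'n) laurent \<Rightarrow> ('k, 'n) laurent)) monoid).
          \<exists>!(s\<tau> :: ('n \<Rightarrow> nat \<Rightarrow> int) \<times> (('k, 'n) laurent \<Rightarrow> ('k, 'n) laurent)).
            s\<tau> \<in> carrier (padic_power p) \<times> carrier (AlgAut laurent_alg) \<and>
            \<sigma> = sigma p (fst s\<tau>) \<otimes>\<^bsub>AlgAut diff_alg\<^esub> induced_aut (snd s\<tau>))"
proof (intro conjI ballI)
  note p = assms
  show "\<exists>\<phi> \<in> hom (AlgAut (laurent_alg :: ('k, ('k, 'n) laurent) module))
                    (AutoGroup (padic_power p :: ('n \<Rightarrow> nat \<Rightarrow> int) monoid)).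
            (AutOrd :: ((('k, 'n) laurent \<Rightarrow> ('k, 'n) laurent) \<Rightarrow>
                        (('k, 'n) laurent \<Rightarrow> ('k, 'n) laurent)) monoid)
              \<cong> semidirect_product (padic_power p) (AlgAut laurent_alg) \<phi>"
    using AutOrd_decomposition[OF p] induced_aut_normalizes[OF p]
    by (intro internal_semidirect_product[OF group_AutOrd
          group_padic_power[OF prime_gt_0_nat[OF p(1)]] group_AlgAut_laurent padic_shift_hom[OF p] induced_aut_hom])
      (simp_all only: AlgAut_laurent_carrier)
next
  fix s :: "'n \<Rightarrow> nat \<Rightarrow> int"
  assume "s \<in> carrier (padic_power p)"
  then show "\<exists>!\<rho> :: (('k, 'n) laurent \<Rightarrow> ('k, 'n) laurent) \<Rightarrow> (('k, 'n) laurent \<Rightarrow> ('k, 'n) laurent).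
      is_sigma p s \<rho>"
    using is_sigma_iff[OF assms] by (intro ex1I[of _ "padic_shift p s"]) blast+
next
  fix \<sigma> :: "(('k, 'n) laurent \<Rightarrow> ('k, 'n) laurent) \<Rightarrow> (('k, 'n) laurent \<Rightarrow> ('k, 'n) laurent)"
  assume \<sigma>: "\<sigma> \<in> carrier AutOrd"
  have eq: "sigma p (fst x) \<otimes>\<^bsub>AlgAut diff_alg\<^esub> induced_aut (snd x) =
      padic_shift p (fst x) \<otimes>\<^bsub>AutOrd\<^esub> induced_aut (snd x)"
    if "x \<in> carrier (padic_power p) \<times> carrier (AlgAut laurent_alg)"
    for x :: "('n \<Rightarrow> nat \<Rightarrow> int) \<times> (('k, 'n) laurent \<Rightarrow> ('k, 'n) laurent)"
  proof -
    have s: "fst x \<in> carrier (padic_power p)" and \<tau>: "snd x \<in> alg_auts laurent_alg"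
      using that by (auto simp: AlgAut_laurent_carrier)
    show ?thesis
      unfolding sigma_eq[OF assms s]
        AutOrd_mult[OF padic_shift_AutOrd[OF assms s] induced_aut_AutOrd[OF \<tau>]] ..
  qed
  show "\<exists>!(s\<tau> :: ('n \<Rightarrow> nat \<Rightarrow> int) \<times> (('k, 'n) laurent \<Rightarrow> ('k, 'n) laurent)).
      s\<tau> \<in> carrier (padic_power p) \<times> carrier (AlgAut laurent_alg) \<and>
      \<sigma> = sigma p (fst s\<tau>) \<otimes>\<^bsub>AlgAut diff_alg\<^esub> induced_aut (snd s\<tau>)"
    using AutOrd_decomposition[OF assms \<sigma>] by (simp only: eq cong: conj_cong)
qed

end
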